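(* Let $\Omega\subset\mathbb{R}^n$ be a smooth bounded domain and let $K:[0,+\infty)\to\mathbb{R}$ be a function. Assume that there exists an open interval $I\subseteq(0,+\infty)$ such that the restriction of $K$ to $I$ is (strictly) increasing and $K(I)=(0,+\infty)$. Then, for each $q\in(0,1)$ and each $\alpha\in L^\infty(\Omega)$ with $\alpha>0$ in $\Omega$, the problem $$\begin{cases}-K\left(\int_\Omega|\nabla u(x)|^2dx\right)\Delta u=\alpha(x)u^q & \text{in }\Omega\\ u>0 & \text{in }\Omega\\ u=0 & \text{on }\partial\Omega\\ \int_\Omega|\nabla u(x)|^2dx\in I\end{cases}$$ has a unique weak solution $\tilde u$, and $\tilde u$ is the unique global minimum in $H^1_0(\Omega)$ of the functional $$u\mapsto\frac12K\left(\int_\Omega|\nabla\tilde u(x)|^2dx\right)\int_\Omega|\nabla u(x)|^2dx-\frac{1}{q+1}\int_\Omega\alpha(x)|u^+(x)|^{q+1}dx.$$ Moreover, $\tilde u$ satisfies the inequality $$\left(K\left(\int_\Omega|\nabla\tilde u(x)|^2dx\right)\right)^{\frac{2}{1-q}}\int_\Omega|\nabla\tilde u(x)|^2dx\leq\left[\left(\frac{2}{q+1}\right)^2\left(\frac{\operatorname{ess\,sup}_\Omega\alpha}{\lambda_1}\right)^{q+1}\right]^{\frac{1}{1-q}}\int_\Omega\alpha(x)dx,$$ where $$\lambda_1=\inf_{u\in H^1_0(\Omega)\setminus\{0\}}\frac{\int_\Omega|\nabla u(x)|^2dx}{\int_\Omega|u(x)|^2dx}.$$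
   Context: Here $u^+=\max\{0,u\}$. No continuity of $K$ on $[0,+\infty)$ is assumed. As usual for (classes of) measurable functions, pointwise inequalities such as $\alpha>0$ or $u>0$ in $\Omega$ are understood almost everywhere. A weak solution of the problem is a function $u\in H^1_0(\Omega)$, with $u>0$ in $\Omega$ and $\int_\Omega|\nabla u(x)|^2dx\in I$, such that for every $v\in H^1_0(\Omega)$ the function $x\mapsto\alpha(x)u(x)^q v(x)$ lies in $L^1(\Omega)$ and $$K\left(\int_\Omega|\nabla u(x)|^2dx\right)\int_\Omega\nabla u(x)\cdot\nabla v(x)\,dx-\int_\Omega\alpha(x)u(x)^qv(x)\,dx=0.$$ *)

theory Defs
  imports "HOL-Analysis.Analysis" "HOL-Probability.Essential_Supremum"
begin

section \<open>Smooth functions and smooth bounded domains\<close>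

primrec C_k :: "nat \<Rightarrow> ('a::euclidean_space \<Rightarrow> real) \<Rightarrow> bool" where
  "C_k 0 f \<longleftrightarrow> continuous_on UNIV f"
| "C_k (Suc k) f \<longleftrightarrow>
     f differentiable_on UNIV \<and> (\<forall>h. C_k k (\<lambda>x. frechet_derivative f (at x) h))"

definition smooth :: "('a::euclidean_space \<Rightarrow> real) \<Rightarrow> bool" where
  "smooth f \<longleftrightarrow> (\<forall>k. C_k k f)"

text \<open>Near each boundary point the set is, for some unit vector \<open>\<nu>\<close>, the strict epigraph in
  direction \<open>\<nu>\<close> of a smooth function on the hyperplane orthogonal to \<open>\<nu>\<close>. That function is given by
  a smooth \<open>\<gamma>\<close> on the whole space, evaluated at the orthogonal projection of the point.\<close>

definition smooth_boundary :: "'a::euclidean_space set \<Rightarrow> bool" where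
  "smooth_boundary \<Omega> \<longleftrightarrow>
     (\<forall>z\<in>frontier \<Omega>. \<exists>r>0. \<exists>\<nu> \<gamma>. norm \<nu> = 1 \<and> smooth \<gamma> \<and>
        \<Omega> \<inter> ball z r = {x \<in> ball z r. x \<bullet> \<nu> > \<gamma> (x - (x \<bullet> \<nu>) *\<^sub>R \<nu>)})"

definition smooth_bounded_domain :: "'a::euclidean_space set \<Rightarrow> bool" where
  "smooth_bounded_domain \<Omega> \<longleftrightarrow>
     open \<Omega> \<and> connected \<Omega> \<and> \<Omega> \<noteq> {} \<and> bounded \<Omega> \<and> smooth_boundary \<Omega>"

section \<open>Lebesgue and Sobolev spaces\<close>

text \<open>Elements of the function spaces are represented by functions on the whole space, of which only
  the values on \<open>\<Omega>\<close> matter; equality of classes is equality almost everywhere in \<open>\<Omega>\<close>.\<close>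

definition ae_eq :: "'a::euclidean_space set \<Rightarrow> ('a \<Rightarrow> real) \<Rightarrow> ('a \<Rightarrow> real) \<Rightarrow> bool" where
  "ae_eq \<Omega> u v \<longleftrightarrow> (AE x in lebesgue_on \<Omega>. u x = v x)"

definition L2 :: "'a::euclidean_space set \<Rightarrow> ('a \<Rightarrow> 'b::euclidean_space) set" where
  "L2 \<Omega> = {f \<in> borel_measurable (lebesgue_on \<Omega>). integrable (lebesgue_on \<Omega>) (\<lambda>x. (norm (f x))\<^sup>2)}"

definition L_infinity :: "'a::euclidean_space set \<Rightarrow> ('a \<Rightarrow> real) set" where
  "L_infinity \<Omega> = {f \<in> borel_measurable (lebesgue_on \<Omega>). esssup (lebesgue_on \<Omega>) (\<lambda>x. ereal \<bar>f x\<bar>) < \<infinity>}"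

text \<open>Functions in \<open>C\<^sub>c\<^sup>\<infinity>(\<Omega>)\<close>, extended by zero.\<close>

definition test_function :: "'a::euclidean_space set \<Rightarrow> ('a \<Rightarrow> real) \<Rightarrow> bool" where
  "test_function \<Omega> \<phi> \<longleftrightarrow>
     smooth \<phi> \<and> compact (closure {x. \<phi> x \<noteq> 0}) \<and> closure {x. \<phi> x \<noteq> 0} \<subseteq> \<Omega>"

definition locally_integrable ::
    "'a::euclidean_space set \<Rightarrow> ('a \<Rightarrow> 'b::euclidean_space) \<Rightarrow> bool" where
  "locally_integrable \<Omega> f \<longleftrightarrow> (\<forall>C. compact C \<and> C \<subseteq> \<Omega> \<longrightarrow> integrable (lebesgue_on C) f)"

definition has_weak_gradient ::
    "'a::euclidean_space set \<Rightarrow> ('a \<Rightarrow> real) \<Rightarrow> ('a \<Rightarrow> 'a) \<Rightarrow> bool" where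
  "has_weak_gradient \<Omega> u g \<longleftrightarrow>
     locally_integrable \<Omega> u \<and> locally_integrable \<Omega> g \<and>
     (\<forall>\<phi>. test_function \<Omega> \<phi> \<longrightarrow> (\<forall>b\<in>Basis.
        (\<integral>x. u x * frechet_derivative \<phi> (at x) b \<partial>lebesgue_on \<Omega>) =
        - (\<integral>x. (g x \<bullet> b) * \<phi> x \<partial>lebesgue_on \<Omega>)))"

text \<open>For open \<open>\<Omega>\<close> a weak gradient is unique almost everywhere in \<open>\<Omega>\<close>, so that the choice of
  representative below is immaterial under integrals over \<open>\<Omega>\<close>.\<close>

definition weak_gradient :: "'a::euclidean_space set \<Rightarrow> ('a \<Rightarrow> real) \<Rightarrow> 'a \<Rightarrow> 'a" where
  "weak_gradient \<Omega> u = (SOME g. has_weak_gradient \<Omega> u g)"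

definition H1 :: "'a::euclidean_space set \<Rightarrow> ('a \<Rightarrow> real) set" where
  "H1 \<Omega> = {u \<in> L2 \<Omega>. \<exists>g \<in> L2 \<Omega>. has_weak_gradient \<Omega> u g}"

definition dirichlet_energy :: "'a::euclidean_space set \<Rightarrow> ('a \<Rightarrow> real) \<Rightarrow> real" where
  "dirichlet_energy \<Omega> u = (\<integral>x. (norm (weak_gradient \<Omega> u x))\<^sup>2 \<partial>lebesgue_on \<Omega>)"

definition H1_norm :: "'a::euclidean_space set \<Rightarrow> ('a \<Rightarrow> real) \<Rightarrow> real" where
  "H1_norm \<Omega> u = sqrt ((\<integral>x. (u x)\<^sup>2 \<partial>lebesgue_on \<Omega>) + dirichlet_energy \<Omega> u)"

text \<open>The closure of \<open>C\<^sub>c\<^sup>\<infinity>(\<Omega>)\<close> in \<open>H\<^sup>1(\<Omega>)\<close>.\<close>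

definition H10 :: "'a::euclidean_space set \<Rightarrow> ('a \<Rightarrow> real) set" where
  "H10 \<Omega> = {u \<in> H1 \<Omega>. \<exists>\<phi>. (\<forall>k. test_function \<Omega> (\<phi> k)) \<and>
     (\<lambda>k. H1_norm \<Omega> (\<lambda>x. u x - \<phi> k x)) \<longlonglongrightarrow> 0}"

definition lambda1 :: "'a::euclidean_space set \<Rightarrow> real" where
  "lambda1 \<Omega> = (INF u \<in> {u \<in> H10 \<Omega>. \<not> ae_eq \<Omega> u (\<lambda>x. 0)}.
     dirichlet_energy \<Omega> u / (\<integral>x. \<bar>u x\<bar>\<^sup>2 \<partial>lebesgue_on \<Omega>))"

section \<open>The Kirchhoff problem\<close>

text \<open>\<open>K\<close> is only ever evaluated at nonnegative reals.\<close>

definition weak_solution ::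
    "'a::euclidean_space set \<Rightarrow> (real \<Rightarrow> real) \<Rightarrow> real set \<Rightarrow> real \<Rightarrow> ('a \<Rightarrow> real) \<Rightarrow> ('a \<Rightarrow> real) \<Rightarrow> bool"
  where
  "weak_solution \<Omega> K I q \<alpha> u \<longleftrightarrow>
     u \<in> H10 \<Omega> \<and> (AE x in lebesgue_on \<Omega>. u x > 0) \<and> dirichlet_energy \<Omega> u \<in> I \<and>
     (\<forall>v \<in> H10 \<Omega>.
        integrable (lebesgue_on \<Omega>) (\<lambda>x. \<alpha> x * u x powr q * v x) \<and>
        K (dirichlet_energy \<Omega> u) *
            (\<integral>x. weak_gradient \<Omega> u x \<bullet> weak_gradient \<Omega> v x \<partial>lebesgue_on \<Omega>)
          - (\<integral>x. \<alpha> x * u x powr q * v x \<partial>lebesgue_on \<Omega>) = 0)"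

definition energy_functional ::
    "'a::euclidean_space set \<Rightarrow> real \<Rightarrow> real \<Rightarrow> ('a \<Rightarrow> real) \<Rightarrow> ('a \<Rightarrow> real) \<Rightarrow> real" where
  "energy_functional \<Omega> k q \<alpha> u =
     1 / 2 * k * dirichlet_energy \<Omega> u
     - 1 / (q + 1) * (\<integral>x. \<alpha> x * \<bar>max 0 (u x)\<bar> powr (q + 1) \<partial>lebesgue_on \<Omega>)"

end

theory Submission
  imports Defs
begin

text \<open>
  By scaling, everything reduces to the equation with \<open>K\<close> replaced by the constant \<open>1\<close>: if \<open>u\<close> solves
  it with energy \<open>E\<close>, then \<open>k powr (- 1 / (1 - q)) u\<close> solves the equation with constant \<open>k\<close>, and the
  Kirchhoff condition becomes \<open>K(t) powr (2 / (1 - q)) t = E\<close>, which has exactly one root in \<open>I\<close> by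
  monotonicity. The estimate is Young's inequality applied to \<open>E = \<integral> \<alpha> u powr (q + 1)\<close>.

  Existence uses neither compact embeddings nor a maximum principle. The energy is minimised over
  nonnegative test functions. For such \<open>a\<close>, \<open>b\<close>, comparing with the arithmetic mean \<open>(a + b) / 2\<close> and
  the quadratic mean \<open>sqrt ((a\<^sup>2 + b\<^sup>2) / 2)\<close> bounds the Dirichlet energy of \<open>a - b\<close> by the excess
  of the energies of \<open>a\<close>, \<open>b\<close> over the infimum, so a minimising sequence is Cauchy. The minimiser is
  positive because the sublinear term dominates the quadratic one near \<open>0\<close>.

  For uniqueness, Picone's inequality \<open>\<integral> \<alpha> u powr (q - 1) v\<^sup>2 \<le> k \<integral> |\<nabla>v|\<^sup>2\<close> for a positive weak solution \<open>u\<close>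
  reduces the comparison of the energies of \<open>v\<close> and \<open>u\<close> to a pointwise inequality, which is strict
  unless \<open>v = u\<close>. So every positive weak solution is the unique global minimiser.
\<close>

section \<open>Smooth functions and test functions\<close>

text \<open>The integral term is convex in \<open>u\<close> and enters the energy with a minus sign,
  so comparing with the arithmetic mean alone goes the wrong way. As a functional of
  \<open>u\<^sup>2\<close> it is concave, and the Dirichlet energy is convex along quadratic means,
  but that comparison gives no control of \<open>a - b\<close>. As q + 1 lies strictly between 1 and
  2, the two means can be mixed with weights 1 - q and 2 q: the quadratic mean compensates the
  integral term, and the arithmetic mean supplies the parallelogram deficit.

  The second obstacle is that square roots and quotients of Sobolev functions call for chain rules
  for weak gradients. Here every nonlinear operation is carried out on test functions, regularised
  by a small parameter so that the result is again a test function, and only integral relations pass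
  to the limit. Hence a function in \<open>H10\<close> is always handled as an L2 limit of test
  functions whose gradients converge in L2, and the uniqueness of weak gradients ties this limit to
  the arbitrary choice in \<open>weak_gradient\<close>.\<close>

lemma C_k_SucI:
  assumes "\<And>x. (f has_derivative D x) (at x)" "\<And>h. C_k k (\<lambda>x. D x h)"
  shows "C_k (Suc k) f"
proof -
  have "frechet_derivative f (at x) = D x" for x
    using frechet_derivative_at[OF assms(1)] by simp
  moreover have "f differentiable_on UNIV"
    using assms(1) by (auto simp: differentiable_on_def differentiable_def)
  ultimately show ?thesis using assms(2) by simp
qed

lemma C_k_Suc_has_derivative:
  "C_k (Suc k) f \<Longrightarrow> (f has_derivative frechet_derivative f (at x)) (at x)"
  by (simp add: differentiable_on_def flip: frechet_derivative_works)

lemma C_k_Suc_imp: "C_k (Suc k) f \<Longrightarrow> C_k k f"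
proof (induction k arbitrary: f)
  case 0
  then show ?case by (simp add: differentiable_imp_continuous_on)
next
  case (Suc k)
  then show ?case by (metis C_k.simps(2))
qed

lemma C_k_const: "C_k k (\<lambda>x. c)"
proof (induction k arbitrary: c)
  case (Suc k)
  then show ?case by (intro C_k_SucI[where D="\<lambda>x h. 0"]) auto
qed simp

lemma C_k_inner: "C_k k (\<lambda>x. x \<bullet> b)"
proof (cases k)
  case (Suc m)
  then show ?thesis
    by (auto simp del: C_k.simps intro!: C_k_SucI[where D="\<lambda>x h. h \<bullet> b"] C_k_const derivative_eq_intros)
qed (simp add: continuous_intros)

lemma C_k_add:
  assumes "C_k k f" "C_k k g"
  shows "C_k k (\<lambda>x. f x + g x)"
  using assms
proof (induction k arbitrary: f g)
  case (Suc k)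
  show ?case
    by (rule C_k_SucI, rule has_derivative_add[OF Suc.prems[THEN C_k_Suc_has_derivative]])
      (use Suc in auto)
qed (simp add: continuous_intros)

lemma C_k_mult:
  assumes "C_k k f" "C_k k g"
  shows "C_k k (\<lambda>x. f x * g x)"
  using assms
proof (induction k arbitrary: f g)
  case (Suc k)
  show ?case
    by (rule C_k_SucI, rule has_derivative_mult[OF Suc.prems[THEN C_k_Suc_has_derivative]])
      (use Suc Suc.prems[THEN C_k_Suc_imp] in \<open>auto intro!: C_k_add\<close>)
qed (simp add: continuous_intros)

lemma C_k_powr:
  assumes "C_k k f" "\<And>x. f x > 0"
  shows "C_k k (\<lambda>x. f x powr a)"
  using assms
proof (induction k arbitrary: f a)
  case (Suc k)
  have "((\<lambda>x. f x powr a) has_derivative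
      (\<lambda>h. a * f x powr (a - 1) * frechet_derivative f (at x) h)) (at x)" for x
  proof -
    have "((\<lambda>y. y powr a) has_derivative (\<lambda>h. a * f x powr (a - 1) * h)) (at (f x))"
      using has_real_derivative_powr[OF Suc.prems(2)[of x], of a] Suc.prems(2)[of x]
      by (simp add: has_field_derivative_def)
    from has_derivative_compose[OF C_k_Suc_has_derivative[OF Suc.prems(1)] this]
    show ?thesis .
  qed
  then show ?case
    by (rule C_k_SucI) (use Suc.prems in \<open>intro C_k_mult C_k_const Suc.IH C_k_Suc_imp[OF Suc.prems(1)], simp_all\<close>)
next
  case 0
  then show ?case by (simp, intro continuous_intros) (auto, metis less_irrefl)
qed

text \<open>The flat function exp(- 1/t) is the case n = 0. The powers of 1/t make the family closed
  under differentiation up to linear combinations, so smoothness of all members is one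
  induction.\<close>

definition bump :: "nat \<Rightarrow> real \<Rightarrow> real" where
  "bump n t = (if t \<le> 0 then 0 else (1 / t) ^ n * exp (- (1 / t)))"

lemma bump_nonneg: "bump n t \<ge> 0"
  by (simp add: bump_def)

lemma bump_pos_iff: "bump n t > 0 \<longleftrightarrow> t > 0"
  by (simp add: bump_def)

lemma tendsto_bump_0: "(bump n \<longlongrightarrow> 0) (at 0)"
proof -
  have "((\<lambda>t::real. t ^ n / exp t) \<longlongrightarrow> 0) at_top" by (rule tendsto_power_div_exp_0)
  then have "((\<lambda>t::real. inverse t ^ n / exp (inverse t)) \<longlongrightarrow> 0) (at_right 0)"
    by (rule filterlim_compose[OF _ filterlim_inverse_at_top_right])
  moreover have "eventually (\<lambda>t. inverse t ^ n / exp (inverse t) = bump n t) (at_right 0)"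
    by (auto simp: eventually_at_right_field bump_def exp_minus field_simps intro!: exI[of _ 1])
  ultimately have "(bump n \<longlongrightarrow> 0) (at_right 0)" by (rule Lim_transform_eventually)
  moreover have "eventually (\<lambda>t. 0 = bump n t) (at_left 0)"
    by (auto simp: eventually_at_left_field bump_def intro!: exI[of _ "-1"])
  then have "(bump n \<longlongrightarrow> 0) (at_left 0)" by (rule Lim_transform_eventually[OF tendsto_const])
  ultimately show ?thesis by (simp add: filterlim_split_at)
qed

lemma bump_has_derivative:
  "(bump n has_real_derivative bump (n + 2) t - n * bump (n + 1) t) (at t)"
proof -
  consider "t < 0" | "t = 0" | "t > 0" by linarith
  then show ?thesis
  proof cases
    case 1
    have "((\<lambda>_. 0) has_real_derivative bump (n + 2) t - n * bump (n + 1) t) (at t)"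
      using 1 by (simp add: bump_def)
    then show ?thesis
      by (rule has_field_derivative_transform_within_open[where S="{..<0}"])
        (use 1 in \<open>auto simp: bump_def\<close>)
  next
    case 2
    \<comment> \<open>The difference quotient at 0 is again a member of the family, so its limit is
      already known.\<close>
    have "(\<lambda>h. (bump n h - bump n 0) / (h - 0)) = bump (n + 1)"
      by (auto simp: bump_def fun_eq_iff)
    with tendsto_bump_0[of "n + 1"] show ?thesis
      unfolding has_field_derivative_iff using 2 by (simp add: bump_def)
  next
    case 3
    have "((\<lambda>t. (1 / t) ^ n * exp (- (1 / t))) has_real_derivative
        bump (n + 2) t - n * bump (n + 1) t) (at t)"
    proof -
      \<comment> \<open>Differentiate through r = 1/t, whose derivative is - r^2; this explains the
        shift of the indices by 1 and 2.\<close>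
      have "((\<lambda>r. r ^ n * exp (- r)) has_real_derivative
          (real n * r ^ (n - 1) - r ^ n) * exp (- r)) (at r)" for r
        by (auto intro!: derivative_eq_intros simp: algebra_simps)
      moreover have "((\<lambda>t. 1 / t) has_real_derivative - ((1 / t)\<^sup>2)) (at t)"
        using 3 by (auto intro!: derivative_eq_intros simp: power2_eq_square)
      ultimately have "((\<lambda>t. (1 / t) ^ n * exp (- (1 / t))) has_real_derivative
          (real n * (1 / t) ^ (n - 1) - (1 / t) ^ n) * exp (- (1 / t)) * - ((1 / t)\<^sup>2)) (at t)"
        by (rule DERIV_chain2)
      \<comment> \<open>For n = 0 the truncated exponent n - 1 is multiplied by 0, hence the case
        split.\<close>
      moreover have "(real n * r ^ (n - 1) - r ^ n) * e * - r\<^sup>2 = r ^ (n + 2) * e - n * (r ^ (n + 1) * e)"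
        for r e :: real
        by (cases n) (simp_all add: algebra_simps power2_eq_square)
      ultimately show ?thesis using 3 by (simp add: bump_def)
    qed
    then show ?thesis
      by (rule has_field_derivative_transform_within_open[where S="{0<..}"])
        (use 3 in \<open>auto simp: bump_def\<close>)
  qed
qed

text \<open>The derivative of \<open>bump n\<close> involves \<open>bump (n + 1)\<close> and
  \<open>bump (n + 2)\<close>, so the induction on k must leave n free.\<close>

lemma C_k_bump:
  assumes "C_k k f"
  shows "C_k k (\<lambda>x. bump n (f x))"
  using assms
proof (induction k arbitrary: f n)
  case 0
  have "continuous_on UNIV (bump n)"
    using bump_has_derivative by (meson DERIV_isCont continuous_at_imp_continuous_on)
  with 0 show ?case
    by (auto intro: continuous_on_compose2)
next
  case (Suc k)
  have "((\<lambda>x. bump n (f x)) has_derivative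
      (\<lambda>h. (bump (n + 2) (f x) + (- real n) * bump (n + 1) (f x)) * frechet_derivative f (at x) h)) (at x)" for x
  proof -
    have "(bump n has_derivative (\<lambda>h. (bump (n + 2) (f x) + (- real n) * bump (n + 1) (f x)) * h)) (at (f x))"
      using bump_has_derivative[of n "f x"] by (simp add: has_field_derivative_def)
    from has_derivative_compose[OF C_k_Suc_has_derivative[OF Suc.prems(1)] this]
    show ?thesis .
  qed
  then show ?case
    by (rule C_k_SucI)
      (use Suc.prems in \<open>intro C_k_mult C_k_const C_k_add Suc.IH C_k_Suc_imp[OF Suc.prems(1)], simp\<close>)
qed

section \<open>Closure properties of smooth functions\<close>

lemma smooth_const: "smooth (\<lambda>x. c)"
  and smooth_inner: "smooth (\<lambda>x. x \<bullet> b)"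
  and smooth_add: "smooth f \<Longrightarrow> smooth g \<Longrightarrow> smooth (\<lambda>x. f x + g x)"
  and smooth_mult: "smooth f \<Longrightarrow> smooth g \<Longrightarrow> smooth (\<lambda>x. f x * g x)"
  and smooth_powr: "smooth f \<Longrightarrow> (\<And>x. f x > 0) \<Longrightarrow> smooth (\<lambda>x. f x powr a)"
  and smooth_bump: "smooth f \<Longrightarrow> smooth (\<lambda>x. bump n (f x))"
  unfolding smooth_def
  by (auto intro: C_k_const C_k_inner C_k_add C_k_mult C_k_powr C_k_bump)

lemma smooth_diff:
  assumes "smooth f" "smooth g"
  shows "smooth (\<lambda>x. f x - g x)"
  using smooth_add[OF assms(1) smooth_mult[OF smooth_const[of "-1"] assms(2)]] by simp

lemma smooth_power2: "smooth f \<Longrightarrow> smooth (\<lambda>x. (f x)\<^sup>2)"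
  unfolding power2_eq_square by (rule smooth_mult)

lemma smooth_prod: "(\<And>i. i \<in> A \<Longrightarrow> smooth (f i)) \<Longrightarrow> smooth (\<lambda>x. \<Prod>i\<in>A. f i x)"
  by (induction A rule: infinite_finite_induct) (auto intro!: smooth_const smooth_mult)

lemma smooth_sqrt: "smooth f \<Longrightarrow> (\<And>x. f x > 0) \<Longrightarrow> smooth (\<lambda>x. sqrt (f x))"
  using smooth_powr[of f "1/2"] by (simp add: powr_half_sqrt less_imp_le)

lemma smooth_inverse: "smooth f \<Longrightarrow> (\<And>x. f x > 0) \<Longrightarrow> smooth (\<lambda>x. inverse (f x))"
  using smooth_powr[of f "-1"] by (simp add: powr_minus less_imp_le)

section \<open>Gradients, supports and bounds of test functions\<close>

definition grad :: "('a::euclidean_space \<Rightarrow> real) \<Rightarrow> 'a \<Rightarrow> 'a" where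
  "grad f x = (\<Sum>b\<in>Basis. frechet_derivative f (at x) b *\<^sub>R b)"

lemma gderiv_imp_grad: "GDERIV f x :> D \<Longrightarrow> grad f x = D"
  unfolding grad_def gderiv_def
  by (drule frechet_derivative_at[symmetric]) (simp add: inner_commute[of _ D] euclidean_representation)

lemma smooth_has_derivative: "smooth f \<Longrightarrow> (f has_derivative frechet_derivative f (at x)) (at x)"
  using C_k_Suc_has_derivative unfolding smooth_def by blast

lemma frechet_derivative_eq_grad:
  assumes "smooth f"
  shows "frechet_derivative f (at x) h = grad f x \<bullet> h"
proof -
  interpret bounded_linear "frechet_derivative f (at x)"
    using smooth_has_derivative[OF assms] by (rule has_derivative_bounded_linear)
  have "frechet_derivative f (at x) h = frechet_derivative f (at x) (\<Sum>b\<in>Basis. (h \<bullet> b) *\<^sub>R b)"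
    by (simp add: euclidean_representation)
  also have "\<dots> = h \<bullet> grad f x"
    by (simp add: grad_def inner_sum_right sum scale mult.commute)
  also have "\<dots> = grad f x \<bullet> h" by (rule inner_commute)
  finally show ?thesis .
qed

lemma smooth_gderiv: "smooth f \<Longrightarrow> GDERIV f x :> grad f x"
  unfolding gderiv_def
  by (rule has_derivative_eq_rhs[OF smooth_has_derivative])
    (auto simp: frechet_derivative_eq_grad inner_commute)

lemma smooth_continuous: "smooth f \<Longrightarrow> continuous_on A f"
  using C_k.simps(1) continuous_on_subset unfolding smooth_def by blast

lemma grad_continuous: 
  assumes "smooth f" shows "continuous_on A (grad f)"
proof -
  have "C_k (Suc 0) f" using assms by (auto simp only: smooth_def)
  then have "continuous_on UNIV (\<lambda>x. frechet_derivative f (at x) h)" for h by simp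
  then have "continuous_on A (\<lambda>x. frechet_derivative f (at x) h)" for h
    by (rule continuous_on_subset) simp
  then show ?thesis unfolding grad_def by (intro continuous_intros)
qed

lemma test_functionI:
  assumes "smooth \<phi>" "{x. \<phi> x \<noteq> 0} \<subseteq> C" "compact C" "C \<subseteq> \<Omega>"
  shows "test_function \<Omega> \<phi>"
proof -
  have "closure {x. \<phi> x \<noteq> 0} \<subseteq> C"
    using assms by (simp add: closure_minimal compact_imp_closed)
  then show ?thesis
    using assms unfolding test_function_def
    by (meson closed_closure compact_Int_closed compact_closure bounded_subset compact_imp_bounded closure_subset subset_trans)
qed

lemma test_function_smooth: "test_function \<Omega> \<phi> \<Longrightarrow> smooth \<phi>"
  by (simp add: test_function_def)

lemma test_function_support:
  assumes "test_function \<Omega> \<phi>"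
  obtains C where "compact C" "C \<subseteq> \<Omega>" "\<And>x. x \<notin> C \<Longrightarrow> \<phi> x = 0" "\<And>x. x \<notin> C \<Longrightarrow> grad \<phi> x = 0"
proof (rule that[of "closure {x. \<phi> x \<noteq> 0}"])
  let ?C = "closure {x. \<phi> x \<noteq> 0}"
  show "compact ?C" "?C \<subseteq> \<Omega>" using assms by (auto simp: test_function_def)
  show *: "\<phi> x = 0" if "x \<notin> ?C" for x
    using that closure_subset[of "{x. \<phi> x \<noteq> 0}"] by blast
  show "grad \<phi> x = 0" if "x \<notin> ?C" for x
  proof (rule gderiv_imp_grad)
    have "((\<lambda>_. 0) has_derivative (\<lambda>h. h \<bullet> 0)) (at x)" by simp
    then show "GDERIV \<phi> x :> 0" unfolding gderiv_def
    proof (rule has_derivative_transform_within_open)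
      show "open (- ?C)" by (simp only: open_Compl closed_closure)
      show "x \<in> - ?C" using that by blast
      show "0 = \<phi> y" if "y \<in> - ?C" for y using *[of y, symmetric] that by blast
    qed
  qed
qed

text \<open>Meant for nonlinear expressions in \<open>a\<close> and \<open>b\<close>, such as a
  regularised quadratic mean, which are not products with a compactly supported factor.\<close>

lemma test_function_comb:
  assumes "test_function \<Omega> a" "test_function \<Omega> b" "smooth f"
    "\<And>x. a x = 0 \<Longrightarrow> b x = 0 \<Longrightarrow> f x = 0"
  shows "test_function \<Omega> f"
proof -
  obtain C where C: "compact C" "C \<subseteq> \<Omega>" "\<And>x. x \<notin> C \<Longrightarrow> a x = 0"
    by (rule test_function_support[OF assms(1)]) blast
  obtain C' where C': "compact C'" "C' \<subseteq> \<Omega>" "\<And>x. x \<notin> C' \<Longrightarrow> b x = 0"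
    by (rule test_function_support[OF assms(2)]) blast
  show ?thesis
    by (rule test_functionI[of f "C \<union> C'"]) (use assms(3,4) C C' in \<open>blast intro: compact_Un\<close>)+
qed

lemma test_function_mult_left: "test_function \<Omega> a \<Longrightarrow> smooth f \<Longrightarrow> test_function \<Omega> (\<lambda>x. f x * a x)"
  by (rule test_function_comb[of \<Omega> a a]) (auto intro: smooth_mult dest: test_function_smooth)

lemma test_function_cmult: "test_function \<Omega> a \<Longrightarrow> test_function \<Omega> (\<lambda>x. c * a x)"
  by (rule test_function_mult_left[OF _ smooth_const])

lemma test_function_add:
  "test_function \<Omega> a \<Longrightarrow> test_function \<Omega> b \<Longrightarrow> test_function \<Omega> (\<lambda>x. a x + b x)"
  by (rule test_function_comb[of \<Omega> a b]) (auto intro: smooth_add dest: test_function_smooth)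

lemma test_function_0: "test_function \<Omega> (\<lambda>x. 0)"
  by (rule test_functionI[of _ "{}"]) (auto intro: smooth_const)

lemma grad_add: "smooth f \<Longrightarrow> smooth g \<Longrightarrow> grad (\<lambda>x. f x + g x) x = grad f x + grad g x"
  by (intro gderiv_imp_grad GDERIV_add smooth_gderiv)

lemma grad_mult: "smooth f \<Longrightarrow> smooth g \<Longrightarrow> grad (\<lambda>x. f x * g x) x = f x *\<^sub>R grad g x + g x *\<^sub>R grad f x"
  by (intro gderiv_imp_grad GDERIV_mult smooth_gderiv)

lemma grad_const: "grad (\<lambda>x. c) x = 0"
  by (intro gderiv_imp_grad GDERIV_const)

lemma grad_cmult: "smooth f \<Longrightarrow> grad (\<lambda>x. c * f x) x = c *\<^sub>R grad f x"
  by (simp add: grad_mult smooth_const grad_const)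

lemma grad_inner: "grad (\<lambda>x. x \<bullet> b) x = b"
  by (rule gderiv_imp_grad) (auto simp: gderiv_def intro!: derivative_eq_intros)

lemma grad_compose:
  assumes "smooth f" "(g has_real_derivative g') (at (f x))"
  shows "grad (\<lambda>x. g (f x)) x = g' *\<^sub>R grad f x"
  using GDERIV_DERIV_compose[OF smooth_gderiv[OF assms(1)] assms(2)] by (rule gderiv_imp_grad)

lemma test_function_bounded:
  assumes "test_function \<Omega> \<phi>"
  obtains B where "\<And>x. \<bar>\<phi> x\<bar> \<le> B" "\<And>x. norm (grad \<phi> x) \<le> B" "B > 0"
proof -
  obtain C where C: "compact C" "\<And>x. x \<notin> C \<Longrightarrow> \<phi> x = 0" "\<And>x. x \<notin> C \<Longrightarrow> grad \<phi> x = 0"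
    by (rule test_function_support[OF assms]) blast
  have "bounded (\<phi> ` C)" "bounded (grad \<phi> ` C)"
    using C(1) assms[THEN test_function_smooth]
    by (auto intro!: compact_imp_bounded compact_continuous_image smooth_continuous grad_continuous)
  then obtain B B' where "\<And>x. x \<in> C \<Longrightarrow> \<bar>\<phi> x\<bar> \<le> B" "\<And>x. x \<in> C \<Longrightarrow> norm (grad \<phi> x) \<le> B'"
    by (auto simp: bounded_iff)
  then have "\<bar>\<phi> x\<bar> \<le> max 1 (max B B')" "norm (grad \<phi> x) \<le> max 1 (max B B')" for x
    using C(2,3)[of x] by (cases "x \<in> C"; fastforce)+
  then show ?thesis using that[of "max 1 (max B B')"] by auto
qed

section \<open>Square integrable functions\<close>

text \<open>Fatou's lemma with upper bounds \<open>c k\<close> in place of the integrals themselves.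
  Integrability of the limit is part of the conclusion, because the Bochner integral of a
  non-integrable function is 0 and the inequality alone would carry no information.\<close>

lemma integral_fatou:
  fixes f :: "nat \<Rightarrow> 'a \<Rightarrow> real"
  assumes int: "\<And>k. integrable M (f k)" and [measurable]: "g \<in> borel_measurable M"
    and nonneg: "\<And>k. AE x in M. 0 \<le> f k x"
    and conv: "AE x in M. (\<lambda>k. f k x) \<longlonglongrightarrow> g x"
    and le: "\<And>k. integral\<^sup>L M (f k) \<le> c k" and c: "c \<longlonglongrightarrow> d"
  shows "integrable M g" "AE x in M. 0 \<le> g x" "integral\<^sup>L M g \<le> d"
proof -
  let ?n = "(\<integral>\<^sup>+x. ennreal (g x) \<partial>M)"
  have nonneg': "AE x in M. \<forall>k. 0 \<le> f k x"
    using nonneg by (simp add: AE_all_countable)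
  with conv show g0: "AE x in M. 0 \<le> g x"
    by eventually_elim (auto intro: LIMSEQ_le_const)
  have [measurable]: "f k \<in> borel_measurable M" for k using int by auto
  have c0: "0 \<le> c k" for k
    using integral_nonneg_AE[OF nonneg[of k]] le[of k] by linarith
  have d0: "0 \<le> d" using c c0 by (auto intro: LIMSEQ_le_const)
  have "?n = (\<integral>\<^sup>+x. liminf (\<lambda>k. ennreal (f k x)) \<partial>M)"
  proof (rule nn_integral_cong_AE, use conv in eventually_elim)
    fix x assume "(\<lambda>k. f k x) \<longlonglongrightarrow> g x"
    then have "(\<lambda>k. ennreal (f k x)) \<longlonglongrightarrow> ennreal (g x)" by (rule tendsto_ennrealI)
    then show "ennreal (g x) = liminf (\<lambda>k. ennreal (f k x))"
      by (simp add: lim_imp_Liminf)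
  qed
  also have "\<dots> \<le> liminf (\<lambda>k. \<integral>\<^sup>+x. ennreal (f k x) \<partial>M)"
    by (rule nn_integral_liminf) simp
  also have "\<dots> \<le> liminf (\<lambda>k. ennreal (c k))"
    by (intro Liminf_mono always_eventually allI)
      (simp add: nn_integral_eq_integral int nonneg le ennreal_leI)
  also have "\<dots> = ennreal d"
    using c by (intro lim_imp_Liminf tendsto_ennrealI) auto
  finally have *: "?n \<le> ennreal d" .
  have "(\<integral>\<^sup>+x. ennreal (norm (g x)) \<partial>M) = ?n"
    using g0 by (intro nn_integral_cong_AE) auto
  also have "\<dots> < \<infinity>" using * ennreal_less_top by (simp add: order_le_less_trans)
  finally show gi: "integrable M g" by (simp add: integrable_iff_bounded)
  show "integral\<^sup>L M g \<le> d"
    using * d0 by (simp add: nn_integral_eq_integral[OF gi g0])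
qed

section \<open>Square integrability and the Cauchy-Schwarz inequality\<close>

abbreviation sqnorm :: "'a measure \<Rightarrow> ('a \<Rightarrow> 'b::euclidean_space) \<Rightarrow> real" where
  "sqnorm M f \<equiv> (\<integral>x. (norm (f x))\<^sup>2 \<partial>M)"

definition square_integrable :: "'a measure \<Rightarrow> ('a \<Rightarrow> 'b::euclidean_space) \<Rightarrow> bool" where
  "square_integrable M f \<longleftrightarrow> f \<in> borel_measurable M \<and> integrable M (\<lambda>x. (norm (f x))\<^sup>2)"

lemma L2_iff: "f \<in> L2 \<Omega> \<longleftrightarrow> square_integrable (lebesgue_on \<Omega>) f"
  by (simp add: L2_def square_integrable_def)

lemma square_integrable_measurable: "square_integrable M f \<Longrightarrow> f \<in> borel_measurable M"
  by (simp add: square_integrable_def)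

lemma square_integrable_norm_power2: "square_integrable M f \<Longrightarrow> integrable M (\<lambda>x. (norm (f x))\<^sup>2)"
  by (simp add: square_integrable_def)

lemma square_integrable_power2:
  "square_integrable M f \<Longrightarrow> integrable M (\<lambda>x. (f x :: real)\<^sup>2)"
  by (simp add: square_integrable_def)

lemma square_integrable_inner:
  assumes "square_integrable M f" "square_integrable M g"
  shows "integrable M (\<lambda>x. f x \<bullet> g x)"
proof (rule Bochner_Integration.integrable_bound)
  have [measurable]: "f \<in> borel_measurable M" "g \<in> borel_measurable M"
    using assms by (auto dest: square_integrable_measurable)
  show "integrable M (\<lambda>x. (norm (f x))\<^sup>2 + (norm (g x))\<^sup>2)"
    using assms by (auto dest: square_integrable_norm_power2)
  show "(\<lambda>x. f x \<bullet> g x) \<in> borel_measurable M" by measurable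
  have "\<bar>f x \<bullet> g x\<bar> \<le> (norm (f x))\<^sup>2 + (norm (g x))\<^sup>2" for x
    using Cauchy_Schwarz_ineq2[of "f x" "g x"] sum_squares_bound[of "norm (f x)" "norm (g x)"]
      mult_nonneg_nonneg[of "norm (f x)" "norm (g x)"]
    by simp
  then show "AE x in M. norm (f x \<bullet> g x) \<le> norm ((norm (f x))\<^sup>2 + (norm (g x))\<^sup>2)"
    by simp
qed

lemma square_integrable_mult:
  fixes f g :: "'a \<Rightarrow> real"
  shows "square_integrable M f \<Longrightarrow> square_integrable M g \<Longrightarrow> integrable M (\<lambda>x. f x * g x)"
  using square_integrable_inner[of M f g] by simp

lemma square_integrable_bound:
  fixes f :: "'a \<Rightarrow> 'b::euclidean_space" and g :: "'a \<Rightarrow> 'c::euclidean_space"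
  assumes "square_integrable M g" "f \<in> borel_measurable M" "AE x in M. norm (f x) \<le> norm (g x)"
  shows "square_integrable M f"
  unfolding square_integrable_def
proof (intro conjI Bochner_Integration.integrable_bound[OF square_integrable_norm_power2[OF assms(1)]])
  show "AE x in M. norm ((norm (f x))\<^sup>2) \<le> norm ((norm (g x))\<^sup>2)"
    using assms(3) by eventually_elim (simp add: power_mono)
qed (use assms(2) in measurable)

lemma square_integrable_scaleR: "square_integrable M f \<Longrightarrow> square_integrable M (\<lambda>x. c *\<^sub>R f x)"
  by (auto simp: square_integrable_def power_mult_distrib)

lemma square_integrable_cmult: "square_integrable M f \<Longrightarrow> square_integrable M (\<lambda>x. (c::real) * f x)"
  using square_integrable_scaleR[of M f c] by simp

lemma square_integrable_norm: "square_integrable M f \<Longrightarrow> square_integrable M (\<lambda>x. norm (f x))"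
  by (auto simp: square_integrable_def)

lemma square_integrable_add:
  assumes "square_integrable M f" "square_integrable M g"
  shows "square_integrable M (\<lambda>x. f x + g x)"
proof -
  have "integrable M (\<lambda>x. (norm (f x))\<^sup>2 + (norm (g x))\<^sup>2 + 2 * (f x \<bullet> g x))"
    using assms
    by (intro Bochner_Integration.integrable_add Bochner_Integration.integrable_mult_right square_integrable_inner square_integrable_norm_power2)
  moreover have "(norm (f x + g x))\<^sup>2 = (norm (f x))\<^sup>2 + (norm (g x))\<^sup>2 + 2 * (f x \<bullet> g x)" for x
    by (simp add: power2_norm_eq_inner inner_add_left inner_add_right inner_commute)
  ultimately show ?thesis
    using assms by (auto simp: square_integrable_def)
qed

lemma square_integrable_diff:
  "square_integrable M f \<Longrightarrow> square_integrable M g \<Longrightarrow> square_integrable M (\<lambda>x. f x - g x)"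
  using square_integrable_add[of M f "\<lambda>x. - 1 *\<^sub>R g x"] square_integrable_scaleR[of M g "- 1"]
  by simp

lemma square_integrable_inner_const:
  assumes "square_integrable M f"
  shows "square_integrable M (\<lambda>x. f x \<bullet> b)"
proof (rule square_integrable_bound[OF square_integrable_scaleR[OF assms, of "norm b"]])
  show "(\<lambda>x. f x \<bullet> b) \<in> borel_measurable M"
    using square_integrable_measurable[OF assms] by measurable
  have "norm (f x \<bullet> b) \<le> norm (norm b *\<^sub>R f x)" for x
    using Cauchy_Schwarz_ineq2[of "f x" b] by (simp add: mult.commute)
  then show "AE x in M. norm (f x \<bullet> b) \<le> norm (norm b *\<^sub>R f x)" by simp
qed

lemma square_integrable_quadratic_mean:
  fixes a b :: "'a \<Rightarrow> real"
  assumes "square_integrable M a" "square_integrable M b"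
  shows "square_integrable M (\<lambda>x. sqrt (((a x)\<^sup>2 + (b x)\<^sup>2) / 2))"
proof (rule square_integrable_bound[OF square_integrable_add[OF assms[THEN square_integrable_norm]]])
  note [measurable] = assms[THEN square_integrable_measurable]
  show "(\<lambda>x. sqrt (((a x)\<^sup>2 + (b x)\<^sup>2) / 2)) \<in> borel_measurable M" by measurable
  have "sqrt (((a x)\<^sup>2 + (b x)\<^sup>2) / 2) \<le> \<bar>a x\<bar> + \<bar>b x\<bar>" for x
  proof -
    have "sqrt (((a x)\<^sup>2 + (b x)\<^sup>2) / 2) \<le> sqrt ((a x)\<^sup>2 + (b x)\<^sup>2)" by simp
    also have "\<dots> \<le> \<bar>a x\<bar> + \<bar>b x\<bar>" by (rule sqrt_sum_squares_le_sum_abs)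
    finally show ?thesis .
  qed
  then show "AE x in M. norm (sqrt (((a x)\<^sup>2 + (b x)\<^sup>2) / 2)) \<le> norm (norm (a x) + norm (b x))" by simp
qed

lemma (in finite_measure) square_integrable_bounded:
  assumes "f \<in> borel_measurable M" "\<And>x. norm (f x) \<le> B"
  shows "square_integrable M f"
  unfolding square_integrable_def
proof (intro conjI integrable_const_bound[where B="B\<^sup>2"])
  show "AE x in M. norm ((norm (f x))\<^sup>2) \<le> B\<^sup>2"
    using assms(2) by (auto intro!: power_mono)
qed (use assms(1) in measurable)

lemma (in finite_measure) square_integrable_imp_integrable:
  fixes f :: "'a \<Rightarrow> 'b::euclidean_space"
  assumes "square_integrable M f"
  shows "integrable M f"
proof -
  have "integrable M (\<lambda>x. norm (f x) * 1)"
    using square_integrable_norm[OF assms] square_integrable_bounded[of "\<lambda>x. 1::real" 1]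
    by (intro square_integrable_mult) auto
  then show ?thesis
    using square_integrable_measurable[OF assms] by (simp add: integrable_norm_iff)
qed

lemma integral_Cauchy_Schwarz:
  assumes f: "square_integrable M f" and g: "square_integrable M g"
  shows "\<bar>\<integral>x. f x \<bullet> g x \<partial>M\<bar> \<le> sqrt (sqnorm M f) * sqrt (sqnorm M g)"
proof -
  define A B C where "A = sqnorm M f" and "B = (\<integral>x. f x \<bullet> g x \<partial>M)"
    and "C = sqnorm M g"
  have AC: "A \<ge> 0" "C \<ge> 0" by (simp_all add: A_def C_def)
  have *: "0 \<le> A + 2 * t * B + t\<^sup>2 * C" for t
  proof -
    have "0 \<le> sqnorm M (\<lambda>x. f x + t *\<^sub>R g x)" by simp
    also have "\<dots> = (\<integral>x. (norm (f x))\<^sup>2 + 2 * t * (f x \<bullet> g x) + t\<^sup>2 * (norm (g x))\<^sup>2 \<partial>M)"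
      by (intro Bochner_Integration.integral_cong refl)
        (simp add: power2_norm_eq_inner inner_add_left inner_add_right inner_commute,
          simp add: power2_eq_square)
    also have "\<dots> = A + 2 * t * B + t\<^sup>2 * C"
      using f g by (simp add: A_def B_def C_def square_integrable_inner square_integrable_norm_power2)
    finally show ?thesis .
  qed
  have "B\<^sup>2 \<le> A * C"
  proof (cases "C = 0")
    case True
    have "B = 0"
    proof (rule ccontr)
      assume "B \<noteq> 0"
      \<comment> \<open>With C = 0 the quadratic in t is affine, and at this t it equals -1.\<close>
      with *[of "- (A + 1) / (2 * B)"] True show False by (simp add: field_simps)
    qed
    then show ?thesis using AC by simp
  next
    case False
    then have "C > 0" using AC by simp
    \<comment> \<open>The quadratic evaluated at its vertex t = - B / C.\<close>
    have "0 \<le> A - B\<^sup>2 / C"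
      using *[of "- B / C"] \<open>C > 0\<close> by (simp add: power2_eq_square)
    then show ?thesis using \<open>C > 0\<close> by (simp add: field_simps)
  qed
  then have "sqrt (B\<^sup>2) \<le> sqrt (A * C)" by (rule real_sqrt_le_mono)
  then show ?thesis by (simp add: real_sqrt_mult A_def B_def C_def)
qed

lemma integral_Cauchy_Schwarz_real:
  fixes f g :: "'a \<Rightarrow> real"
  assumes "square_integrable M f" "square_integrable M g"
  shows "\<bar>\<integral>x. f x * g x \<partial>M\<bar> \<le> sqrt (\<integral>x. (f x)\<^sup>2 \<partial>M) * sqrt (\<integral>x. (g x)\<^sup>2 \<partial>M)"
  using integral_Cauchy_Schwarz[OF assms] by simp

text \<open>Square integrability is built in: without it the integral of the squared difference
  could be 0 merely by default.\<close>

definition L2_tendsto ::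
    "'a measure \<Rightarrow> (nat \<Rightarrow> 'a \<Rightarrow> 'b::euclidean_space) \<Rightarrow> ('a \<Rightarrow> 'b) \<Rightarrow> bool" where
  "L2_tendsto M f g \<longleftrightarrow> (\<forall>k. square_integrable M (f k)) \<and> square_integrable M g \<and>
     (\<lambda>k. sqnorm M (\<lambda>x. f k x - g x)) \<longlonglongrightarrow> 0"

lemma L2_tendsto_const: "square_integrable M f \<Longrightarrow> L2_tendsto M (\<lambda>k. f) f"
  by (simp add: L2_tendsto_def)

lemma L2_tendsto_subseq:
  "L2_tendsto M f g \<Longrightarrow> strict_mono r \<Longrightarrow> L2_tendsto M (\<lambda>k. f (r k)) g"
  unfolding L2_tendsto_def
  using LIMSEQ_subseq_LIMSEQ[of "\<lambda>k. sqnorm M (\<lambda>x. f k x - g x)" 0 r] by (auto simp: o_def)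

lemma L2_tendsto_norm_diff: "L2_tendsto M f g \<Longrightarrow> (\<lambda>k. sqrt (sqnorm M (\<lambda>x. f k x - g x))) \<longlonglongrightarrow> 0"
  unfolding L2_tendsto_def using tendsto_real_sqrt by fastforce

lemma L2_tendsto_inner:
  assumes "L2_tendsto M f f'" "L2_tendsto M g g'"
  shows "(\<lambda>k. \<integral>x. f k x \<bullet> g k x \<partial>M) \<longlonglongrightarrow> (\<integral>x. f' x \<bullet> g' x \<partial>M)"
proof (rule LIM_zero_cancel, rule Lim_null_comparison)
  let ?n = "\<lambda>h::'a \<Rightarrow> 'b. sqrt (sqnorm M h)"
  let ?F = "\<lambda>k x. f k x - f' x" and ?G = "\<lambda>k x. g k x - g' x"
  have si: "square_integrable M (f k)" "square_integrable M f'"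
    "square_integrable M (g k)" "square_integrable M g'" for k
    using assms by (auto simp: L2_tendsto_def)
  have si': "square_integrable M (?F k)" "square_integrable M (?G k)" for k
    by (intro square_integrable_diff si)+
  have "(\<integral>x. f k x \<bullet> g k x \<partial>M) - (\<integral>x. f' x \<bullet> g' x \<partial>M)
      = (\<integral>x. ?F k x \<bullet> ?G k x \<partial>M) + (\<integral>x. ?F k x \<bullet> g' x \<partial>M) + (\<integral>x. f' x \<bullet> ?G k x \<partial>M)" for k
    by (simp add: inner_diff_left inner_diff_right square_integrable_inner si)
  then show "\<forall>\<^sub>F k in sequentially.
      norm ((\<integral>x. f k x \<bullet> g k x \<partial>M) - (\<integral>x. f' x \<bullet> g' x \<partial>M))
        \<le> ?n (?F k) * ?n (?G k) + ?n (?F k) * ?n g' + ?n f' * ?n (?G k)"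
    using integral_Cauchy_Schwarz[OF si'] integral_Cauchy_Schwarz[OF si'(1) si(4)]
      integral_Cauchy_Schwarz[OF si(2) si'(2)]
    by (intro always_eventually allI) (simp only: real_norm_def, intro order_trans[OF abs_triangle_ineq] add_mono)
  have "(\<lambda>k. ?n (?F k) * ?n (?G k) + ?n (?F k) * ?n g' + ?n f' * ?n (?G k)) \<longlonglongrightarrow> 0 * 0 + 0 * ?n g' + ?n f' * 0"
    by (intro tendsto_intros L2_tendsto_norm_diff assms)
  then show "(\<lambda>k. ?n (?F k) * ?n (?G k) + ?n (?F k) * ?n g' + ?n f' * ?n (?G k)) \<longlonglongrightarrow> 0"
    by simp
qed

lemma L2_tendsto_norm_power2:
  "L2_tendsto M f g \<Longrightarrow> (\<lambda>k. sqnorm M (\<lambda>x. f k x)) \<longlonglongrightarrow> sqnorm M g"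
  using L2_tendsto_inner[of M f g f g] by (simp add: power2_norm_eq_inner)

lemma L2_tendsto_scaleR:
  assumes "L2_tendsto M f g" shows "L2_tendsto M (\<lambda>k x. c *\<^sub>R f k x) (\<lambda>x. c *\<^sub>R g x)"
proof -
  have "(\<lambda>k. c\<^sup>2 * sqnorm M (\<lambda>x. f k x - g x)) \<longlonglongrightarrow> c\<^sup>2 * 0"
    using assms by (intro tendsto_intros) (auto simp: L2_tendsto_def)
  then show ?thesis
    using assms
    by (auto simp: L2_tendsto_def square_integrable_scaleR power_mult_distrib simp flip: scaleR_diff_right)
qed

lemma L2_tendsto_add:
  assumes "L2_tendsto M f f'" "L2_tendsto M g g'"
  shows "L2_tendsto M (\<lambda>k x. f k x + g k x) (\<lambda>x. f' x + g' x)"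
proof -
  let ?s = "\<lambda>k x. (f k x + g k x) - (f' x + g' x)"
  let ?F = "\<lambda>k. sqnorm M (\<lambda>x. f k x - f' x)"
  let ?G = "\<lambda>k. sqnorm M (\<lambda>x. g k x - g' x)"
  have si: "square_integrable M (f k)" "square_integrable M f'"
    "square_integrable M (g k)" "square_integrable M g'" for k
    using assms by (auto simp: L2_tendsto_def)
  have "(\<lambda>k. sqnorm M (\<lambda>x. ?s k x)) \<longlonglongrightarrow> 0"
  proof (rule tendsto_sandwich[OF _ _ tendsto_const])
    show "\<forall>\<^sub>F k in sequentially. (sqnorm M (\<lambda>x. ?s k x))
        \<le> 2 * ?F k + 2 * ?G k"
    proof (intro always_eventually allI)
      fix k
      have "(sqnorm M (\<lambda>x. ?s k x))
          \<le> (\<integral>x. 2 * (norm (f k x - f' x))\<^sup>2 + 2 * (norm (g k x - g' x))\<^sup>2 \<partial>M)"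
      proof (rule integral_mono)
        show "integrable M (\<lambda>x. (norm (?s k x))\<^sup>2)"
          "integrable M (\<lambda>x. 2 * (norm (f k x - f' x))\<^sup>2 + 2 * (norm (g k x - g' x))\<^sup>2)"
          using si by (auto intro!: square_integrable_norm_power2 square_integrable_diff
              square_integrable_add Bochner_Integration.integrable_add)
        fix x
        have "norm (?s k x) \<le> norm (f k x - f' x) + norm (g k x - g' x)"
          using norm_triangle_ineq[of "f k x - f' x" "g k x - g' x"] by (simp add: algebra_simps)
        then have "(norm (?s k x))\<^sup>2 \<le> (norm (f k x - f' x) + norm (g k x - g' x))\<^sup>2"
          by (rule power_mono) simp
        also have "\<dots> \<le> 2 * (norm (f k x - f' x))\<^sup>2 + 2 * (norm (g k x - g' x))\<^sup>2"
          using sum_squares_bound[of "norm (f k x - f' x)" "norm (g k x - g' x)"]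
          by (simp add: power2_sum)
        finally show "(norm (?s k x))\<^sup>2
            \<le> 2 * (norm (f k x - f' x))\<^sup>2 + 2 * (norm (g k x - g' x))\<^sup>2" .
      qed
      also have "\<dots> = 2 * ?F k + 2 * ?G k"
        using si by (simp add: square_integrable_norm_power2 square_integrable_diff)
      finally show "(sqnorm M (\<lambda>x. ?s k x))
        \<le> 2 * ?F k + 2 * ?G k" .
    qed
    have "(\<lambda>k. 2 * ?F k + 2 * ?G k) \<longlonglongrightarrow> 2 * 0 + 2 * 0"
      using assms by (intro tendsto_intros) (auto simp: L2_tendsto_def)
    then show "(\<lambda>k. 2 * ?F k + 2 * ?G k) \<longlonglongrightarrow> 0"
      by simp
  qed simp
  then show ?thesis
    using si by (simp add: L2_tendsto_def square_integrable_add)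
qed

lemma L2_tendsto_subseq_AE:
  assumes "L2_tendsto M f g"
  obtains r where "strict_mono r" "AE x in M. (\<lambda>k. f (r k) x) \<longlonglongrightarrow> g x"
proof -
  have "integrable M (\<lambda>x. (norm (f k x - g x))\<^sup>2)" for k
    using assms by (auto simp: L2_tendsto_def intro!: square_integrable_norm_power2 square_integrable_diff)
  moreover have "(\<lambda>k. \<integral>x. norm ((norm (f k x - g x))\<^sup>2) \<partial>M) \<longlonglongrightarrow> 0"
    using assms by (simp add: L2_tendsto_def)
  ultimately obtain r where r: "strict_mono r"
    "AE x in M. (\<lambda>k. (norm (f (r k) x - g x))\<^sup>2) \<longlonglongrightarrow> 0"
    using tendsto_L1_AE_subseq[of M "\<lambda>k x. (norm (f k x - g x))\<^sup>2"] by blast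
  from r(2) have "AE x in M. (\<lambda>k. f (r k) x) \<longlonglongrightarrow> g x"
  proof eventually_elim
    case (elim x)
    then have "(\<lambda>k. sqrt ((norm (f (r k) x - g x))\<^sup>2)) \<longlonglongrightarrow> sqrt 0" by (rule tendsto_real_sqrt)
    then show ?case by (simp add: tendsto_norm_zero_iff LIM_zero_iff)
  qed
  with r(1) show ?thesis by (rule that)
qed

text \<open>On a finite measure space an L2 Cauchy sequence is L1 Cauchy, so a subsequence converges
  almost everywhere. Fatou's lemma, applied along this subsequence to the differences with a fixed
  \<open>f i\<close>, shows that the pointwise limit is also the L2 limit.\<close>

lemma (in finite_measure) L2_complete:
  fixes f :: "nat \<Rightarrow> 'a \<Rightarrow> 'b::euclidean_space"
  assumes si: "\<And>k. square_integrable M (f k)"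
    and Cauchy: "\<And>e. e > 0 \<Longrightarrow> \<exists>N. \<forall>i\<ge>N. \<forall>j\<ge>N. (sqnorm M (\<lambda>x. f i x - f j x)) < e"
  obtains g where "L2_tendsto M f g"
proof -
  let ?o = "sqrt (\<integral>x. (1::real)\<^sup>2 \<partial>M)"
  let ?D = "\<lambda>i j. sqnorm M (\<lambda>x. f i x - f j x)"
  have [measurable]: "f k \<in> borel_measurable M" for k
    using si by (rule square_integrable_measurable)
  \<comment> \<open>The added 1 makes the divisor positive even when the whole space is
    null.\<close>
  define m where "m = ?o + 1"
  have "(\<integral>x. (1::real)\<^sup>2 \<partial>M) \<ge> 0" by simp
  then have "m > 0" by (simp add: m_def add_nonneg_pos)
  have "\<exists>N. \<forall>i\<ge>N. \<forall>j\<ge>N. (\<integral>x. norm (f i x - f j x) \<partial>M) < e" if "e > 0" for e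
  proof -
    obtain N where N: "(?D i j) < (e / m)\<^sup>2" if "i \<ge> N" "j \<ge> N" for i j
      using Cauchy[of "(e / m)\<^sup>2"] \<open>e > 0\<close> \<open>m > 0\<close> by (metis divide_pos_pos zero_less_power)
    have "(\<integral>x. norm (f i x - f j x) \<partial>M) < e" if "i \<ge> N" "j \<ge> N" for i j
    proof -
      have "(\<integral>x. norm (f i x - f j x) \<partial>M) \<le> \<bar>\<integral>x. norm (f i x - f j x) * 1 \<partial>M\<bar>" by simp
      also have "\<dots> \<le> sqrt (?D i j) * ?o"
        by (intro integral_Cauchy_Schwarz_real square_integrable_norm square_integrable_diff si
            square_integrable_bounded[where B=1]) auto
      also have "\<dots> \<le> sqrt (?D i j) * m"
        by (intro mult_left_mono) (auto simp: m_def)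
      also have "\<dots> < sqrt ((e / m)\<^sup>2) * m"
        using N[OF that] \<open>m > 0\<close> by (intro mult_strict_right_mono real_sqrt_less_mono)
      also have "\<dots> = e" using \<open>m > 0\<close> \<open>e > 0\<close> by simp
      finally show ?thesis .
    qed
    then show ?thesis by blast
  qed
  from cauchy_L1_AE_cauchy_subseq[of M f, OF square_integrable_imp_integrable[OF si] this]
  obtain r where r: "strict_mono r" "AE x in M. Cauchy (\<lambda>k. f (r k) x)" by blast
  define g where "g x = lim (\<lambda>k. f (r k) x)" for x
  have [measurable]: "g \<in> borel_measurable M" unfolding g_def by measurable
  have g: "AE x in M. (\<lambda>k. f (r k) x) \<longlonglongrightarrow> g x"
    using r(2) by eventually_elim (simp add: g_def Cauchy_convergent_iff convergent_LIMSEQ_iff)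
  have tail: "\<exists>N. \<forall>i\<ge>N. square_integrable M (\<lambda>x. f i x - g x) \<and> (sqnorm M (\<lambda>x. f i x - g x)) \<le> e"
    if "e > 0" for e
  proof -
    obtain N where N: "\<And>i j. i \<ge> N \<Longrightarrow> j \<ge> N \<Longrightarrow> (?D i j) < e"
      using Cauchy[OF \<open>e > 0\<close>] by blast
    have "square_integrable M (\<lambda>x. f i x - g x) \<and> (sqnorm M (\<lambda>x. f i x - g x)) \<le> e" if "i \<ge> N" for i
    proof -
      \<comment> \<open>The shift by N puts all indices r (k + N) beyond N, since r j \<ge>
        j.\<close>
      have int: "integrable M (\<lambda>x. (norm (f i x - f (r (k + N)) x))\<^sup>2)" for k
        by (intro square_integrable_norm_power2 square_integrable_diff si)
      have lim: "AE x in M. (\<lambda>k. (norm (f i x - f (r (k + N)) x))\<^sup>2) \<longlonglongrightarrow> (norm (f i x - g x))\<^sup>2"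
        using g
      proof eventually_elim
        case (elim x)
        from LIMSEQ_ignore_initial_segment[OF this, of N] show ?case by (intro tendsto_intros)
      qed
      have le: "sqnorm M (\<lambda>x. f i x - f (r (k + N)) x) \<le> e" for k
        using N[OF that, of "r (k + N)"] seq_suble[OF r(1), of "k + N"] by simp
      show ?thesis
        using integral_fatou(1,3)[OF int _ _ lim le tendsto_const]
        by (simp add: square_integrable_def)
    qed
    then show ?thesis by blast
  qed
  obtain N where "square_integrable M (\<lambda>x. f N x - g x)" using tail[of 1] by auto
  from square_integrable_diff[OF si[of N] this] have gsi: "square_integrable M g" by simp
  have "(\<lambda>k. sqnorm M (\<lambda>x. f k x - g x)) \<longlonglongrightarrow> 0"
  proof (rule LIMSEQ_I)
    fix e :: real assume "e > 0"
    then obtain N where "\<forall>i\<ge>N. (sqnorm M (\<lambda>x. f i x - g x)) \<le> e / 2"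
      using tail[of "e / 2"] by auto
    with \<open>e > 0\<close> show "\<exists>N. \<forall>k\<ge>N. norm (sqnorm M (\<lambda>x. f k x - g x) - 0) < e"
      by (intro exI[of _ N]) fastforce
  qed
  with gsi si show ?thesis by (intro that[of g]) (simp add: L2_tendsto_def)
qed

text \<open>Nonlinear coefficients of approximating functions converge only almost everywhere;
  multiplying them into a fixed L2 function upgrades this to strong L2 convergence.\<close>

lemma L2_tendsto_dominated:
  fixes f :: "'a \<Rightarrow> 'b::euclidean_space"
  assumes f: "square_integrable M f"
    and meas: "\<And>k. c k \<in> borel_measurable M" "d \<in> borel_measurable M"
    and bound: "\<And>k x. \<bar>c k x\<bar> \<le> C"
    and conv: "AE x in M. (\<lambda>k. c k x) \<longlonglongrightarrow> d x"
  shows "L2_tendsto M (\<lambda>k x. c k x *\<^sub>R f x) (\<lambda>x. d x *\<^sub>R f x)"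
proof -
  note [measurable] = square_integrable_measurable[OF f] meas
  \<comment> \<open>The bound holds at every point, so any point will do, here
    \<open>undefined\<close>.\<close>
  have C: "C \<ge> 0" using bound[of 0 undefined] by linarith
  have si: "square_integrable M (\<lambda>x. e x *\<^sub>R f x)"
    if "e \<in> borel_measurable M" "AE x in M. \<bar>e x\<bar> \<le> C" for e
  proof (rule square_integrable_bound[OF square_integrable_scaleR[OF f, of C]])
    show "(\<lambda>x. e x *\<^sub>R f x) \<in> borel_measurable M" using that by measurable
    show "AE x in M. norm (e x *\<^sub>R f x) \<le> norm (C *\<^sub>R f x)"
      using that(2) by eventually_elim (use C in \<open>simp add: mult_right_mono\<close>)
  qed
  have d_le: "AE x in M. \<bar>d x\<bar> \<le> C"
    using conv
  proof eventually_elim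
    case (elim x)
    from tendsto_rabs[OF this] show ?case
      by (rule LIMSEQ_le_const2) (use bound in auto)
  qed
  have "(\<lambda>k. sqnorm M (\<lambda>x. c k x *\<^sub>R f x - d x *\<^sub>R f x)) \<longlonglongrightarrow> (\<integral>x. 0 \<partial>M)"
  proof (rule integral_dominated_convergence)
    show "integrable M (\<lambda>x. (2 * C)\<^sup>2 * (norm (f x))\<^sup>2)"
      using square_integrable_norm_power2[OF f] by simp
    show "AE x in M. (\<lambda>k. (norm (c k x *\<^sub>R f x - d x *\<^sub>R f x))\<^sup>2) \<longlonglongrightarrow> 0"
      using conv
    proof eventually_elim
      case (elim x)
      then have "(\<lambda>k. (norm (c k x *\<^sub>R f x - d x *\<^sub>R f x))\<^sup>2) \<longlonglongrightarrow> (norm (d x *\<^sub>R f x - d x *\<^sub>R f x))\<^sup>2"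
        by (intro tendsto_intros)
      then show ?case by simp
    qed
    show "AE x in M. norm ((norm (c k x *\<^sub>R f x - d x *\<^sub>R f x))\<^sup>2) \<le> (2 * C)\<^sup>2 * (norm (f x))\<^sup>2" for k
      using d_le
    proof eventually_elim
      case (elim x)
      have "\<bar>c k x - d x\<bar> \<le> 2 * C" using elim bound[of k x] by linarith
      then have "\<bar>c k x - d x\<bar> * norm (f x) \<le> 2 * C * norm (f x)" by (rule mult_right_mono) simp
      then have "(\<bar>c k x - d x\<bar> * norm (f x))\<^sup>2 \<le> (2 * C * norm (f x))\<^sup>2" by (rule power_mono) simp
      then show ?case by (simp add: power_mult_distrib flip: scaleR_diff_left)
    qed
  qed measurable
  then show ?thesis
    using si d_le bound meas by (auto simp: L2_tendsto_def)
qed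

section \<open>Integration by parts and the Poincare inequality\<close>

lemma integrable_lborel_compact_support:
  fixes f :: "'a::euclidean_space \<Rightarrow> 'b::euclidean_space"
  assumes "continuous_on UNIV f" "compact C" "\<And>x. x \<notin> C \<Longrightarrow> f x = 0"
  shows "integrable lborel f"
proof -
  have "integrable lborel (\<lambda>x. indicator C x *\<^sub>R f x)"
    using assms by (intro borel_integrable_compact) (auto intro: continuous_on_subset)
  moreover have "(\<lambda>x. indicator C x *\<^sub>R f x) = f"
    using assms(3) by (auto simp: fun_eq_iff indicator_def)
  ultimately show ?thesis by simp
qed

lemma integral_lborel_translate:
  fixes f :: "'a::euclidean_space \<Rightarrow> real"
  assumes [measurable]: "f \<in> borel_measurable borel"
  shows "(\<integral>x. f (c + x) \<partial>lborel) = (\<integral>x. f x \<partial>lborel)"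
proof -
  have "(\<integral>x. f x \<partial>lborel) = (\<integral>x. f x \<partial>(distr lborel borel ((+) c)))"
    by (simp add: lborel_distr_plus)
  also have "\<dots> = (\<integral>x. f (c + x) \<partial>lborel)" by (rule integral_distr) auto
  finally show ?thesis by simp
qed

lemma smooth_lipschitz:
  assumes "smooth f" "\<And>x. norm (grad f x) \<le> B"
  shows "\<bar>f x - f y\<bar> \<le> B * norm (x - y)"
proof -
  have "norm (f x - f y) \<le> B * norm (x - y)"
  proof (rule differentiable_bound[of UNIV])
    show "(f has_derivative (\<lambda>h. h \<bullet> grad f x)) (at x within UNIV)" for x
      using smooth_gderiv[OF assms(1)] by (simp add: gderiv_def)
    show "onorm (\<lambda>h. h \<bullet> grad f x) \<le> B" for x
    proof (rule onorm_le)
      fix h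
      have "norm (h \<bullet> grad f x) \<le> norm (grad f x) * norm h"
        using Cauchy_Schwarz_ineq2[of h "grad f x"] by (simp add: mult.commute)
      also have "\<dots> \<le> B * norm h" by (intro mult_right_mono assms(2)) simp
      finally show "norm (h \<bullet> grad f x) \<le> B * norm h" .
    qed
  qed auto
  then show ?thesis by simp
qed

text \<open>By translation invariance every difference quotient in direction \<open>b\<close> has
  integral 0, and dominated convergence passes this on to the directional derivative.\<close>

lemma integral_lborel_grad:
  fixes f :: "'a::euclidean_space \<Rightarrow> real"
  assumes "test_function UNIV f"
  shows "(\<integral>x. grad f x \<bullet> b \<partial>lborel) = 0"
proof -
  have sm: "smooth f" using assms by (rule test_function_smooth)
  obtain C where C: "compact C" "\<And>x. x \<notin> C \<Longrightarrow> f x = 0"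
    by (rule test_function_support[OF assms]) blast
  obtain B where B: "\<And>x. norm (grad f x) \<le> B" "B > 0"
    by (rule test_function_bounded[OF assms]) blast
  obtain R where R: "\<And>x. x \<in> C \<Longrightarrow> norm x \<le> R"
    using compact_imp_bounded[OF C(1)] by (auto simp: bounded_iff)
  define h where "h n = 1 / real (Suc n)" for n
  have h: "0 < h n" "h n \<le> 1" for n by (auto simp: h_def)
  have h_lim: "filterlim h (at 0) sequentially"
    unfolding filterlim_at using LIMSEQ_Suc[OF lim_1_over_n] by (auto simp: h_def[abs_def])
  define F where "F n x = (f (h n *\<^sub>R b + x) - f x) / h n" for n x
  have f_int: "integrable lborel f"
    using smooth_continuous[OF sm] C by (rule integrable_lborel_compact_support)
  have meas[measurable]: "f \<in> borel_measurable borel" "grad f \<in> borel_measurable borel"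
    using smooth_continuous[OF sm, of UNIV] grad_continuous[OF sm, of UNIV]
    by (auto intro: borel_measurable_continuous_onI)
  have "(\<lambda>n. \<integral>x. F n x \<partial>lborel) \<longlonglongrightarrow> (\<integral>x. grad f x \<bullet> b \<partial>lborel)"
  proof (rule integral_dominated_convergence)
    \<comment> \<open>Steps have length at most \<open>norm b\<close>, so all quotients vanish
      outside this ball, and the Lipschitz bound dominates them inside.\<close>
    show "integrable lborel (\<lambda>x. indicator (cball 0 (R + norm b)) x *\<^sub>R (B * norm b))"
      by (rule borel_integrable_compact) auto
    show "AE x in lborel. (\<lambda>n. F n x) \<longlonglongrightarrow> grad f x \<bullet> b"
    proof (intro always_eventually allI)
      fix x
      have "((\<lambda>t. f (t *\<^sub>R b + x)) has_real_derivative grad f x \<bullet> b) (at 0)"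
      proof -
        have "((\<lambda>t. f (t *\<^sub>R b + x)) has_derivative (\<lambda>t. (t *\<^sub>R b) \<bullet> grad f x)) (at 0)"
          by (rule has_derivative_compose[of "\<lambda>t. t *\<^sub>R b + x" "\<lambda>t. t *\<^sub>R b" 0 UNIV f])
            (use smooth_gderiv[OF sm, of x] in \<open>auto simp: gderiv_def intro!: derivative_eq_intros\<close>)
        then show ?thesis
          by (simp add: has_field_derivative_def inner_commute mult_commute_abs)
      qed
      then have "((\<lambda>t. (f (t *\<^sub>R b + x) - f x) / t) \<longlongrightarrow> grad f x \<bullet> b) (at 0)"
        by (simp add: has_field_derivative_iff)
      from filterlim_compose[OF this h_lim] show "(\<lambda>n. F n x) \<longlonglongrightarrow> grad f x \<bullet> b"
        by (simp add: F_def)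
    qed
    show "AE x in lborel. norm (F n x) \<le> indicator (cball 0 (R + norm b)) x *\<^sub>R (B * norm b)" for n
    proof (intro always_eventually allI)
      fix x
      show "norm (F n x) \<le> indicator (cball 0 (R + norm b)) x *\<^sub>R (B * norm b)"
      proof (cases "norm x \<le> R + norm b")
        case True
        have "\<bar>f (h n *\<^sub>R b + x) - f x\<bar> \<le> B * norm (h n *\<^sub>R b + x - x)"
          by (rule smooth_lipschitz[OF sm B(1)])
        then have "\<bar>F n x\<bar> \<le> B * norm b"
          using h[of n] by (simp add: F_def abs_mult field_simps)
        with True show ?thesis by simp
      next
        case False
        have "norm x \<le> norm (h n *\<^sub>R b + x) + norm (h n *\<^sub>R b)"
          using norm_triangle_ineq4[of "h n *\<^sub>R b + x" "h n *\<^sub>R b"] by simp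
        moreover have "norm (h n *\<^sub>R b) \<le> norm b"
          using h[of n] by (simp add: mult_left_le_one_le)
        ultimately have "h n *\<^sub>R b + x \<notin> C" "x \<notin> C"
          using False R[of "h n *\<^sub>R b + x"] R[of x] norm_ge_zero[of b] by linarith+
        then show ?thesis using False C(2) by (simp add: F_def)
      qed
    qed
  qed (auto simp: F_def)
  moreover have "(\<integral>x. F n x \<partial>lborel) = 0" for n
  proof -
    have "integrable lborel (\<lambda>x. f (h n *\<^sub>R b + x))"
    proof -
      have "integrable (distr lborel borel ((+) (h n *\<^sub>R b))) f"
        using f_int by (simp add: lborel_distr_plus)
      then show ?thesis by (subst (asm) integrable_distr_eq) auto
    qed
    then show ?thesis
      unfolding F_def using f_int integral_lborel_translate[OF meas(1), of "h n *\<^sub>R b"] by simp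
  qed
  ultimately show ?thesis by (simp add: LIMSEQ_const_iff)
qed

section \<open>Integration by parts on a bounded open set\<close>

locale bounded_open_set =
  fixes \<Omega> :: "'a::euclidean_space set"
  assumes open_domain: "open \<Omega>" and bounded_domain: "bounded \<Omega>"
begin

abbreviation M :: "'a measure" where "M \<equiv> lebesgue_on \<Omega>"

lemma lmeasurable_domain: "\<Omega> \<in> lmeasurable"
  using open_domain bounded_domain by (rule lmeasurable_open[rotated])

lemma sets_domain: "\<Omega> \<in> sets lebesgue"
  using lmeasurable_domain by blast

sublocale finite_measure M
  by (rule finite_measure_lebesgue_on[OF lmeasurable_domain])

lemma integral_eq_lborel:
  fixes f :: "'a \<Rightarrow> real"
  assumes "continuous_on UNIV f" "\<And>x. x \<notin> \<Omega> \<Longrightarrow> f x = 0"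
  shows "(\<integral>x. f x \<partial>M) = (\<integral>x. f x \<partial>lborel)"
proof -
  have "(\<integral>x. f x \<partial>M) = (\<integral>x. (if x \<in> \<Omega> then f x else 0) \<partial>lebesgue)"
    by (simp add: Lebesgue_Measure.integral_restrict_UNIV sets_domain)
  also have "(\<lambda>x. if x \<in> \<Omega> then f x else 0) = f" using assms(2) by auto
  also have "(\<integral>x. f x \<partial>lebesgue) = (\<integral>x. f x \<partial>lborel)"
    using assms(1) by (intro integral_completion) (simp add: borel_measurable_continuous_onI)
  finally show ?thesis .
qed

lemma measurable_continuous: "continuous_on UNIV f \<Longrightarrow> f \<in> borel_measurable M"
  by (rule continuous_imp_measurable_on_sets_lebesgue[OF continuous_on_subset sets_domain]) auto

lemma test_function_measurable:
  assumes "smooth \<phi>"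
  shows "\<phi> \<in> borel_measurable M" "grad \<phi> \<in> borel_measurable M"
  using assms by (auto intro!: measurable_continuous smooth_continuous grad_continuous)

lemma test_function_L2:
  assumes "test_function \<Omega> \<phi>"
  shows "square_integrable M \<phi>" "square_integrable M (grad \<phi>)"
proof -
  obtain B where "\<And>x. \<bar>\<phi> x\<bar> \<le> B" "\<And>x. norm (grad \<phi> x) \<le> B"
    by (rule test_function_bounded[OF assms]) blast
  then show "square_integrable M \<phi>" "square_integrable M (grad \<phi>)"
    using test_function_measurable[OF test_function_smooth[OF assms]]
    by (auto intro!: square_integrable_bounded[where B=B])
qed

lemma integral_grad:
  assumes "test_function \<Omega> f"
  shows "(\<integral>x. grad f x \<bullet> b \<partial>M) = 0"
proof -
  obtain C where C: "compact C" "C \<subseteq> \<Omega>" "\<And>x. x \<notin> C \<Longrightarrow> grad f x = 0"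
    by (rule test_function_support[OF assms]) blast
  have "continuous_on UNIV (\<lambda>x. grad f x \<bullet> b)"
    by (intro continuous_intros grad_continuous test_function_smooth[OF assms])
  then have "(\<integral>x. grad f x \<bullet> b \<partial>M) = (\<integral>x. grad f x \<bullet> b \<partial>lborel)"
    using C by (intro integral_eq_lborel) force+
  also have "\<dots> = 0"
    using assms by (intro integral_lborel_grad) (auto simp: test_function_def)
  finally show ?thesis .
qed

lemma integral_by_parts:
  assumes "test_function \<Omega> \<psi>" "test_function \<Omega> \<phi>"
  shows "(\<integral>x. \<psi> x * (grad \<phi> x \<bullet> b) \<partial>M) = - (\<integral>x. (grad \<psi> x \<bullet> b) * \<phi> x \<partial>M)"
proof -
  note sm = assms[THEN test_function_smooth]
  note si = test_function_L2[OF assms(1)] test_function_L2[OF assms(2)]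
  have comp: "square_integrable M (\<lambda>x. grad \<psi> x \<bullet> b)" "square_integrable M (\<lambda>x. grad \<phi> x \<bullet> b)"
    by (intro square_integrable_inner_const si)+
  have "0 = (\<integral>x. grad (\<lambda>x. \<psi> x * \<phi> x) x \<bullet> b \<partial>M)"
    by (rule integral_grad[symmetric], rule test_function_mult_left) (use assms sm in auto)
  also have "\<dots> = (\<integral>x. \<psi> x * (grad \<phi> x \<bullet> b) + (grad \<psi> x \<bullet> b) * \<phi> x \<partial>M)"
    by (simp add: grad_mult sm inner_add_left mult.commute add.commute)
  also have "\<dots> = (\<integral>x. \<psi> x * (grad \<phi> x \<bullet> b) \<partial>M) + (\<integral>x. (grad \<psi> x \<bullet> b) * \<phi> x \<partial>M)"
    using si comp by (intro Bochner_Integration.integral_add square_integrable_mult)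
  finally show ?thesis by linarith
qed

text \<open>The divergence of the field \<open>\<phi>\<^sup>2 (x \<bullet> b) b\<close> has integral zero.\<close>

lemma poincare_test:
  obtains P where "P > 0" "\<And>\<phi>. test_function \<Omega> \<phi> \<Longrightarrow>
    (\<integral>x. (\<phi> x)\<^sup>2 \<partial>M) \<le> P * sqnorm M (grad \<phi>)"
proof -
  obtain R where R: "R > 0" "\<And>x. x \<in> \<Omega> \<Longrightarrow> norm x \<le> R"
    using bounded_domain by (auto simp: bounded_pos)
  obtain b :: 'a where b: "b \<in> Basis" using nonempty_Basis by blast
  let ?P = "\<lambda>\<phi>. (\<integral>x. (\<phi> x)\<^sup>2 \<partial>M)"
  let ?G = "\<lambda>\<phi>. sqnorm M (grad \<phi>)"
  have "?P \<phi> \<le> 4 * R\<^sup>2 * ?G \<phi>" if "test_function \<Omega> \<phi>" for \<phi>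
  proof -
    note sm = test_function_smooth[OF that]
    note si = test_function_L2[OF that]
    note [measurable] = test_function_measurable[OF sm]
    let ?w = "\<lambda>x. (x \<bullet> b) * (\<phi> x * \<phi> x)"
    have tw: "test_function \<Omega> ?w"
      by (rule test_function_comb[OF that that]) (auto intro!: smooth_mult sm smooth_inner)
    have grad_w: "grad ?w x \<bullet> b = (\<phi> x)\<^sup>2 + 2 * (x \<bullet> b) * \<phi> x * (grad \<phi> x \<bullet> b)" for x
      using b by (simp add: grad_mult sm smooth_mult smooth_inner grad_inner inner_add_left
          power2_eq_square algebra_simps)
    have intw: "integrable M (\<lambda>x. grad ?w x \<bullet> b)"
      using test_function_L2(2)[OF tw, THEN square_integrable_imp_integrable]
      by (rule integrable_inner_left)
    have "0 = (\<integral>x. grad ?w x \<bullet> b \<partial>M)" using integral_grad[OF tw] by simp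
    \<comment> \<open>Half of \<open>(\<phi> x)\<^sup>2\<close> absorbs the cross term, by
      completing the square in \<open>\<phi> x + 2 * ?s\<close> below. With |x \<bullet> b| \<le> R
      this leads to the constant 4 R^2.\<close>
    also have "\<dots> \<ge> (\<integral>x. (\<phi> x)\<^sup>2 / 2 - 2 * R\<^sup>2 * (norm (grad \<phi> x))\<^sup>2 \<partial>M)"
    proof (rule integral_mono)
      show "integrable M (\<lambda>x. (\<phi> x)\<^sup>2 / 2 - 2 * R\<^sup>2 * (norm (grad \<phi> x))\<^sup>2)"
        using square_integrable_power2[OF si(1)] square_integrable_norm_power2[OF si(2)] by auto
      fix x assume "x \<in> space M"
      then have "norm x \<le> R" using R(2) by simp
      let ?s = "(x \<bullet> b) * (grad \<phi> x \<bullet> b)"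
      have "\<bar>x \<bullet> b\<bar> \<le> R" "\<bar>grad \<phi> x \<bullet> b\<bar> \<le> norm (grad \<phi> x)"
        using Basis_le_norm[OF b, of x] Basis_le_norm[OF b, of "grad \<phi> x"] \<open>norm x \<le> R\<close> by auto
      then have "\<bar>?s\<bar> \<le> R * norm (grad \<phi> x)"
        unfolding abs_mult by (intro mult_mono) (use R(1) in auto)
      then have "\<bar>?s\<bar>\<^sup>2 \<le> (R * norm (grad \<phi> x))\<^sup>2" by (rule power_mono) simp
      then have "?s\<^sup>2 \<le> R\<^sup>2 * (norm (grad \<phi> x))\<^sup>2" by (simp add: power_mult_distrib)
      moreover have "0 \<le> (\<phi> x + 2 * ?s)\<^sup>2" by simp
      then have "0 \<le> (\<phi> x)\<^sup>2 + 4 * (\<phi> x * ?s) + 4 * ?s\<^sup>2"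
        by (simp add: power2_eq_square algebra_simps)
      moreover have "2 * (x \<bullet> b) * \<phi> x * (grad \<phi> x \<bullet> b) = 2 * (\<phi> x * ?s)" by simp
      ultimately show "(\<phi> x)\<^sup>2 / 2 - 2 * R\<^sup>2 * (norm (grad \<phi> x))\<^sup>2 \<le> grad ?w x \<bullet> b"
        unfolding grad_w by linarith
    qed (rule intw)
    also have "(\<integral>x. (\<phi> x)\<^sup>2 / 2 - 2 * R\<^sup>2 * (norm (grad \<phi> x))\<^sup>2 \<partial>M) =
        ?P \<phi> / 2 - 2 * R\<^sup>2 * ?G \<phi>"
      using square_integrable_power2[OF si(1)] square_integrable_norm_power2[OF si(2)] by simp
    finally show ?thesis by simp
  qed
  with R(1) show ?thesis by (intro that[of "4 * R\<^sup>2"]) auto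
qed

end

section \<open>Uniqueness of weak gradients\<close>

text \<open>Positive exactly on the open box and 0 elsewhere. Boxes are used because an open set is
  a countable union of closed boxes and averages over small cubes recover an integrable
  function.\<close>

definition box_bump :: "'a::euclidean_space \<Rightarrow> 'a \<Rightarrow> 'a \<Rightarrow> real" where
  "box_bump a b x = (\<Prod>i\<in>Basis. bump 0 ((x - a) \<bullet> i) * bump 0 ((b - x) \<bullet> i))"

lemma smooth_box_bump: "smooth (box_bump a b)"
  unfolding box_bump_def
  by (intro smooth_prod smooth_mult smooth_bump)
    (auto simp: inner_diff_left intro!: smooth_diff smooth_inner smooth_const)

lemma box_bump_nonneg: "box_bump a b x \<ge> 0"
  unfolding box_bump_def by (intro prod_nonneg) (auto simp: bump_nonneg)

lemma box_bump_pos_iff: "box_bump a b x > 0 \<longleftrightarrow> x \<in> box a b"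
proof
  assume "x \<in> box a b"
  then show "box_bump a b x > 0"
    unfolding box_bump_def
    by (intro prod_pos ballI mult_pos_pos) (auto simp: bump_pos_iff mem_box inner_diff_left)
next
  assume "box_bump a b x > 0"
  then have "bump 0 ((x - a) \<bullet> i) * bump 0 ((b - x) \<bullet> i) \<noteq> 0" if "i \<in> Basis" for i
    using that unfolding box_bump_def by (metis finite_Basis less_irrefl prod_zero_iff)
  then have "bump 0 ((x - a) \<bullet> i) > 0 \<and> bump 0 ((b - x) \<bullet> i) > 0" if "i \<in> Basis" for i
    using that bump_nonneg[of 0] by (metis less_eq_real_def mult_zero_left mult_zero_right)
  then show "x \<in> box a b" by (auto simp: bump_pos_iff mem_box inner_diff_left)
qed

lemma test_function_box_bump:
  assumes "cbox a b \<subseteq> \<Omega>"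
  shows "test_function \<Omega> (box_bump a b)"
proof (rule test_functionI[OF smooth_box_bump _ compact_cbox assms])
  have "x \<in> box a b" if "box_bump a b x \<noteq> 0" for x
    using that box_bump_nonneg[of a b x] box_bump_pos_iff[of a b x] by simp
  then show "{x. box_bump a b x \<noteq> 0} \<subseteq> cbox a b" using box_subset_cbox by blast
qed

section \<open>The fundamental lemma of the calculus of variations\<close>

context bounded_open_set
begin

lemma integrable_locally_integrable_mult:
  assumes "locally_integrable \<Omega> h" "test_function \<Omega> \<phi>"
  shows "integrable M (\<lambda>x. (h x :: real) * \<phi> x)"
proof -
  obtain C where C: "compact C" "C \<subseteq> \<Omega>" "\<And>x. x \<notin> C \<Longrightarrow> \<phi> x = 0"
    by (rule test_function_support[OF assms(2)]) blast
  obtain B where B: "\<And>x. \<bar>\<phi> x\<bar> \<le> B" "B > 0"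
    by (rule test_function_bounded[OF assms(2)]) blast
  have Cs: "C \<in> sets lebesgue" using C(1) by (simp add: lmeasurable_compact fmeasurableD)
  have h: "integrable (lebesgue_on C) h" using assms(1) C by (auto simp: locally_integrable_def)
  have "integrable (lebesgue_on C) (\<lambda>x. h x * \<phi> x)"
  proof (rule Bochner_Integration.integrable_bound)
    show "integrable (lebesgue_on C) (\<lambda>x. B * h x)" using h by simp
    have "\<phi> \<in> borel_measurable (lebesgue_on C)"
      by (rule continuous_imp_measurable_on_sets_lebesgue[OF smooth_continuous Cs])
        (rule test_function_smooth[OF assms(2)])
    then show "(\<lambda>x. h x * \<phi> x) \<in> borel_measurable (lebesgue_on C)" using h by measurable
    have "\<bar>h x * \<phi> x\<bar> \<le> \<bar>B * h x\<bar>" for x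
      using mult_left_mono[OF B(1)[of x], of "\<bar>h x\<bar>"] B(2) by (simp add: abs_mult mult.commute)
    then show "AE x in lebesgue_on C. norm (h x * \<phi> x) \<le> norm (B * h x)" by simp
  qed
  then have "integrable lebesgue (\<lambda>x. if x \<in> C then h x * \<phi> x else 0)"
    by (simp add: Lebesgue_Measure.integrable_restrict_UNIV Cs)
  also have "(\<lambda>x. if x \<in> C then h x * \<phi> x else 0) = (\<lambda>x. if x \<in> \<Omega> then h x * \<phi> x else 0)"
    using C by (auto simp: fun_eq_iff)
  finally show ?thesis by (simp add: Lebesgue_Measure.integrable_restrict_UNIV sets_domain)
qed

text \<open>The indicator of the box is approximated by test functions that stay between 0 and
  1.\<close>

lemma integral_cbox_eq_0:
  assumes h: "locally_integrable \<Omega> h"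
    and 0: "\<And>\<phi>. test_function \<Omega> \<phi> \<Longrightarrow> (\<integral>x. (h x :: real) * \<phi> x \<partial>M) = 0"
    and sub: "cbox a b \<subseteq> \<Omega>"
  shows "integral (cbox a b) h = 0"
proof -
  let ?D = "\<lambda>k x. 1 + real k * box_bump a b x"
  let ?L = "lebesgue_on (cbox a b)"
  have h_int: "integrable ?L h" using h sub by (auto simp: locally_integrable_def)
  \<comment> \<open>This is k p / (1 + k p) with p the box bump: it tends to 1 where p > 0 and is 0
    where p = 0.\<close>
  define \<phi> where "\<phi> k x = real k * inverse (?D k x) * box_bump a b x" for k x
  have pos: "?D k x > 0" for k x
    using box_bump_nonneg[of a b x] by (simp add: add_pos_nonneg)
  have sm: "smooth (\<lambda>x. real k * inverse (?D k x))" for k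
    by (intro smooth_mult smooth_inverse smooth_add smooth_const smooth_box_bump pos)
  then have test: "test_function \<Omega> (\<phi> k)" for k
    unfolding \<phi>_def by (intro test_function_mult_left test_function_box_bump sub)
  have \<phi>_eq: "\<phi> k x = 1 - inverse (?D k x)" for k x
    using pos[of k x] by (simp add: \<phi>_def field_simps)
  have \<phi>_le: "\<bar>\<phi> k x\<bar> \<le> 1" for k x
  proof -
    have "inverse (?D k x) \<le> 1"
      using box_bump_nonneg[of a b x] by (intro inverse_le_1_iff[THEN iffD2]) (auto simp: mult_nonneg_nonneg)
    then show ?thesis using pos[of k x] unfolding \<phi>_eq by (simp add: abs_le_iff)
  qed
  have supp: "\<phi> k x = 0" if "x \<notin> cbox a b" for k x
  proof -
    have "x \<notin> box a b" using that box_subset_cbox by blast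
    then have "box_bump a b x = 0"
      using box_bump_nonneg[of a b x] box_bump_pos_iff[of a b x] by simp
    then show ?thesis by (simp add: \<phi>_def)
  qed
  have "(\<integral>x. h x * \<phi> k x \<partial>?L) = 0" for k
  proof -
    have "(\<integral>x. h x * \<phi> k x \<partial>?L) = (\<integral>x. (if x \<in> cbox a b then h x * \<phi> k x else 0) \<partial>lebesgue)"
      by (simp add: Lebesgue_Measure.integral_restrict_UNIV)
    also have "\<dots> = (\<integral>x. (if x \<in> \<Omega> then h x * \<phi> k x else 0) \<partial>lebesgue)"
      using sub supp by (intro Bochner_Integration.integral_cong) auto
    also have "\<dots> = (\<integral>x. h x * \<phi> k x \<partial>M)"
      by (simp add: Lebesgue_Measure.integral_restrict_UNIV sets_domain)
    finally show ?thesis using 0[OF test] by simp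
  qed
  moreover have "(\<lambda>k. \<integral>x. h x * \<phi> k x \<partial>?L) \<longlonglongrightarrow> (\<integral>x. h x \<partial>?L)"
  proof (rule integral_dominated_convergence)
    show "integrable ?L (\<lambda>x. norm (h x))" using h_int by simp
    have "\<phi> k \<in> borel_measurable ?L" for k
      by (rule continuous_imp_measurable_on_sets_lebesgue[OF smooth_continuous])
        (use test test_function_smooth in auto)
    then show "(\<lambda>x. h x * \<phi> k x) \<in> borel_measurable ?L" for k using h_int by measurable
    show "h \<in> borel_measurable ?L" using h_int by auto
    show "AE x in ?L. norm (h x * \<phi> k x) \<le> norm (h x)" for k
      using \<phi>_le[of k] by (simp add: abs_mult mult_left_le)
    \<comment> \<open>Convergence to 1 fails only on the faces of the box, which form a null
      set.\<close>
    have "AE x in lebesgue. x \<notin> cbox a b - box a b"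
      using negligible_frontier_interval by (intro AE_not_in) (simp add: negligible_iff_null_sets)
    then have "AE x in ?L. x \<in> box a b"
      by (subst AE_restrict_space_iff) auto
    then show "AE x in ?L. (\<lambda>k. h x * \<phi> k x) \<longlonglongrightarrow> h x"
    proof eventually_elim
      case (elim x)
      then have "box_bump a b x > 0" by (simp add: box_bump_pos_iff)
      then have "filterlim (\<lambda>k. 1 + box_bump a b x * real k) at_top sequentially"
        by (intro filterlim_tendsto_add_at_top[OF tendsto_const]
            filterlim_tendsto_pos_mult_at_top[OF tendsto_const] filterlim_real_sequentially)
      then have "(\<lambda>k. inverse (1 + box_bump a b x * real k)) \<longlonglongrightarrow> 0"
        by (rule tendsto_inverse_0_at_top)
      then have "(\<lambda>k. h x * (1 - inverse (1 + box_bump a b x * real k))) \<longlonglongrightarrow> h x * (1 - 0)"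
        by (intro tendsto_intros)
      then show ?case by (simp add: \<phi>_eq mult.commute)
    qed
  qed
  ultimately have "(\<integral>x. h x \<partial>?L) = 0" by (simp add: LIMSEQ_const_iff)
  then show ?thesis using lebesgue_integral_eq_integral[OF h_int] by simp
qed

text \<open>Lebesgue differentiation: at almost every point \<open>h\<close> is the limit of its
  averages over shrinking cubes, and all these averages are 0.\<close>

lemma negligible_cbox_locally_integrable:
  assumes h: "locally_integrable \<Omega> h"
    and 0: "\<And>\<phi>. test_function \<Omega> \<phi> \<Longrightarrow> (\<integral>x. (h x :: real) * \<phi> x \<partial>M) = 0"
    and sub: "cbox a b \<subseteq> \<Omega>"
  shows "negligible {x \<in> cbox a b. h x \<noteq> 0}"
proof -
  \<comment> \<open>Extension by zero makes the function integrable on every box, as the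
    differentiation theorem requires.\<close>
  define f where "f x = (if x \<in> cbox a b then h x else 0)" for x
  have "integrable (lebesgue_on (cbox a b)) h" using h sub by (auto simp: locally_integrable_def)
  then have "h integrable_on cbox a b" by (rule integrable_on_lebesgue_on) simp
  then have "f integrable_on UNIV" unfolding f_def by (simp add: Henstock_Kurzweil_Integration.integrable_restrict_UNIV)
  then have "f integrable_on cbox c d" for c d by (rule integrable_on_subcbox) simp
  then obtain N where N: "negligible N" "\<And>x e. \<lbrakk>x \<notin> N; 0 < e\<rbrakk> \<Longrightarrow> \<exists>d>0. \<forall>t. 0 < t \<and> t < d \<longrightarrow>
      norm (integral (cbox x (x + t *\<^sub>R One)) f /\<^sub>R t ^ DIM('a) - f x) < e"
    using integrable_ccontinuous_explicit[of f] by blast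
  have "h x = 0" if x: "x \<in> box a b" "x \<notin> N" for x
  proof (rule ccontr)
    assume "h x \<noteq> 0"
    then obtain d where d: "d > 0" "\<And>t. 0 < t \<Longrightarrow> t < d \<Longrightarrow>
        norm (integral (cbox x (x + t *\<^sub>R One)) f /\<^sub>R t ^ DIM('a) - f x) < \<bar>h x\<bar>"
      using N(2)[OF x(2), of "\<bar>h x\<bar>"] by auto
    define m where "m = Min ((\<lambda>i. (b - x) \<bullet> i) ` Basis)"
    have "m > 0" using x(1) by (auto simp: m_def mem_box inner_diff_left)
    have m: "m \<le> (b - x) \<bullet> i" if "i \<in> Basis" for i using that by (simp add: m_def)
    \<comment> \<open>The cube with corner x and side t stays inside the box since t \<le> m, and t
      < d makes the differentiation estimate available.\<close>
    define t where "t = min m d / 2"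
    have t: "0 < t" "t < d" "t \<le> m" using d(1) \<open>m > 0\<close> by (auto simp: t_def)
    have subx: "cbox x (x + t *\<^sub>R One) \<subseteq> cbox a b"
    proof (rule subset_box_imp(1)[rule_format])
      fix i :: 'a assume i: "i \<in> Basis"
      with x(1) m[OF i] t show "a \<bullet> i \<le> x \<bullet> i \<and> (x + t *\<^sub>R One) \<bullet> i \<le> b \<bullet> i"
        by (auto simp: mem_box inner_add_left inner_diff_left less_imp_le)
    qed
    have "integral (cbox x (x + t *\<^sub>R One)) f = integral (cbox x (x + t *\<^sub>R One)) h"
      by (rule Henstock_Kurzweil_Integration.integral_cong) (use subx in \<open>auto simp: f_def\<close>)
    also have "\<dots> = 0" by (rule integral_cbox_eq_0[OF h 0]) (use subx sub in auto)
    finally show False using d(2)[OF t(1,2)] x(1) box_subset_cbox[of a b] by (auto simp: f_def)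
  qed
  then have "{x \<in> cbox a b. h x \<noteq> 0} \<subseteq> N \<union> (cbox a b - box a b)" by auto
  then show ?thesis
    by (rule negligible_subset[rotated]) (auto intro: N(1) negligible_frontier_interval)
qed

lemma AE_eq_0_locally_integrable:
  assumes h: "locally_integrable \<Omega> h"
    and 0: "\<And>\<phi>. test_function \<Omega> \<phi> \<Longrightarrow> (\<integral>x. (h x :: real) * \<phi> x \<partial>M) = 0"
  shows "AE x in M. h x = 0"
proof -
  obtain D where D: "countable D" "D \<subseteq> Pow \<Omega>" "\<And>X. X \<in> D \<Longrightarrow> \<exists>a b. X = cbox a b" "\<Union>D = \<Omega>"
    using open_countable_Union_open_cbox[OF open_domain] by blast
  have "negligible {x \<in> X. h x \<noteq> 0}" if "X \<in> D" for X
    using negligible_cbox_locally_integrable[OF h 0] D(2,3) that by blast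
  then have "negligible (\<Union>X\<in>D. {x \<in> X. h x \<noteq> 0})" using D(1) by blast
  then have "AE x in lebesgue. x \<notin> (\<Union>X\<in>D. {x \<in> X. h x \<noteq> 0})"
    by (intro AE_not_in) (simp add: negligible_iff_null_sets)
  moreover have "(\<Union>X\<in>D. {x \<in> X. h x \<noteq> 0}) = {x \<in> \<Omega>. h x \<noteq> 0}" using D(4) by auto
  ultimately show ?thesis using sets_domain by (subst AE_restrict_space_iff) auto
qed

text \<open>Needed for \<open>weak_gradient\<close>: of a gradient chosen by \<open>SOME\<close>
  only local integrability is known, and this has to yield measurability on all of
  \<open>\<Omega>\<close>.\<close>

lemma locally_integrable_measurable:
  assumes "locally_integrable \<Omega> g"
  shows "g \<in> borel_measurable M"
proof -
  obtain D where D: "countable D" "D \<subseteq> Pow \<Omega>" "\<And>X. X \<in> D \<Longrightarrow> \<exists>a b. X = cbox a b" "\<Union>D = \<Omega>"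
    using open_countable_Union_open_cbox[OF open_domain] by blast
  show ?thesis
  proof (rule measurable_piecewise_restrict[OF D(1)])
    fix X assume X: "X \<in> D"
    then have X': "compact X" "X \<subseteq> \<Omega>" "X \<in> sets lebesgue" using D(2,3) by fastforce+
    then show "X \<inter> space M \<in> sets M"
      using sets_domain by (auto simp: sets_restrict_space_iff)
    have "restrict_space M X = lebesgue_on X"
      using X' sets_domain by (subst restrict_restrict_space) (auto simp: Int_absorb1)
    then show "g \<in> restrict_space M X \<rightarrow>\<^sub>M borel"
      using assms X' by (auto simp: locally_integrable_def)
  qed (use D in auto)
qed

lemma integrable_imp_locally_integrable:
  assumes "integrable M g"
  shows "locally_integrable \<Omega> g"
  unfolding locally_integrable_def
proof (intro allI impI, elim conjE)
  fix C assume C: "compact C" "C \<subseteq> \<Omega>"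
  have Cs: "C \<in> sets lebesgue" using C(1) by (simp add: lmeasurable_compact fmeasurableD)
  have "restrict_space M C = lebesgue_on C"
    using C Cs sets_domain by (subst restrict_restrict_space) (auto simp: Int_absorb1)
  moreover have "integrable (restrict_space M C) g"
    using assms C Cs sets_domain
    by (subst integrable_restrict_space) (auto simp: sets_restrict_space_iff Int_absorb2 intro!: integrable_mult_indicator)
  ultimately show "integrable (lebesgue_on C) g" by simp
qed

lemma has_weak_gradient_unique:
  assumes "has_weak_gradient \<Omega> u g" "has_weak_gradient \<Omega> u g'"
  shows "AE x in M. g x = g' x"
proof -
  have "AE x in M. g x \<bullet> b - g' x \<bullet> b = 0" if b: "b \<in> Basis" for b
  proof (rule AE_eq_0_locally_integrable)
    have loc: "locally_integrable \<Omega> (\<lambda>x. g x \<bullet> b)" "locally_integrable \<Omega> (\<lambda>x. g' x \<bullet> b)"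
      using assms by (auto simp: has_weak_gradient_def locally_integrable_def)
    then show "locally_integrable \<Omega> (\<lambda>x. g x \<bullet> b - g' x \<bullet> b)"
      by (auto simp: locally_integrable_def)
    fix \<phi> :: "'a \<Rightarrow> real" assume t: "test_function \<Omega> \<phi>"
    then have "(\<integral>x. (g x \<bullet> b) * \<phi> x \<partial>M) = (\<integral>x. (g' x \<bullet> b) * \<phi> x \<partial>M)"
      using assms b by (auto simp: has_weak_gradient_def)
    then show "(\<integral>x. (g x \<bullet> b - g' x \<bullet> b) * \<phi> x \<partial>M) = 0"
      using loc[THEN integrable_locally_integrable_mult, OF t] by (simp add: left_diff_distrib)
  qed
  then have "AE x in M. \<forall>b\<in>Basis. g x \<bullet> b - g' x \<bullet> b = 0"
    by (simp add: AE_ball_countable countable_finite)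
  then show ?thesis by eventually_elim (auto intro: euclidean_eqI)
qed

end

section \<open>The space of Sobolev functions vanishing on the boundary\<close>

lemma smooth_grad_inner: "smooth f \<Longrightarrow> smooth (\<lambda>x. grad f x \<bullet> b)"
  unfolding frechet_derivative_eq_grad[symmetric]
  unfolding smooth_def by (metis C_k.simps(2))

section \<open>The closed graph of the gradient\<close>

context bounded_open_set
begin

lemma test_function_grad_inner:
  assumes "test_function \<Omega> \<phi>"
  shows "test_function \<Omega> (\<lambda>x. grad \<phi> x \<bullet> b)"
proof -
  obtain C where "compact C" "C \<subseteq> \<Omega>" "\<And>x. x \<notin> C \<Longrightarrow> grad \<phi> x = 0"
    by (rule test_function_support[OF assms]) blast
  then show ?thesis
    using smooth_grad_inner[OF test_function_smooth[OF assms]]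
    by (intro test_functionI[of _ C]) force+
qed

lemma has_weak_gradient_iff:
  "has_weak_gradient \<Omega> u g \<longleftrightarrow> locally_integrable \<Omega> u \<and> locally_integrable \<Omega> g \<and>
    (\<forall>\<phi>. test_function \<Omega> \<phi> \<longrightarrow> (\<forall>b\<in>Basis.
      (\<integral>x. u x * (grad \<phi> x \<bullet> b) \<partial>M) = - (\<integral>x. (g x \<bullet> b) * \<phi> x \<partial>M)))"
  unfolding has_weak_gradient_def
  by (simp add: frechet_derivative_eq_grad test_function_smooth cong: conj_cong imp_cong)

lemma has_weak_gradient_diff:
  assumes "has_weak_gradient \<Omega> u g" "has_weak_gradient \<Omega> v h"
  shows "has_weak_gradient \<Omega> (\<lambda>x. u x - v x) (\<lambda>x. g x - h x)"
  unfolding has_weak_gradient_iff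
proof (intro conjI allI impI ballI)
  show "locally_integrable \<Omega> (\<lambda>x. u x - v x)" "locally_integrable \<Omega> (\<lambda>x. g x - h x)"
    using assms by (auto simp: has_weak_gradient_iff locally_integrable_def)
  fix \<phi> :: "'a \<Rightarrow> real" and b :: 'a assume t: "test_function \<Omega> \<phi>" and b: "b \<in> Basis"
  have loc: "locally_integrable \<Omega> u" "locally_integrable \<Omega> v"
    "locally_integrable \<Omega> (\<lambda>x. g x \<bullet> b)" "locally_integrable \<Omega> (\<lambda>x. h x \<bullet> b)"
    using assms by (auto simp: has_weak_gradient_iff locally_integrable_def)
  note int = loc(1,2)[THEN integrable_locally_integrable_mult, OF test_function_grad_inner[OF t, of b]]
    loc(3,4)[THEN integrable_locally_integrable_mult, OF t]
  show "(\<integral>x. (u x - v x) * (grad \<phi> x \<bullet> b) \<partial>M) = - (\<integral>x. ((g x - h x) \<bullet> b) * \<phi> x \<partial>M)"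
    using assms t b int by (simp add: has_weak_gradient_iff left_diff_distrib inner_diff_left)
qed

lemma weak_gradient_eq:
  assumes "has_weak_gradient \<Omega> u g"
  shows "weak_gradient \<Omega> u \<in> borel_measurable M" "AE x in M. weak_gradient \<Omega> u x = g x"
proof -
  have "has_weak_gradient \<Omega> u (weak_gradient \<Omega> u)"
    unfolding weak_gradient_def by (rule someI[of "has_weak_gradient \<Omega> u", OF assms])
  then show "weak_gradient \<Omega> u \<in> borel_measurable M" "AE x in M. weak_gradient \<Omega> u x = g x"
    using assms by (auto simp: has_weak_gradient_def
        intro: locally_integrable_measurable has_weak_gradient_unique)
qed

text \<open>The closure in L2 x L2 of the graph of the gradient on test functions. Naming the
  gradient keeps the choice in \<open>weak_gradient\<close> out of all limit arguments.\<close>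

definition H10_grad :: "('a \<Rightarrow> real) \<Rightarrow> ('a \<Rightarrow> 'a) \<Rightarrow> bool" where
  "H10_grad u g \<longleftrightarrow> (\<exists>\<phi>. (\<forall>k. test_function \<Omega> (\<phi> k)) \<and>
     L2_tendsto M \<phi> u \<and> L2_tendsto M (\<lambda>k. grad (\<phi> k)) g)"

lemma H10_gradE:
  assumes "H10_grad u g"
  obtains \<phi> where "\<And>k. test_function \<Omega> (\<phi> k)" "L2_tendsto M \<phi> u" "L2_tendsto M (\<lambda>k. grad (\<phi> k)) g"
  using assms by (auto simp: H10_grad_def)

lemma H10_grad_L2:
  assumes "H10_grad u g"
  shows "square_integrable M u" "square_integrable M g"
  using assms by (auto simp: H10_grad_def L2_tendsto_def)

lemma H10_grad_test: "test_function \<Omega> \<phi> \<Longrightarrow> H10_grad \<phi> (grad \<phi>)"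
  unfolding H10_grad_def
  by (intro exI[of _ "\<lambda>_. \<phi>"]) (auto intro: L2_tendsto_const test_function_L2)

lemma H10_grad_scale:
  assumes "H10_grad u g"
  shows "H10_grad (\<lambda>x. c * u x) (\<lambda>x. c *\<^sub>R g x)"
proof -
  obtain \<phi> where \<phi>: "\<And>k. test_function \<Omega> (\<phi> k)" "L2_tendsto M \<phi> u" "L2_tendsto M (\<lambda>k. grad (\<phi> k)) g"
    by (rule H10_gradE[OF assms]) blast
  have "L2_tendsto M (\<lambda>k x. grad (\<lambda>x. c * \<phi> k x) x) (\<lambda>x. c *\<^sub>R g x)"
    using L2_tendsto_scaleR[OF \<phi>(3), of c]
    by (simp add: grad_cmult[OF test_function_smooth[OF \<phi>(1)]])
  with L2_tendsto_scaleR[OF \<phi>(2), of c] show ?thesis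
    unfolding H10_grad_def
    by (intro exI[of _ "\<lambda>k x. c * \<phi> k x"]) (simp add: test_function_cmult \<phi>(1))
qed

lemma H10_grad_add:
  assumes "H10_grad u g" "H10_grad v h"
  shows "H10_grad (\<lambda>x. u x + v x) (\<lambda>x. g x + h x)"
proof -
  obtain \<phi> where \<phi>: "\<And>k. test_function \<Omega> (\<phi> k)" "L2_tendsto M \<phi> u" "L2_tendsto M (\<lambda>k. grad (\<phi> k)) g"
    by (rule H10_gradE[OF assms(1)]) blast
  obtain \<psi> where \<psi>: "\<And>k. test_function \<Omega> (\<psi> k)" "L2_tendsto M \<psi> v" "L2_tendsto M (\<lambda>k. grad (\<psi> k)) h"
    by (rule H10_gradE[OF assms(2)]) blast
  have "L2_tendsto M (\<lambda>k x. grad (\<lambda>x. \<phi> k x + \<psi> k x) x) (\<lambda>x. g x + h x)"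
    using L2_tendsto_add[OF \<phi>(3) \<psi>(3)]
    by (simp add: grad_add[OF test_function_smooth[OF \<phi>(1)] test_function_smooth[OF \<psi>(1)]])
  with L2_tendsto_add[OF \<phi>(2) \<psi>(2)] show ?thesis
    unfolding H10_grad_def
    by (intro exI[of _ "\<lambda>k x. \<phi> k x + \<psi> k x"]) (simp add: test_function_add \<phi>(1) \<psi>(1))
qed

text \<open>Both sides of integration by parts against a fixed test function are inner products,
  hence continuous under L2 convergence.\<close>

lemma H10_grad_imp_has_weak_gradient:
  assumes "H10_grad u g"
  shows "has_weak_gradient \<Omega> u g"
  unfolding has_weak_gradient_iff
proof (intro conjI allI impI ballI)
  note si = H10_grad_L2[OF assms]
  show "locally_integrable \<Omega> u" "locally_integrable \<Omega> g"
    using si by (auto intro: integrable_imp_locally_integrable square_integrable_imp_integrable)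
  obtain \<phi> where \<phi>: "\<And>k. test_function \<Omega> (\<phi> k)" "L2_tendsto M \<phi> u" "L2_tendsto M (\<lambda>k. grad (\<phi> k)) g"
    by (rule H10_gradE[OF assms]) blast
  fix \<psi> :: "'a \<Rightarrow> real" and b :: 'a assume t: "test_function \<Omega> \<psi>" and b: "b \<in> Basis"
  have "(\<lambda>k. \<integral>x. \<phi> k x \<bullet> (grad \<psi> x \<bullet> b) \<partial>M) \<longlonglongrightarrow> (\<integral>x. u x \<bullet> (grad \<psi> x \<bullet> b) \<partial>M)"
    by (intro L2_tendsto_inner[OF \<phi>(2)] L2_tendsto_const test_function_L2
        test_function_grad_inner t)
  moreover have "(\<lambda>k. - (\<integral>x. grad (\<phi> k) x \<bullet> (\<psi> x *\<^sub>R b) \<partial>M)) \<longlonglongrightarrow> - (\<integral>x. g x \<bullet> (\<psi> x *\<^sub>R b) \<partial>M)"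
  proof (intro tendsto_minus L2_tendsto_inner[OF \<phi>(3)] L2_tendsto_const)
    show "square_integrable M (\<lambda>x. \<psi> x *\<^sub>R b)"
      using test_function_L2(1)[OF t] b
      by (auto simp: square_integrable_def intro: borel_measurable_scaleR)
  qed
  moreover have "(\<integral>x. \<phi> k x \<bullet> (grad \<psi> x \<bullet> b) \<partial>M) = - (\<integral>x. grad (\<phi> k) x \<bullet> (\<psi> x *\<^sub>R b) \<partial>M)" for k
    using integral_by_parts[OF \<phi>(1)[of k] t, of b] by (simp add: mult.commute)
  ultimately have "(\<integral>x. u x \<bullet> (grad \<psi> x \<bullet> b) \<partial>M) = - (\<integral>x. g x \<bullet> (\<psi> x *\<^sub>R b) \<partial>M)"
    using LIMSEQ_unique by fastforce
  then show "(\<integral>x. u x * (grad \<psi> x \<bullet> b) \<partial>M) = - (\<integral>x. (g x \<bullet> b) * \<psi> x \<partial>M)"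
    by (simp add: mult.commute)
qed

lemma dirichlet_energy_has_weak_gradient:
  assumes "has_weak_gradient \<Omega> u g"  "g \<in> borel_measurable M"
  shows "dirichlet_energy \<Omega> u = sqnorm M g"
  unfolding dirichlet_energy_def
proof (rule integral_cong_AE)
  note [measurable] = weak_gradient_eq(1)[OF assms(1)] assms(2)
  show "(\<lambda>x. (norm (weak_gradient \<Omega> u x))\<^sup>2) \<in> borel_measurable M"
    "(\<lambda>x. (norm (g x))\<^sup>2) \<in> borel_measurable M" by measurable
  show "AE x in M. (norm (weak_gradient \<Omega> u x))\<^sup>2 = (norm (g x))\<^sup>2"
    using weak_gradient_eq(2)[OF assms(1)] by eventually_elim simp
qed

lemma dirichlet_energy_H10_grad:
  "H10_grad u g \<Longrightarrow> dirichlet_energy \<Omega> u = sqnorm M g"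
  by (intro dirichlet_energy_has_weak_gradient H10_grad_imp_has_weak_gradient
      square_integrable_measurable H10_grad_L2)

lemma integral_weak_gradient_inner:
  assumes "H10_grad u g" "H10_grad v h"
  shows "(\<integral>x. weak_gradient \<Omega> u x \<bullet> weak_gradient \<Omega> v x \<partial>M) = (\<integral>x. g x \<bullet> h x \<partial>M)"
proof (rule integral_cong_AE)
  note w = assms[THEN H10_grad_imp_has_weak_gradient]
  note [measurable] = w[THEN weak_gradient_eq(1)]
    assms[THEN H10_grad_L2(2), THEN square_integrable_measurable]
  show "(\<lambda>x. weak_gradient \<Omega> u x \<bullet> weak_gradient \<Omega> v x) \<in> borel_measurable M"
    "(\<lambda>x. g x \<bullet> h x) \<in> borel_measurable M" by measurable
  show "AE x in M. weak_gradient \<Omega> u x \<bullet> weak_gradient \<Omega> v x = g x \<bullet> h x"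
    using w[THEN weak_gradient_eq(2)] by eventually_elim simp
qed

text \<open>The squared \<open>H1_norm\<close> of the difference is the sum of the two squared L2
  distances, of the functions and of the gradients, once weak gradients are known to be unique; the
  sum tends to 0 exactly when both terms do.\<close>

lemma H10_iff: "u \<in> H10 \<Omega> \<longleftrightarrow> (\<exists>g. H10_grad u g)"
proof
  assume "u \<in> H10 \<Omega>"
  then obtain g \<phi> where u: "square_integrable M u" and g: "square_integrable M g" "has_weak_gradient \<Omega> u g"
    and \<phi>: "\<And>k. test_function \<Omega> (\<phi> k)" "(\<lambda>k. H1_norm \<Omega> (\<lambda>x. u x - \<phi> k x)) \<longlonglongrightarrow> 0"
    unfolding H10_def H1_def L2_iff mem_Collect_eq Bex_def by blast
  note t = test_function_L2[OF \<phi>(1)]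
  define A where "A k = (\<integral>x. (u x - \<phi> k x)\<^sup>2 \<partial>M)" for k
  define B where "B k = sqnorm M (\<lambda>x. g x - grad (\<phi> k) x)" for k
  have AB: "A k \<ge> 0" "B k \<ge> 0" for k by (simp_all add: A_def B_def)
  have "dirichlet_energy \<Omega> (\<lambda>x. u x - \<phi> k x) = B k" for k
    unfolding B_def
    by (intro dirichlet_energy_has_weak_gradient has_weak_gradient_diff g(2)
        H10_grad_imp_has_weak_gradient H10_grad_test \<phi>(1)
        square_integrable_measurable square_integrable_diff g(1) t)
  then have "(\<lambda>k. sqrt (A k + B k)) \<longlonglongrightarrow> 0" using \<phi>(2) by (simp add: H1_norm_def A_def)
  then have "(\<lambda>k. (sqrt (A k + B k))\<^sup>2) \<longlonglongrightarrow> 0\<^sup>2" by (rule tendsto_power)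
  then have lim: "(\<lambda>k. A k + B k) \<longlonglongrightarrow> 0" using AB by (simp add: add_nonneg_nonneg)
  have "A \<longlonglongrightarrow> 0" "B \<longlonglongrightarrow> 0"
    using AB by (auto intro!: tendsto_sandwich[OF _ _ tendsto_const lim] always_eventually)
  then have "L2_tendsto M \<phi> u" "L2_tendsto M (\<lambda>k. grad (\<phi> k)) g"
    using u g t by (simp_all add: L2_tendsto_def A_def[abs_def] B_def[abs_def] norm_minus_commute power2_commute)
  then show "\<exists>g. H10_grad u g" using \<phi>(1) by (auto simp: H10_grad_def)
next
  assume "\<exists>g. H10_grad u g"
  then obtain g where g: "H10_grad u g" by blast
  obtain \<phi> where \<phi>: "\<And>k. test_function \<Omega> (\<phi> k)" "L2_tendsto M \<phi> u" "L2_tendsto M (\<lambda>k. grad (\<phi> k)) g"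
    by (rule H10_gradE[OF g]) blast
  have "dirichlet_energy \<Omega> (\<lambda>x. u x - \<phi> k x) = sqnorm M (\<lambda>x. g x - grad (\<phi> k) x)" for k
    by (intro dirichlet_energy_has_weak_gradient has_weak_gradient_diff
        H10_grad_imp_has_weak_gradient H10_grad_test g \<phi>(1)
        square_integrable_measurable square_integrable_diff H10_grad_L2(2)[OF g]
        test_function_L2)
  then have "H1_norm \<Omega> (\<lambda>x. u x - \<phi> k x) = sqrt ((sqnorm M (\<lambda>x. \<phi> k x - u x))
      + sqnorm M (\<lambda>x. grad (\<phi> k) x - g x))" for k
    by (simp add: H1_norm_def norm_minus_commute power2_commute)
  moreover have "(\<lambda>k. sqrt ((sqnorm M (\<lambda>x. \<phi> k x - u x))
      + sqnorm M (\<lambda>x. grad (\<phi> k) x - g x))) \<longlonglongrightarrow> sqrt (0 + 0)"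
    using \<phi>(2,3) by (intro tendsto_intros) (auto simp: L2_tendsto_def)
  ultimately have "(\<lambda>k. H1_norm \<Omega> (\<lambda>x. u x - \<phi> k x)) \<longlonglongrightarrow> 0" by simp
  then show "u \<in> H10 \<Omega>"
    using g \<phi>(1) H10_grad_L2[OF g] H10_grad_imp_has_weak_gradient[OF g]
    by (auto simp: H10_def H1_def L2_iff)
qed

lemma poincare:
  obtains P where "P > 0" "\<And>u g. H10_grad u g \<Longrightarrow>
    (\<integral>x. (u x)\<^sup>2 \<partial>M) \<le> P * sqnorm M g"
proof -
  obtain P where P: "P > 0" "\<And>\<phi>. test_function \<Omega> \<phi> \<Longrightarrow>
    (\<integral>x. (\<phi> x)\<^sup>2 \<partial>M) \<le> P * sqnorm M (grad \<phi>)" by (rule poincare_test) blast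
  have "(\<integral>x. (u x)\<^sup>2 \<partial>M) \<le> P * sqnorm M g" if u: "H10_grad u g" for u g
  proof -
    obtain \<phi> where \<phi>: "\<And>k. test_function \<Omega> (\<phi> k)" "L2_tendsto M \<phi> u" "L2_tendsto M (\<lambda>k. grad (\<phi> k)) g"
      by (rule H10_gradE[OF u]) blast
    show ?thesis
    proof (rule LIMSEQ_le)
      show "(\<lambda>k. \<integral>x. (\<phi> k x)\<^sup>2 \<partial>M) \<longlonglongrightarrow> (\<integral>x. (u x)\<^sup>2 \<partial>M)"
        using L2_tendsto_norm_power2[OF \<phi>(2)] by simp
      show "(\<lambda>k. P * sqnorm M (grad (\<phi> k))) \<longlonglongrightarrow> P * sqnorm M g"
        by (intro tendsto_intros L2_tendsto_norm_power2 \<phi>(3))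
    qed (use P(2) \<phi>(1) in auto)
  qed
  with P(1) show ?thesis by (rule that)
qed

text \<open>Cauchy gradients suffice, because Poincare's inequality for differences makes the
  functions themselves Cauchy.\<close>

lemma H10_complete:
  assumes t: "\<And>k. test_function \<Omega> (\<psi> k)"
    and Cauchy: "\<And>e. e > 0 \<Longrightarrow> \<exists>N. \<forall>i\<ge>N. \<forall>j\<ge>N. (sqnorm M (\<lambda>x. grad (\<psi> i) x - grad (\<psi> j) x)) < e"
  obtains u g where "L2_tendsto M \<psi> u" "L2_tendsto M (\<lambda>k. grad (\<psi> k)) g"
proof -
  let ?G = "\<lambda>i j. sqnorm M (\<lambda>x. grad (\<psi> i) x - grad (\<psi> j) x)"
  let ?D = "\<lambda>i j. sqnorm M (\<lambda>x. \<psi> i x - \<psi> j x)"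
  obtain P where P: "P > 0" "\<And>\<phi>. test_function \<Omega> \<phi> \<Longrightarrow>
    (\<integral>x. (\<phi> x)\<^sup>2 \<partial>M) \<le> P * sqnorm M (grad \<phi>)" by (rule poincare_test) blast
  have le: "(?D i j) \<le> P * ?G i j" for i j
  proof -
    have "grad (\<lambda>x. \<psi> i x + - 1 * \<psi> j x) x = grad (\<psi> i) x + - 1 *\<^sub>R grad (\<psi> j) x" for x
      by (subst grad_add, rule test_function_smooth[OF t],
          rule test_function_smooth[OF test_function_cmult[OF t]])
        (simp only: grad_cmult[OF test_function_smooth[OF t]])
    then show ?thesis
      using P(2)[of "\<lambda>x. \<psi> i x + - 1 * \<psi> j x", OF test_function_add[OF t test_function_cmult[OF t]]]
      by simp
  qed
  have "\<exists>N. \<forall>i\<ge>N. \<forall>j\<ge>N. (?D i j) < e" if "e > 0" for e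
  proof -
    obtain N where N: "\<And>i j. i \<ge> N \<Longrightarrow> j \<ge> N \<Longrightarrow>
        (?G i j) < e / P"
      using Cauchy[of "e / P"] \<open>e > 0\<close> P(1) by auto
    have "(?D i j) < e" if "i \<ge> N" "j \<ge> N" for i j
      using le[of i j] N[OF that] P(1) by (simp add: field_simps)
    then show ?thesis by blast
  qed
  then obtain u where "L2_tendsto M \<psi> u"
    using L2_complete[of \<psi>, OF test_function_L2(1)[OF t]] by blast
  moreover obtain g where "L2_tendsto M (\<lambda>k. grad (\<psi> k)) g"
    using L2_complete[of "\<lambda>k. grad (\<psi> k)", OF test_function_L2(2)[OF t] Cauchy] by blast
  ultimately show ?thesis by (rule that)
qed

end

section \<open>Power inequalities\<close>

text \<open>Apply ln z \<le> z - 1 to x and y divided by their weighted arithmetic mean c; the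
  linear terms then cancel. Equality forces ln z = z - 1, hence z = 1, at both quotients. The
  equality case is what later gives uniqueness of the minimiser.\<close>

lemma weighted_AM_GM:
  fixes x y s :: real
  assumes "x > 0" "y > 0" "0 < s" "s < 1"
  shows "x powr (1 - s) * y powr s \<le> (1 - s) * x + s * y"
    and "x powr (1 - s) * y powr s = (1 - s) * x + s * y \<Longrightarrow> x = y"
proof -
  define c where "c = (1 - s) * x + s * y"
  have c: "c > 0" using assms by (simp add: c_def add_pos_pos)
  have x: "ln (x / c) \<le> x / c - 1" and y: "ln (y / c) \<le> y / c - 1"
    using assms c by (auto intro!: ln_le_minus_one)
  have 0: "(1 - s) * (x / c - 1) + s * (y / c - 1) = 0"
    using c by (simp add: c_def field_simps)
  have ln: "ln (x powr (1 - s) * y powr s) = (1 - s) * ln (x / c) + s * ln (y / c) + ln c"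
    using assms c by (simp add: ln_mult ln_powr ln_div algebra_simps)
  have "(1 - s) * ln (x / c) + s * ln (y / c) \<le> (1 - s) * (x / c - 1) + s * (y / c - 1)"
    using assms by (intro add_mono mult_left_mono x y) auto
  then have "ln (x powr (1 - s) * y powr s) \<le> ln c" using 0 ln by linarith
  then show "x powr (1 - s) * y powr s \<le> (1 - s) * x + s * y"
    unfolding c_def[symmetric] using assms c by (simp add: ln_le_cancel_iff)
  assume "x powr (1 - s) * y powr s = (1 - s) * x + s * y"
  then have "(1 - s) * ln (x / c) + s * ln (y / c) = (1 - s) * (x / c - 1) + s * (y / c - 1)"
    using 0 ln by (simp add: c_def[symmetric])
  then have eq: "(1 - s) * (x / c - 1 - ln (x / c)) + s * (y / c - 1 - ln (y / c)) = 0"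
    by (simp add: algebra_simps)
  have "0 \<le> (1 - s) * (x / c - 1 - ln (x / c))" "0 \<le> s * (y / c - 1 - ln (y / c))"
    using assms x y by simp_all
  with eq have "(1 - s) * (x / c - 1 - ln (x / c)) = 0" "s * (y / c - 1 - ln (y / c)) = 0"
    by linarith+
  then have "ln (x / c) = x / c - 1" "ln (y / c) = y / c - 1" using assms by simp_all
  then have "x / c = 1" "y / c = 1"
    using ln_eq_minus_one[of "x / c"] ln_eq_minus_one[of "y / c"] assms(1,2) c by simp_all
  then show "x = y" using c by (simp add: field_simps)
qed

lemma weighted_AM_GM_nonneg:
  fixes x y s :: real
  assumes "x \<ge> 0" "y \<ge> 0" "0 < s" "s < 1"
  shows "x powr (1 - s) * y powr s \<le> (1 - s) * x + s * y"
proof (cases "x = 0 \<or> y = 0")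
  case True
  then show ?thesis using assms by auto
next
  case False
  then show ?thesis using assms by (intro weighted_AM_GM) auto
qed

text \<open>Weighted AM-GM for x powr (q + 1) and y powr (q + 1) with weights 1 / (q + 1) and q / (q
  + 1).\<close>

lemma young_powr:
  fixes x y q :: real
  assumes "x \<ge> 0" "y \<ge> 0" "0 < q"
  shows "(q + 1) * (x * y powr q) \<le> x powr (q + 1) + q * y powr (q + 1)"
proof -
  have s: "1 - q / (q + 1) = 1 / (q + 1)" using assms by (simp add: field_simps)
  have "(x powr (q + 1)) powr (1 - q / (q + 1)) * (y powr (q + 1)) powr (q / (q + 1))
      \<le> (1 - q / (q + 1)) * x powr (q + 1) + q / (q + 1) * y powr (q + 1)"
    using assms by (intro weighted_AM_GM_nonneg) auto
  then have "x * y powr q \<le> 1 / (q + 1) * x powr (q + 1) + q / (q + 1) * y powr (q + 1)"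
    using assms unfolding s by (simp add: powr_powr)
  then have "x * y powr q \<le> (x powr (q + 1) + q * y powr (q + 1)) / (q + 1)"
    by (simp add: add_divide_distrib)
  then show ?thesis using assms by (simp add: le_divide_eq mult.commute)
qed

text \<open>The tangent line at \<open>b\<close> of the convex function \<open>a \<mapsto> \<bar>a\<bar> powr (q + 1)\<close>.\<close>

lemma abs_powr_tangent:
  fixes a b q :: real
  assumes "0 < q"
  shows "(q + 1) * (sgn b * \<bar>b\<bar> powr q * (a - b)) \<le> \<bar>a\<bar> powr (q + 1) - \<bar>b\<bar> powr (q + 1)"
proof -
  have "sgn b * a \<le> \<bar>a\<bar>" by (cases b "0::real" rule: linorder_cases) auto
  then have "(q + 1) * (sgn b * a * \<bar>b\<bar> powr q) \<le> (q + 1) * (\<bar>a\<bar> * \<bar>b\<bar> powr q)"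
    using assms by (intro mult_left_mono mult_right_mono) auto
  also have "\<dots> \<le> \<bar>a\<bar> powr (q + 1) + q * \<bar>b\<bar> powr (q + 1)"
    using assms by (intro young_powr) auto
  finally have "(q + 1) * (sgn b * a * \<bar>b\<bar> powr q) \<le> \<bar>a\<bar> powr (q + 1) + q * \<bar>b\<bar> powr (q + 1)" .
  moreover have "sgn b * \<bar>b\<bar> powr q * b = \<bar>b\<bar> powr (q + 1)"
    by (cases b "0::real" rule: linorder_cases) (auto simp: powr_add)
  ultimately show ?thesis by (simp add: algebra_simps)
qed

lemma power2_powr:
  fixes y p :: real
  assumes "y \<ge> 0"
  shows "(y\<^sup>2) powr p = y powr (2 * p)"
proof (cases "y = 0")
  case False
  then have "y\<^sup>2 = y powr 2" using assms by (simp add: powr_numeral)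
  then show ?thesis by (simp only: powr_powr)
qed simp

lemma powr_le_1_add:
  fixes x p :: real
  assumes "0 \<le> x" "0 \<le> p" "p \<le> 1"
  shows "x powr p \<le> 1 + x"
proof (cases "x \<le> 1")
  case True
  then show ?thesis using powr_mono2[of p x 1] assms by simp
next
  case False
  then show ?thesis using powr_mono[of p 1 x] assms by simp
qed

text \<open>The tangent at b bounds the difference from below, the tangent at a from above. The
  slopes are estimated crudely by |c| powr q \<le> 1 + |c|, so that only products of L2 functions
  remain to be integrated.\<close>

lemma abs_powr_diff_le:
  fixes a b q :: real
  assumes "0 < q" "q < 1"
  shows "\<bar>\<bar>a\<bar> powr (q + 1) - \<bar>b\<bar> powr (q + 1)\<bar> \<le> 2 * (2 + 2 * \<bar>b\<bar> + \<bar>a - b\<bar>) * \<bar>a - b\<bar>"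
proof -
  let ?C = "2 * (2 + 2 * \<bar>b\<bar> + \<bar>a - b\<bar>)"
  define X where "X c = (q + 1) * (sgn c * \<bar>c\<bar> powr q * (a - b))" for c
  have *: "\<bar>X c\<bar> \<le> 2 * (1 + \<bar>c\<bar>) * \<bar>a - b\<bar>" for c
  proof -
    have "\<bar>X c\<bar> = \<bar>(q + 1) * (sgn c * \<bar>c\<bar> powr q * (a - b))\<bar>" by (simp add: X_def)
    also have "\<bar>(q + 1) * (sgn c * \<bar>c\<bar> powr q * (a - b))\<bar> = (q + 1) * (\<bar>sgn c\<bar> * \<bar>c\<bar> powr q) * \<bar>a - b\<bar>"
      using assms by (simp add: abs_mult mult.assoc)
    also have "\<dots> \<le> 2 * (1 * (1 + \<bar>c\<bar>)) * \<bar>a - b\<bar>"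
      using assms by (intro mult_right_mono mult_mono powr_le_1_add) (auto simp: abs_sgn_eq)
    finally show ?thesis by simp
  qed
  have "\<bar>a\<bar> \<le> \<bar>b\<bar> + \<bar>a - b\<bar>" using abs_triangle_ineq[of b "a - b"] by simp
  then have "2 * (1 + \<bar>a\<bar>) \<le> ?C" using abs_ge_zero[of b] abs_ge_zero[of "a - b"] by argo
  moreover have "2 * (1 + \<bar>b\<bar>) \<le> ?C" using abs_ge_zero[of b] abs_ge_zero[of "a - b"] by argo
  ultimately have "2 * (1 + \<bar>a\<bar>) * \<bar>a - b\<bar> \<le> ?C * \<bar>a - b\<bar>"
    "2 * (1 + \<bar>b\<bar>) * \<bar>a - b\<bar> \<le> ?C * \<bar>a - b\<bar>"
    by (simp_all only: mult_right_mono abs_ge_zero)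
  moreover have "(q + 1) * (sgn a * \<bar>a\<bar> powr q * (b - a)) = - X a"
    by (simp add: X_def algebra_simps)
  then have "\<bar>a\<bar> powr (q + 1) - \<bar>b\<bar> powr (q + 1) \<le> X a"
    using abs_powr_tangent[OF assms(1), of a b] by linarith
  moreover have "X b \<le> \<bar>a\<bar> powr (q + 1) - \<bar>b\<bar> powr (q + 1)"
    using abs_powr_tangent[OF assms(1), of b a] by (simp add: X_def)
  ultimately show ?thesis
    using *[of a, unfolded abs_le_iff] *[of b, unfolded abs_le_iff] unfolding abs_le_iff
    by linarith
qed

text \<open>Young's inequality with a free parameter: the power of \<open>e\<close> in the constant
  term is the one for which the powers e powr (- s) and e powr s, with s = (q + 1) / 2, cancel in
  the geometric mean.\<close>

lemma young_power_two:
  fixes x e q :: real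
  assumes "e > 0" "0 < q" "q < 1"
  shows "\<bar>x\<bar> powr (q + 1) \<le> (q + 1) / 2 * e * x\<^sup>2 + (1 - q) / 2 * e powr (- (q + 1) / (1 - q))"
proof -
  let ?s = "(q + 1) / 2"
  have s: "1 - ?s = (1 - q) / 2" by (simp add: field_simps)
  have "(e powr (- (q + 1) / (1 - q))) powr (1 - ?s) * (e * x\<^sup>2) powr ?s
      \<le> (1 - ?s) * e powr (- (q + 1) / (1 - q)) + ?s * (e * x\<^sup>2)"
    using assms by (intro weighted_AM_GM_nonneg) auto
  moreover have "(e powr (- (q + 1) / (1 - q))) powr (1 - ?s) = e powr (- ?s)"
  proof -
    have "- (q + 1) / (1 - q) * ((1 - q) / 2) = - ((q + 1) / 2)" using assms by (simp add: field_simps)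
    then show ?thesis by (simp only: s powr_powr)
  qed
  moreover have "(e * x\<^sup>2) powr ?s = e powr ?s * \<bar>x\<bar> powr (q + 1)"
  proof -
    have "2 * ?s = q + 1" by simp
    from power2_powr[of "\<bar>x\<bar>" ?s, unfolded this] show ?thesis using assms by (simp add: powr_mult)
  qed
  moreover have "e powr (- ?s) * (e powr ?s * \<bar>x\<bar> powr (q + 1)) = \<bar>x\<bar> powr (q + 1)"
    unfolding mult.assoc[symmetric] using assms by (simp flip: powr_add)
  ultimately have "\<bar>x\<bar> powr (q + 1) \<le> (1 - ?s) * e powr (- (q + 1) / (1 - q)) + ?s * (e * x\<^sup>2)"
    by (simp only:)
  then show ?thesis unfolding s by (simp only: mult.assoc add.commute)
qed

text \<open>The power mean of exponent \<open>q + 1 \<in> (1, 2)\<close> is controlled by the arithmetic mean and the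
  quadratic mean. Testing the energy against these two means shows that a minimising sequence is
  Cauchy.\<close>

lemma power_mean_interpolation:
  fixes a b q :: real
  assumes "0 < q" "q < 1" "a \<ge> 0" "b \<ge> 0"
  shows "(q + 1) * (a powr (q + 1) + b powr (q + 1)) / 2
    \<le> 2 * q * sqrt ((a\<^sup>2 + b\<^sup>2) / 2) powr (q + 1) + (1 - q) * ((a + b) / 2) powr (q + 1)"
proof (cases "a = 0 \<and> b = 0")
  case True
  then show ?thesis by simp
next
  case False
  define m where "m = (a + b) / 2"
  define s where "s = sqrt ((a\<^sup>2 + b\<^sup>2) / 2)"
  have m: "m > 0" using False assms by (auto simp: m_def)
  have "a\<^sup>2 + b\<^sup>2 > 0" using False by (simp add: sum_power2_gt_zero_iff)
  then have s: "s > 0" "s\<^sup>2 = (a\<^sup>2 + b\<^sup>2) / 2" by (auto simp: s_def)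
  \<comment> \<open>The ratios c / m and c^2 / s^2 each add up to 2 over c = a and c = b. Their
    weighted geometric mean is c powr (q + 1) / W, so AM-GM bounds the power sum by 2 W.\<close>
  define W where "W = m powr (1 - q) * (s\<^sup>2) powr q"
  have W: "W > 0" using m s by (simp add: W_def)
  have *: "c powr (q + 1) \<le> W * ((1 - q) * (c / m) + q * (c\<^sup>2 / s\<^sup>2))" if "c \<ge> 0" for c
  proof -
    have "(c / m) powr (1 - q) * (c\<^sup>2 / s\<^sup>2) powr q \<le> (1 - q) * (c / m) + q * (c\<^sup>2 / s\<^sup>2)"
      using assms that m by (intro weighted_AM_GM_nonneg) auto
    moreover have "(c / m) powr (1 - q) * (c\<^sup>2 / s\<^sup>2) powr q = c powr (q + 1) / W"
    proof (cases "c = 0")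
      case False
      have "(c\<^sup>2) powr q = c powr (2 * q)" using that by (rule power2_powr)
      moreover have "c powr (1 - q) * c powr (2 * q) = c powr (q + 1)" by (simp flip: powr_add)
      ultimately show ?thesis
        using that m s(1) by (simp add: powr_divide W_def times_divide_times_eq)
    qed simp
    ultimately show ?thesis using W by (simp add: field_simps)
  qed
  have "a powr (q + 1) + b powr (q + 1)
      \<le> W * ((1 - q) * (a / m) + q * (a\<^sup>2 / s\<^sup>2)) + W * ((1 - q) * (b / m) + q * (b\<^sup>2 / s\<^sup>2))"
    using assms by (intro add_mono *)
  also have "\<dots> = W * ((1 - q) * ((a + b) / m) + q * ((a\<^sup>2 + b\<^sup>2) / s\<^sup>2))"
    by (simp add: algebra_simps add_divide_distrib)
  also have "(a + b) / m = 2" using m by (simp add: m_def field_simps)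
  also have "(a\<^sup>2 + b\<^sup>2) / s\<^sup>2 = 2" using s by (simp add: field_simps)
  finally have 1: "a powr (q + 1) + b powr (q + 1) \<le> 2 * W" by (simp add: algebra_simps)
  \<comment> \<open>The weight for which the geometric mean of m powr (q + 1) and s powr (q + 1) is
    again W.\<close>
  let ?t = "2 * q / (q + 1)"
  have t: "1 - ?t = (1 - q) / (q + 1)" using assms by (simp add: field_simps)
  have "(m powr (q + 1)) powr (1 - ?t) * (s powr (q + 1)) powr ?t
      \<le> (1 - ?t) * m powr (q + 1) + ?t * s powr (q + 1)"
    using assms by (intro weighted_AM_GM_nonneg) auto
  moreover have "(s\<^sup>2) powr q = s powr (2 * q)" using s(1) by (intro power2_powr) simp
  ultimately have "W \<le> (1 - q) / (q + 1) * m powr (q + 1) + ?t * s powr (q + 1)"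
    unfolding t using assms by (simp add: powr_powr W_def)
  then have "W \<le> ((1 - q) * m powr (q + 1) + 2 * q * s powr (q + 1)) / (q + 1)"
    by (simp add: add_divide_distrib)
  then have "(q + 1) * W \<le> (1 - q) * m powr (q + 1) + 2 * q * s powr (q + 1)"
    using assms by (simp add: le_divide_eq mult.commute)
  moreover have "(q + 1) * (a powr (q + 1) + b powr (q + 1)) \<le> (q + 1) * (2 * W)"
    using 1 assms by (intro mult_left_mono) auto
  then have "(q + 1) * (a powr (q + 1) + b powr (q + 1)) / 2 \<le> (q + 1) * W" by simp
  ultimately show ?thesis unfolding m_def[symmetric] s_def[symmetric] by linarith
qed

text \<open>For v > 0 this is weighted AM-GM between u powr (q + 1) and u powr (q - 1) v^2, whose
  geometric mean with weight (q + 1) / 2 on the latter is v powr (q + 1). For v \<le> 0 the last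
  term alone is positive, since 1 / (q + 1) > 1 / 2.\<close>

lemma minimality_integrand:
  fixes u v q :: real
  assumes "0 < q" "q < 1" "u > 0"
  shows "0 \<le> u powr (q - 1) * v\<^sup>2 / 2 - \<bar>max 0 v\<bar> powr (q + 1) / (q + 1)
      - (1 / 2 - 1 / (q + 1)) * u powr (q + 1)" (is "0 \<le> ?f")
    and "u powr (q - 1) * v\<^sup>2 / 2 - \<bar>max 0 v\<bar> powr (q + 1) / (q + 1)
      - (1 / 2 - 1 / (q + 1)) * u powr (q + 1) = 0 \<Longrightarrow> v = u"
proof -
  have "0 \<le> ?f \<and> (?f = 0 \<longrightarrow> v = u)"
  proof (cases "v > 0")
    case False
    have "(1 / (q + 1) - 1 / 2) * u powr (q + 1) > 0"
      using assms by (intro mult_pos_pos) (auto simp: field_simps)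
    moreover have "0 \<le> u powr (q - 1) * v\<^sup>2 / 2" by simp
    moreover have "\<bar>max 0 v\<bar> powr (q + 1) = 0" using False by simp
    ultimately have "?f > 0" by (simp only: left_diff_distrib)
    then show ?thesis by simp
  next
    case True
    let ?s = "(q + 1) / 2"
    define X where "X = u powr (q + 1)"
    define Y where "Y = u powr (q - 1) * v\<^sup>2"
    have XY: "X > 0" "Y > 0" "0 < ?s" "?s < 1" using assms True by (auto simp: X_def Y_def)
    have "X powr (1 - ?s) * Y powr ?s = v powr (q + 1)"
    proof -
      have "(v\<^sup>2) powr ?s = v powr (2 * ?s)" using True by (intro power2_powr) simp
      then have "X powr (1 - ?s) * Y powr ?s =
          (u powr ((q + 1) * (1 - ?s)) * u powr ((q - 1) * ?s)) * v powr (2 * ?s)"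
        by (simp only: X_def Y_def powr_mult powr_powr mult.assoc)
      also have "u powr ((q + 1) * (1 - ?s)) * u powr ((q - 1) * ?s) = 1"
        using assms by (simp add: field_simps flip: powr_add)
      also have "2 * ?s = q + 1" by simp
      finally show ?thesis by simp
    qed
    note * = weighted_AM_GM[OF XY, unfolded this]
    have f: "(q + 1) * ?f = (1 - ?s) * X + ?s * Y - v powr (q + 1)"
    proof -
      have "(q + 1) * (y / 2 - c / (q + 1) - (1 / 2 - 1 / (q + 1)) * x) = (1 - ?s) * x + ?s * y - c"
        for x y c :: real
      proof -
        have "(q + 1) * (y / 2 - c / (q + 1) - (1 / 2 - 1 / (q + 1)) * x)
            = (q + 1) * y / 2 - (q + 1) * (c / (q + 1)) - ((q + 1) / 2 - (q + 1) * (1 / (q + 1))) * x"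
          by (simp only: right_diff_distrib mult.assoc[symmetric] times_divide_eq_right mult_1_right)
        moreover have "(q + 1) * (c / (q + 1)) = c" "(q + 1) * (1 / (q + 1)) = 1" using assms by simp_all
        ultimately show ?thesis by (simp add: algebra_simps add_divide_distrib)
      qed
      then show ?thesis using True by (simp add: X_def[symmetric] Y_def[symmetric])
    qed
    then have "0 \<le> (q + 1) * ?f" using *(1) by simp
    moreover have "v = u" if "?f = 0"
    proof -
      have "X = Y" using *(2) f that by simp
      moreover have "u powr (q + 1) = u powr (q - 1) * u powr 2"
        by (simp add: add.commute flip: powr_add)
      ultimately have "u powr (q - 1) * u\<^sup>2 = u powr (q - 1) * v\<^sup>2"
        using assms by (simp add: X_def Y_def)
      then show ?thesis using assms True by simp
    qed
    ultimately show ?thesis using assms by (simp add: zero_le_mult_iff)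
  qed
  then show "0 \<le> ?f" "?f = 0 \<Longrightarrow> v = u" by simp_all
qed

lemma linear_term_eq_0:
  fixes X Y :: real
  assumes "\<And>t. 0 \<le> t * X + t\<^sup>2 * Y" "Y \<ge> 0"
  shows "X = 0"
proof -
  \<comment> \<open>At this t the expression collapses to - t^2; the added 1 covers Y = 0.\<close>
  define t where "t = - X / (Y + 1)"
  have X: "X = - t * (Y + 1)" using assms(2) by (simp add: t_def)
  have "t * X + t\<^sup>2 * Y = - t\<^sup>2" unfolding X by (simp add: power2_eq_square algebra_simps)
  then have "t\<^sup>2 \<le> 0" using assms(1)[of t] by simp
  then show ?thesis using X by simp
qed

lemma sublinear_term_le_0:
  fixes Z Y q :: real
  assumes "\<And>t. t > 0 \<Longrightarrow> t powr (q + 1) * Z \<le> t\<^sup>2 * Y" "q < 1" "Y \<ge> 0"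
  shows "Z \<le> 0"
proof (rule ccontr)
  assume "\<not> Z \<le> 0"
  then have Z: "Z > 0" by simp
  \<comment> \<open>Chosen so that t powr (1 - q) Y \<le> Z / 2, which contradicts Z \<le> t powr (1
    - q) Y.\<close>
  define t where "t = (Z / (2 * (Y + 1))) powr (1 / (1 - q))"
  have t: "t > 0" using Z assms(3) by (simp add: t_def)
  have t': "t powr (1 - q) = Z / (2 * (Y + 1))" using Z assms(2,3) by (simp add: t_def powr_powr)
  have "t\<^sup>2 = t powr ((q + 1) + (1 - q))" using t by (simp add: powr_numeral)
  then have "t\<^sup>2 = t powr (q + 1) * t powr (1 - q)" by (simp only: powr_add)
  then have "t powr (q + 1) * Z \<le> t powr (q + 1) * (t powr (1 - q) * Y)"
    using assms(1)[OF t] by (simp add: mult.assoc)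
  then have "Z \<le> t powr (1 - q) * Y" by (rule mult_left_le_imp_le) (use t in simp)
  then have "Z \<le> Z / (2 * (Y + 1)) * Y" unfolding t' .
  also have "\<dots> \<le> Z / 2" using Z assms(3) by (simp add: field_simps)
  finally show False using Z by simp
qed

section \<open>Existence of a positive minimiser\<close>

locale sublinear_problem = bounded_open_set +
  fixes q A :: real and \<alpha> :: "'a \<Rightarrow> real"
  assumes q: "0 < q" "q < 1"
    and \<alpha>_measurable[measurable]: "\<alpha> \<in> borel_measurable M"
    and \<alpha>_pos: "AE x in M. 0 < \<alpha> x" and \<alpha>_le: "AE x in M. \<alpha> x \<le> A" and A_pos: "A > 0"
begin

section \<open>The sublinear integral\<close>

lemma square_integrable_\<alpha>_mult:
  assumes "square_integrable M f"
  shows "square_integrable M (\<lambda>x. \<alpha> x * (f x :: real))"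
proof (rule square_integrable_bound[OF square_integrable_cmult[OF assms, of A]])
  show "(\<lambda>x. \<alpha> x * f x) \<in> borel_measurable M"
    using square_integrable_measurable[OF assms] by measurable
  show "AE x in M. norm (\<alpha> x * f x) \<le> norm (A * f x)"
    using \<alpha>_pos \<alpha>_le by eventually_elim (simp add: abs_mult mult_right_mono)
qed

lemma square_integrable_const: "square_integrable M (\<lambda>x. c :: real)"
  by (rule square_integrable_bounded[where B="\<bar>c\<bar>"]) auto

lemma integrable_\<alpha>_mult:
  assumes "integrable M f"
  shows "integrable M (\<lambda>x. \<alpha> x * (f x :: real))"
proof (rule Bochner_Integration.integrable_bound)
  show "integrable M (\<lambda>x. A * f x)" using assms by simp
  show "(\<lambda>x. \<alpha> x * f x) \<in> borel_measurable M" using assms by measurable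
  show "AE x in M. norm (\<alpha> x * f x) \<le> norm (A * f x)"
    using \<alpha>_pos \<alpha>_le by eventually_elim (simp add: abs_mult mult_right_mono)
qed

lemma square_integrable_powr:
  assumes "square_integrable M f"
  shows "square_integrable M (\<lambda>x. \<bar>f x :: real\<bar> powr q)"
proof (rule square_integrable_bound[OF square_integrable_add[OF square_integrable_const square_integrable_norm[OF assms]]])
  show "(\<lambda>x. \<bar>f x\<bar> powr q) \<in> borel_measurable M"
    using square_integrable_measurable[OF assms] by measurable
  show "AE x in M. norm (\<bar>f x\<bar> powr q) \<le> norm (1 + norm (f x))"
    using q powr_le_1_add[of "\<bar>f x\<bar>" q for x] by simp
qed

lemma integrable_powr:
  assumes "square_integrable M f"
  shows "integrable M (\<lambda>x. \<bar>f x :: real\<bar> powr (q + 1))"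
proof -
  have "integrable M (\<lambda>x. \<bar>f x\<bar> powr q * \<bar>f x\<bar>)"
    using square_integrable_mult[OF square_integrable_powr[OF assms] square_integrable_norm[OF assms]]
    by simp
  then show ?thesis by (simp add: powr_add)
qed

text \<open>With |u| in place of the positive part: both agree on nonnegative functions, and
  evenness allows the infimum over nonnegative test functions to be compared with functions of any
  sign.\<close>

definition F :: "('a \<Rightarrow> real) \<Rightarrow> real" where
  "F u = 1 / (q + 1) * (\<integral>x. \<alpha> x * \<bar>u x\<bar> powr (q + 1) \<partial>M)"

lemma integrable_\<alpha>_powr: "square_integrable M f \<Longrightarrow> integrable M (\<lambda>x. \<alpha> x * \<bar>f x :: real\<bar> powr (q + 1))"
  by (intro integrable_\<alpha>_mult integrable_powr)

text \<open>The growth is at most quadratic, so the difference is bounded by the L2 distance times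
  the L2 norm of a fixed weight, plus the squared L2 distance.\<close>

lemma F_tendsto:
  assumes "L2_tendsto M f u"
  shows "(\<lambda>k. F (f k)) \<longlonglongrightarrow> F u"
proof -
  let ?d = "\<lambda>k x. \<alpha> x * \<bar>f k x\<bar> powr (q + 1) - \<alpha> x * \<bar>u x\<bar> powr (q + 1)"
  have si: "square_integrable M (f k)" "square_integrable M u" for k
    using assms by (auto simp: L2_tendsto_def)
  let ?I = "\<lambda>u. \<integral>x. \<alpha> x * \<bar>u x\<bar> powr (q + 1) \<partial>M"
  let ?w = "\<lambda>x. 2 * (2 + 2 * \<bar>u x\<bar>)"
  let ?N = "\<lambda>k. sqrt (sqnorm M (\<lambda>x. f k x - u x))"
  have w: "square_integrable M ?w"
    using square_integrable_norm[OF si(2)]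
    by (intro square_integrable_cmult square_integrable_add square_integrable_const) simp
  have "(\<lambda>k. ?I (f k)) \<longlonglongrightarrow> ?I u"
  proof (rule LIM_zero_cancel, rule Lim_null_comparison)
    show "\<forall>\<^sub>F k in sequentially. norm (?I (f k) - ?I u)
        \<le> A * (sqrt (\<integral>x. (?w x)\<^sup>2 \<partial>M) * ?N k + 2 * (?N k)\<^sup>2)"
    proof (intro always_eventually allI)
      fix k
      have d: "square_integrable M (\<lambda>x. f k x - u x)" by (intro square_integrable_diff si)
      note int = square_integrable_mult[OF w square_integrable_norm[OF d]] square_integrable_power2[OF d]
      have "norm (?I (f k) - ?I u) = \<bar>\<integral>x. ?d k x \<partial>M\<bar>"
        by (simp add: integrable_\<alpha>_powr si)
      also have "\<dots> \<le> (\<integral>x. \<bar>?d k x\<bar> \<partial>M)"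
        by (rule integral_abs_bound)
      also have "\<dots> \<le> (\<integral>x. A * (?w x * norm (f k x - u x) + 2 * (f k x - u x)\<^sup>2) \<partial>M)"
      proof (rule integral_mono_AE)
        show "integrable M (\<lambda>x. \<bar>?d k x\<bar>)"
          by (intro integrable_abs Bochner_Integration.integrable_diff integrable_\<alpha>_powr si)
        show "integrable M (\<lambda>x. A * (?w x * norm (f k x - u x) + 2 * (f k x - u x)\<^sup>2))"
          using int by auto
        show "AE x in M. \<bar>?d k x\<bar>
            \<le> A * (?w x * norm (f k x - u x) + 2 * (f k x - u x)\<^sup>2)"
          using \<alpha>_pos \<alpha>_le
        proof eventually_elim
          case (elim x)
          have "\<bar>?d k x\<bar>
              = \<alpha> x * \<bar>\<bar>f k x\<bar> powr (q + 1) - \<bar>u x\<bar> powr (q + 1)\<bar>"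
            using elim by (simp add: abs_mult flip: right_diff_distrib)
          also have "\<dots> \<le> A * (2 * (2 + 2 * \<bar>u x\<bar> + \<bar>f k x - u x\<bar>) * \<bar>f k x - u x\<bar>)"
            using elim by (intro mult_mono abs_powr_diff_le q) auto
          also have "2 * (2 + 2 * \<bar>u x\<bar> + \<bar>f k x - u x\<bar>) * \<bar>f k x - u x\<bar>
              = ?w x * norm (f k x - u x) + 2 * (f k x - u x)\<^sup>2"
            by (simp add: power2_eq_square distrib_left distrib_right)
          finally show ?case .
        qed
      qed
      also have "\<dots> = A * ((\<integral>x. ?w x * norm (f k x - u x) \<partial>M) + 2 * (\<integral>x. (f k x - u x)\<^sup>2 \<partial>M))"
        using int by simp
      also have "\<dots> \<le> A * (sqrt (\<integral>x. (?w x)\<^sup>2 \<partial>M) * ?N k + 2 * (?N k)\<^sup>2)"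
        using integral_Cauchy_Schwarz_real[OF w square_integrable_norm[OF d]] A_pos
        by (intro mult_left_mono add_mono) auto
      finally show "norm (?I (f k) - ?I u) \<le> A * (sqrt (\<integral>x. (?w x)\<^sup>2 \<partial>M) * ?N k + 2 * (?N k)\<^sup>2)" .
    qed
    have "(\<lambda>k. A * (sqrt (\<integral>x. (?w x)\<^sup>2 \<partial>M) * ?N k + 2 * (?N k)\<^sup>2)) \<longlonglongrightarrow> A * (sqrt (\<integral>x. (?w x)\<^sup>2 \<partial>M) * 0 + 2 * 0\<^sup>2)"
      by (intro tendsto_intros L2_tendsto_norm_diff assms)
    then show "(\<lambda>k. A * (sqrt (\<integral>x. (?w x)\<^sup>2 \<partial>M) * ?N k + 2 * (?N k)\<^sup>2)) \<longlonglongrightarrow> 0" by simp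
  qed
  then show ?thesis unfolding F_def by (intro tendsto_intros)
qed

section \<open>The energy on test functions and its infimum\<close>

definition J :: "('a \<Rightarrow> real) \<Rightarrow> real" where
  "J u = 1 / 2 * sqnorm M (grad u) - F u"

definition nonneg_tests :: "('a \<Rightarrow> real) set" where
  "nonneg_tests = {\<psi>. test_function \<Omega> \<psi> \<and> (\<forall>x. \<psi> x \<ge> 0)}"

text \<open>The free \<open>e\<close> is fixed twice: once through the Poincare constant, to bound
  the energy below, and once through \<open>lambda1\<close>, for the final estimate.\<close>

lemma F_le:
  assumes "square_integrable M u" "e > 0"
  shows "F u \<le> 1 / 2 * e * A * (\<integral>x. (u x)\<^sup>2 \<partial>M)
    + (1 - q) / (2 * (q + 1)) * e powr (- (q + 1) / (1 - q)) * (\<integral>x. \<alpha> x \<partial>M)"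
proof -
  define C where "C = (1 - q) / 2 * e powr (- (q + 1) / (1 - q))"
  have int: "integrable M \<alpha>" using square_integrable_\<alpha>_mult[OF square_integrable_const[of 1]]
    by (auto dest: square_integrable_imp_integrable)
  note u2 = square_integrable_power2[OF assms(1)]
  have "(\<integral>x. \<alpha> x * \<bar>u x\<bar> powr (q + 1) \<partial>M) \<le> (\<integral>x. (q + 1) / 2 * e * A * (u x)\<^sup>2 + C * \<alpha> x \<partial>M)"
  proof (rule integral_mono_AE)
    show "integrable M (\<lambda>x. \<alpha> x * \<bar>u x\<bar> powr (q + 1))" by (intro integrable_\<alpha>_powr assms)
    show "integrable M (\<lambda>x. (q + 1) / 2 * e * A * (u x)\<^sup>2 + C * \<alpha> x)" using u2 int by auto
    show "AE x in M. \<alpha> x * \<bar>u x\<bar> powr (q + 1) \<le> (q + 1) / 2 * e * A * (u x)\<^sup>2 + C * \<alpha> x"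
      using \<alpha>_pos \<alpha>_le
    proof eventually_elim
      case (elim x)
      have "\<alpha> x * \<bar>u x\<bar> powr (q + 1) \<le> \<alpha> x * ((q + 1) / 2 * e * (u x)\<^sup>2 + C)"
        unfolding C_def using elim assms(2) q by (intro mult_left_mono young_power_two) auto
      also have "\<dots> = \<alpha> x * ((q + 1) / 2 * e * (u x)\<^sup>2) + C * \<alpha> x" by (simp add: algebra_simps)
      also have "\<alpha> x * ((q + 1) / 2 * e * (u x)\<^sup>2) \<le> A * ((q + 1) / 2 * e * (u x)\<^sup>2)"
        using elim assms(2) q by (intro mult_right_mono) auto
      finally show ?case by (simp add: algebra_simps)
    qed
  qed
  also have "\<dots> = (q + 1) / 2 * e * A * (\<integral>x. (u x)\<^sup>2 \<partial>M) + C * (\<integral>x. \<alpha> x \<partial>M)"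
    using u2 int by simp
  finally have "F u \<le> 1 / (q + 1) * ((q + 1) / 2 * e * A * (\<integral>x. (u x)\<^sup>2 \<partial>M) + C * (\<integral>x. \<alpha> x \<partial>M))"
    unfolding F_def using q by (intro mult_left_mono) auto
  also have "\<dots> = 1 / 2 * e * A * (\<integral>x. (u x)\<^sup>2 \<partial>M) + C / (q + 1) * (\<integral>x. \<alpha> x \<partial>M)"
    using q by (simp add: distrib_left)
  finally show ?thesis by (simp add: C_def)
qed

definition m0 :: real where "m0 = (INF \<psi>\<in>nonneg_tests. J \<psi>)"

lemma J_bdd_below: "bdd_below (J ` nonneg_tests)"
proof -
  obtain P where P: "P > 0" "\<And>\<phi>. test_function \<Omega> \<phi> \<Longrightarrow>
    (\<integral>x. (\<phi> x)\<^sup>2 \<partial>M) \<le> P * sqnorm M (grad \<phi>)" by (rule poincare_test) blast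
  \<comment> \<open>With this \<open>e\<close> the quadratic term is absorbed by half the Dirichlet
    energy exactly.\<close>
  define e where "e = 1 / (A * P)"
  have e: "e > 0" using P A_pos by (simp add: e_def)
  have "- ((1 - q) / (2 * (q + 1)) * e powr (- (q + 1) / (1 - q)) * (\<integral>x. \<alpha> x \<partial>M)) \<le> J \<psi>"
    if "test_function \<Omega> \<psi>" for \<psi>
  proof -
    have "1 / 2 * e * A * (\<integral>x. (\<psi> x)\<^sup>2 \<partial>M) \<le> 1 / 2 * e * A * (P * sqnorm M (grad \<psi>))"
      using e A_pos P(2)[OF that] by (intro mult_left_mono) auto
    also have "\<dots> = 1 / 2 * sqnorm M (grad \<psi>)" using P A_pos by (simp add: e_def)
    finally show ?thesis
      using F_le[OF test_function_L2(1)[OF that] e] by (simp add: J_def)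
  qed
  then show ?thesis by (intro bdd_belowI2) (auto simp: nonneg_tests_def)
qed

lemma m0_le: "\<psi> \<in> nonneg_tests \<Longrightarrow> m0 \<le> J \<psi>"
  unfolding m0_def by (rule cINF_lower[OF J_bdd_below])

text \<open>The competitor \<open>sqrt ((a\<^sup>2 + b\<^sup>2) / 2)\<close> is made smooth by a small parameter \<open>d\<close>.\<close>

lemma quadratic_mean_test:
  fixes a b :: "'a \<Rightarrow> real"
  assumes a: "test_function \<Omega> a" and b: "test_function \<Omega> b" and d: "d > 0"
  defines "s \<equiv> \<lambda>x. sqrt (((a x)\<^sup>2 + (b x)\<^sup>2) / 2 + d\<^sup>2) - d"
  shows "s \<in> nonneg_tests"
    and "(norm (grad s x))\<^sup>2 \<le> ((norm (grad a x))\<^sup>2 + (norm (grad b x))\<^sup>2) / 2"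
    and "\<bar>s x - sqrt (((a x)\<^sup>2 + (b x)\<^sup>2) / 2)\<bar> \<le> d"
proof -
  let ?y = "\<lambda>x. ((a x)\<^sup>2 + (b x)\<^sup>2) / 2"
  note sm = a[THEN test_function_smooth] b[THEN test_function_smooth]
  let ?f = "\<lambda>x. 1 / 2 * (a x * a x + b x * b x) + d\<^sup>2"
  have f_eq: "?y x + d\<^sup>2 = ?f x" for x by (simp add: power2_eq_square)
  have f_pos: "?f x > 0" for x using d by (intro add_nonneg_pos) auto
  have f_smooth: "smooth ?f" by (intro smooth_add smooth_mult smooth_const sm)
  have s_smooth: "smooth s" unfolding s_def f_eq
    by (intro smooth_diff smooth_sqrt smooth_const f_smooth f_pos)
  \<comment> \<open>Where \<open>a\<close> and \<open>b\<close> both vanish the root equals d, so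
    subtracting d keeps the support compact.\<close>
  have "test_function \<Omega> s"
    by (rule test_function_comb[OF a b s_smooth]) (use d in \<open>simp add: s_def\<close>)
  moreover have "s x \<ge> 0" for x using d by (simp add: s_def real_le_rsqrt)
  ultimately show "s \<in> nonneg_tests" by (simp add: nonneg_tests_def)
  show "\<bar>s x - sqrt (?y x)\<bar> \<le> d"
  proof -
    have "sqrt (?y x) \<le> sqrt (?y x + d\<^sup>2)" by simp
    moreover have "sqrt (?y x + d\<^sup>2) \<le> sqrt (?y x) + sqrt (d\<^sup>2)"
      by (rule sqrt_add_le_add_sqrt) auto
    ultimately show ?thesis using d unfolding s_def by simp
  qed
  show "(norm (grad s x))\<^sup>2 \<le> ((norm (grad a x))\<^sup>2 + (norm (grad b x))\<^sup>2) / 2"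
  proof -
    let ?G = "a x *\<^sub>R grad a x + b x *\<^sub>R grad b x"
    define N where "N = (norm (grad a x))\<^sup>2 + (norm (grad b x))\<^sup>2"
    have "grad ?f x = ?G"
      by (simp add: grad_add grad_cmult grad_mult grad_const smooth_add smooth_mult smooth_const sm
          del: times_divide_eq_left)
        (simp add: algebra_simps flip: scaleR_add_left)
    moreover have "((\<lambda>y. sqrt y - d) has_real_derivative (inverse (sqrt (?f x)) / 2)) (at (?f x))"
      using f_pos[of x] by (auto intro!: derivative_eq_intros)
    ultimately have grad_s: "grad s x = (inverse (sqrt (?f x)) / 2) *\<^sub>R ?G"
      unfolding s_def f_eq using grad_compose[OF f_smooth, of "\<lambda>y. sqrt y - d" _ x] by simp
    have "norm ?G \<le> \<bar>a x\<bar> * norm (grad a x) + \<bar>b x\<bar> * norm (grad b x)"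
      using norm_triangle_ineq[of "a x *\<^sub>R grad a x" "b x *\<^sub>R grad b x"] by simp
    then have "(norm ?G)\<^sup>2 \<le> (\<bar>a x\<bar> * norm (grad a x) + \<bar>b x\<bar> * norm (grad b x))\<^sup>2"
      by (rule power_mono) simp
    also have "\<dots> \<le> ((a x)\<^sup>2 + (b x)\<^sup>2) * N"
    proof -
      \<comment> \<open>Lagrange's identity: the defect in the Cauchy-Schwarz inequality is a
        square.\<close>
      have "((a x)\<^sup>2 + (b x)\<^sup>2) * N - (\<bar>a x\<bar> * norm (grad a x) + \<bar>b x\<bar> * norm (grad b x))\<^sup>2
          = (\<bar>a x\<bar> * norm (grad b x) - \<bar>b x\<bar> * norm (grad a x))\<^sup>2"
        unfolding N_def power2_abs[of "a x", symmetric] power2_abs[of "b x", symmetric]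
        by (simp add: power2_eq_square algebra_simps)
      then show ?thesis by (smt (verit) zero_le_power2)
    qed
    also have "\<dots> \<le> 2 * ?f x * N"
    proof (rule mult_right_mono)
      have "2 * ?f x = (a x)\<^sup>2 + (b x)\<^sup>2 + 2 * d\<^sup>2" by (simp add: power2_eq_square field_simps)
      then show "(a x)\<^sup>2 + (b x)\<^sup>2 \<le> 2 * ?f x" by (simp only: le_add_same_cancel1) simp
    qed (simp add: N_def)
    finally have G: "(norm ?G)\<^sup>2 \<le> 2 * ?f x * N" .
    have "(norm (grad s x))\<^sup>2 = (inverse (sqrt (?f x)) / 2)\<^sup>2 * (norm ?G)\<^sup>2"
      unfolding grad_s norm_scaleR power_mult_distrib by simp
    also have "(inverse (sqrt (?f x)) / 2)\<^sup>2 = inverse (?f x) / 4"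
      using f_pos[of x] by (simp add: power_divide power_inverse)
    also have "inverse (?f x) / 4 * (norm ?G)\<^sup>2 \<le> inverse (?f x) / 4 * (2 * ?f x * N)"
      using f_pos[of x] G by (intro mult_left_mono) (auto simp only: inverse_nonnegative_iff_nonnegative divide_nonneg_pos less_imp_le)
    also have "\<dots> = N / 2"
    proof -
      have "inverse y / 4 * (2 * y * N) = N / 2" if "y > 0" for y :: real using that by simp
      from this[OF f_pos[of x]] show ?thesis .
    qed
    finally show ?thesis by (simp add: N_def)
  qed
qed

text \<open>The regularised means converge uniformly, hence in L2 on the bounded domain, and
  \<open>F\<close> follows. The gradient bound is uniform in the parameter, so the quadratic mean
  itself is never differentiated.\<close>

lemma m0_le_quadratic_mean:
  assumes a: "test_function \<Omega> a" and b: "test_function \<Omega> b"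
  shows "m0 \<le> (sqnorm M (grad a) + sqnorm M (grad b)) / 4
    - F (\<lambda>x. sqrt (((a x)\<^sup>2 + (b x)\<^sup>2) / 2))"
proof -
  let ?s = "\<lambda>x. sqrt (((a x)\<^sup>2 + (b x)\<^sup>2) / 2)"
  define E where "E = (sqnorm M (grad a) + sqnorm M (grad b)) / 4"
  define d where "d n = 1 / real (Suc n)" for n
  have d: "d n > 0" for n by (simp add: d_def)
  have d_lim: "d \<longlonglongrightarrow> 0"
    using LIMSEQ_Suc[OF lim_1_over_n] by (auto simp: d_def[abs_def])
  define s where "s n x = sqrt (((a x)\<^sup>2 + (b x)\<^sup>2) / 2 + (d n)\<^sup>2) - d n" for n x
  have s: "s n \<in> nonneg_tests"
    "(norm (grad (s n) x))\<^sup>2 \<le> ((norm (grad a x))\<^sup>2 + (norm (grad b x))\<^sup>2) / 2"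
    "\<bar>s n x - ?s x\<bar> \<le> d n" for n x
    unfolding s_def[abs_def] by (fact quadratic_mean_test[OF a b d])+
  note si = test_function_L2[OF a] test_function_L2[OF b]
  have s_test: "test_function \<Omega> (s n)" for n using s(1)[of n] by (simp add: nonneg_tests_def)
  note [measurable] = si[THEN square_integrable_measurable]
    s_test[THEN test_function_L2(1), THEN square_integrable_measurable]
  have s'_si: "square_integrable M ?s" by (rule square_integrable_quadratic_mean[OF si(1,3)])
  have "L2_tendsto M s ?s"
    unfolding L2_tendsto_def
  proof (intro conjI allI s'_si test_function_L2(1) s_test)
    show "(\<lambda>n. sqnorm M (\<lambda>x. s n x - ?s x)) \<longlonglongrightarrow> 0"
    proof (rule tendsto_sandwich[OF _ _ tendsto_const])
      show "\<forall>\<^sub>F n in sequentially. (sqnorm M (\<lambda>x. s n x - ?s x)) \<le> (\<integral>x. (d n)\<^sup>2 \<partial>M)"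
      proof (intro always_eventually allI integral_mono)
        fix n
        show "integrable M (\<lambda>x. (norm (s n x - ?s x))\<^sup>2)"
          by (intro square_integrable_norm_power2 square_integrable_diff s'_si
              test_function_L2(1) s_test)
        show "(norm (s n x - ?s x))\<^sup>2 \<le> (d n)\<^sup>2" for x
          using s(3)[of n x] by (intro power_mono) auto
      qed auto
      have "(\<lambda>n. (d n)\<^sup>2 * measure M (space M)) \<longlonglongrightarrow> 0\<^sup>2 * measure M (space M)"
        by (intro tendsto_intros d_lim)
      then show "(\<lambda>n. \<integral>x. (d n)\<^sup>2 \<partial>M) \<longlonglongrightarrow> 0" by (simp add: mult.commute)
    qed simp
  qed
  then have lim: "(\<lambda>n. E - F (s n)) \<longlonglongrightarrow> E - F ?s"
    by (intro tendsto_intros F_tendsto)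
  have "m0 \<le> E - F (s n)" for n
  proof -
    have "(sqnorm M (grad (s n)))
        \<le> (\<integral>x. ((norm (grad a x))\<^sup>2 + (norm (grad b x))\<^sup>2) / 2 \<partial>M)"
      using si s_test[of n, THEN test_function_L2(2)] s(2)
      by (intro integral_mono) (auto intro!: square_integrable_norm_power2)
    also have "\<dots> = 2 * E" using si by (simp add: E_def square_integrable_norm_power2)
    finally show ?thesis using m0_le[OF s(1)[of n]] by (simp add: J_def)
  qed
  then show ?thesis unfolding E_def[symmetric] by (intro LIMSEQ_le_const[OF lim]) auto
qed

text \<open>With equal arguments the quadratic mean is |a|, so the sign restriction on the
  competitors does not raise the infimum.\<close>

lemma m0_le_test:
  assumes "test_function \<Omega> a"
  shows "m0 \<le> J a"
  using m0_le_quadratic_mean[OF assms assms] by (simp add: J_def F_def)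

lemma m0_le_H10:
  assumes "H10_grad w h"
  shows "m0 \<le> 1 / 2 * sqnorm M h - F w"
proof -
  obtain \<phi> where \<phi>: "\<And>k. test_function \<Omega> (\<phi> k)" "L2_tendsto M \<phi> w" "L2_tendsto M (\<lambda>k. grad (\<phi> k)) h"
    by (rule H10_gradE[OF assms]) blast
  have "(\<lambda>k. J (\<phi> k)) \<longlonglongrightarrow> 1 / 2 * sqnorm M h - F w"
    unfolding J_def by (intro tendsto_intros L2_tendsto_norm_power2 F_tendsto \<phi>)
  then show ?thesis by (rule LIMSEQ_le_const) (use m0_le_test \<phi>(1) in auto)
qed

text \<open>The weights 2 q and 1 - q of \<open>power_mean_interpolation\<close> add up to q + 1, so
  the weighted sum of the two comparisons reproduces the average of \<open>J a\<close> and
  \<open>J b\<close>. What remains is the parallelogram deficit of the arithmetic mean, with factor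
  (1 - q) / 8.\<close>

lemma minimising_gap:
  assumes "a \<in> nonneg_tests" "b \<in> nonneg_tests"
  shows "(1 - q) * sqnorm M (\<lambda>x. grad a x - grad b x) / 8 \<le> (q + 1) * ((J a + J b) / 2 - m0)"
proof -
  have t: "test_function \<Omega> a" "test_function \<Omega> b" and nonneg: "\<And>x. a x \<ge> 0" "\<And>x. b x \<ge> 0"
    using assms by (auto simp: nonneg_tests_def)
  note sm = t[THEN test_function_smooth]
  note si = test_function_L2[OF t(1)] test_function_L2[OF t(2)]
  note [measurable] = si[THEN square_integrable_measurable]
  let ?m = "\<lambda>x. 1 / 2 * (a x + b x)"
  let ?s = "\<lambda>x. sqrt (((a x)\<^sup>2 + (b x)\<^sup>2) / 2)"
  let ?E = "\<lambda>h::'a \<Rightarrow> 'a. sqnorm M (\<lambda>x. h x)"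
  have m: "?m \<in> nonneg_tests"
    using t nonneg by (auto simp: nonneg_tests_def simp del: times_divide_eq_left
        intro!: test_function_cmult test_function_add)
  have s_si: "square_integrable M ?s" by (rule square_integrable_quadratic_mean[OF si(1,3)])
  have grad_m: "grad ?m x = (1 / 2) *\<^sub>R (grad a x + grad b x)" for x
    by (simp only: grad_cmult[OF smooth_add[OF sm]] grad_add[OF sm])
  have E_m: "?E (grad ?m) = (?E (grad a) + ?E (grad b)) / 2 - ?E (\<lambda>x. grad a x - grad b x) / 4"
  proof -
    have "(norm (grad ?m x))\<^sup>2 = ((norm (grad a x))\<^sup>2 + (norm (grad b x))\<^sup>2) / 2
        - (norm (grad a x - grad b x))\<^sup>2 / 4" for x
      unfolding grad_m norm_scaleR power_mult_distrib power2_norm_eq_inner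
      by (simp add: inner_add_left inner_add_right inner_diff_left inner_diff_right inner_commute
          power2_eq_square field_simps)
    then show ?thesis
      using si by (simp add: square_integrable_norm_power2 square_integrable_diff)
  qed
  have m_si: "square_integrable M ?m"
    using m by (auto simp: nonneg_tests_def intro: test_function_L2)
  have F_ineq: "(q + 1) * (F a + F b) / 2 \<le> 2 * q * F ?s + (1 - q) * F ?m"
  proof -
    let ?I = "\<lambda>u. \<integral>x. \<alpha> x * \<bar>u x\<bar> powr (q + 1) \<partial>M"
    let ?w = "\<lambda>u x. \<alpha> x * \<bar>u x\<bar> powr (q + 1)"
    note int = integrable_\<alpha>_powr[OF si(1)] integrable_\<alpha>_powr[OF si(3)] integrable_\<alpha>_powr[OF s_si]
      integrable_\<alpha>_powr[OF m_si]
    have "(q + 1) / 2 * (?I a + ?I b) = (\<integral>x. (q + 1) / 2 * (?w a x + ?w b x) \<partial>M)"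
      using int by simp
    also have "\<dots> \<le> (\<integral>x. 2 * q * (?w ?s x) + (1 - q) * (?w ?m x) \<partial>M)"
    proof (rule integral_mono_AE)
      show "AE x in M. (q + 1) / 2 * (?w a x + ?w b x)
        \<le> 2 * q * (?w ?s x) + (1 - q) * (?w ?m x)"
        using \<alpha>_pos
      proof eventually_elim
        case (elim x)
        have "\<alpha> x * ((q + 1) * (a x powr (q + 1) + b x powr (q + 1)) / 2)
          \<le> \<alpha> x * (2 * q * ?s x powr (q + 1) + (1 - q) * ((a x + b x) / 2) powr (q + 1))"
          using elim by (intro mult_left_mono power_mean_interpolation q nonneg) auto
        moreover have "\<bar>?s x\<bar> = ?s x" "\<bar>?m x\<bar> = (a x + b x) / 2" using nonneg[of x] by auto
        ultimately show ?case
          using nonneg[of x] by (simp only: abs_of_nonneg) (simp add: algebra_simps add_divide_distrib)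
      qed
    qed (intro Bochner_Integration.integrable_add Bochner_Integration.integrable_mult_right int)+
    also have "\<dots> = 2 * q * ?I ?s + (1 - q) * ?I ?m" using int by simp
    finally have le: "(q + 1) / 2 * (?I a + ?I b) \<le> 2 * q * ?I ?s + (1 - q) * ?I ?m" .
    define c where "c = 1 / (q + 1)"
    have "F u = c * ?I u" for u by (simp add: F_def c_def)
    moreover have "c * ((q + 1) / 2 * (?I a + ?I b)) \<le> c * (2 * q * ?I ?s + (1 - q) * ?I ?m)"
      using q le by (intro mult_left_mono) (auto simp: c_def)
    ultimately show ?thesis by (simp add: algebra_simps add_divide_distrib)
  qed
  have 1: "2 * q * m0 \<le> 2 * q * ((?E (grad a) + ?E (grad b)) / 4 - F ?s)"
    using m0_le_quadratic_mean[OF t] q by (intro mult_left_mono) auto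
  have 2: "(1 - q) * m0 \<le> (1 - q) * (1 / 2 * ?E (grad ?m) - F ?m)"
    using m0_le[OF m] q unfolding J_def by (intro mult_left_mono) auto
  show ?thesis
    using 1 2 F_ineq unfolding E_m J_def by (simp add: field_simps)
qed

lemma minimiser_exists:
  obtains u g where "H10_grad u g" "AE x in M. 0 \<le> u x"
    "1 / 2 * sqnorm M g - F u = m0"
proof -
  have ne: "nonneg_tests \<noteq> {}" using test_function_0 by (auto simp: nonneg_tests_def)
  have "\<exists>\<psi>\<in>nonneg_tests. J \<psi> < m0 + 1 / real (Suc n)" for n
    using cInf_lessD[of "J ` nonneg_tests" "m0 + 1 / real (Suc n)"] ne by (auto simp: m0_def)
  then obtain \<psi> where \<psi>: "\<And>n. \<psi> n \<in> nonneg_tests" "\<And>n. J (\<psi> n) < m0 + 1 / real (Suc n)"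
    by metis
  have t: "test_function \<Omega> (\<psi> n)" for n using \<psi>(1) by (simp add: nonneg_tests_def)
  have inv: "(\<lambda>n. 1 / real (Suc n)) \<longlonglongrightarrow> 0" using LIMSEQ_Suc[OF lim_1_over_n] by simp
  have "\<exists>N. \<forall>i\<ge>N. \<forall>j\<ge>N. (sqnorm M (\<lambda>x. grad (\<psi> i) x - grad (\<psi> j) x)) < e" if "e > 0" for e
  proof -
    \<comment> \<open>The solution of (q + 1) W = (1 - q) e / 8, which matches the gap
      estimate.\<close>
    define W where "W = (1 - q) * e / (8 * (q + 1))"
    have "W > 0" using q that by (simp add: W_def)
    then obtain N where N: "\<And>n. n \<ge> N \<Longrightarrow> 1 / real (Suc n) < W"
      using order_tendstoD(2)[OF inv] by (auto simp: eventually_sequentially)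
    have J_less: "J (\<psi> n) < m0 + W" if "n \<ge> N" for n
      using \<psi>(2)[of n] N[OF that] by (rule order.strict_trans2[OF _ less_imp_le[OF add_strict_left_mono]])
    have "(sqnorm M (\<lambda>x. grad (\<psi> i) x - grad (\<psi> j) x)) < e" if "i \<ge> N" "j \<ge> N" for i j
    proof -
      let ?E = "sqnorm M (\<lambda>x. grad (\<psi> i) x - grad (\<psi> j) x)"
      have "(1 - q) * ?E / 8 \<le> (q + 1) * ((J (\<psi> i) + J (\<psi> j)) / 2 - m0)"
        by (rule minimising_gap[OF \<psi>(1) \<psi>(1)])
      also have "(J (\<psi> i) + J (\<psi> j)) / 2 - m0 < W"
        using J_less[OF that(1)] J_less[OF that(2)] by (simp add: field_simps)
      then have "(q + 1) * ((J (\<psi> i) + J (\<psi> j)) / 2 - m0) < (q + 1) * W"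
        using q by (intro mult_strict_left_mono) auto
      also have "\<dots> = (1 - q) * e / 8" using q by (simp add: W_def field_simps)
      finally show ?thesis using q by simp
    qed
    then show ?thesis by blast
  qed
  from H10_complete[OF t this] obtain u g
    where u: "L2_tendsto M \<psi> u" and g: "L2_tendsto M (\<lambda>k. grad (\<psi> k)) g" by blast
  have H: "H10_grad u g" using t u g by (auto simp: H10_grad_def)
  obtain r where r: "AE x in M. (\<lambda>k. \<psi> (r k) x) \<longlonglongrightarrow> u x"
    using L2_tendsto_subseq_AE[OF u] by blast
  have nonneg: "AE x in M. 0 \<le> u x"
    using r by eventually_elim (rule LIMSEQ_le_const, use \<psi>(1) in \<open>auto simp: nonneg_tests_def\<close>)
  have "(\<lambda>k. J (\<psi> k)) \<longlonglongrightarrow> 1 / 2 * sqnorm M g - F u"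
    unfolding J_def by (intro tendsto_intros L2_tendsto_norm_power2 F_tendsto u g)
  moreover have "(\<lambda>n. m0 + 1 / real (Suc n)) \<longlonglongrightarrow> m0 + 0" by (intro tendsto_intros inv)
  ultimately have "1 / 2 * sqnorm M g - F u \<le> m0 + 0"
    by (rule LIMSEQ_le) (use \<psi>(2) in \<open>auto intro: less_imp_le\<close>)
  with m0_le_H10[OF H] have "1 / 2 * sqnorm M g - F u = m0" by simp
  with H nonneg show ?thesis by (rule that)
qed

text \<open>Where u > 0 the integrand is bounded below by its tangent; where u = 0 it is exactly |t
  v| powr (q + 1). This zero-set term is kept because it yields positivity, while the linear term
  yields the Euler-Lagrange equation.\<close>

lemma variation_inequality:
  assumes u: "H10_grad u g" "AE x in M. 0 \<le> u x"
    and min: "1 / 2 * sqnorm M g - F u = m0"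
    and v: "H10_grad v h"
  shows "0 \<le> t * ((\<integral>x. g x \<bullet> h x \<partial>M) - (\<integral>x. \<alpha> x * (\<bar>u x\<bar> powr q * v x) \<partial>M))
    + t\<^sup>2 * (1 / 2 * sqnorm M h)
    - \<bar>t\<bar> powr (q + 1) / (q + 1) * (\<integral>x. \<alpha> x * (indicator {x. u x = 0} x * \<bar>v x\<bar> powr (q + 1)) \<partial>M)"
proof -
  let ?Z = "(\<integral>x. \<alpha> x * (indicator {x. u x = 0} x * \<bar>v x\<bar> powr (q + 1)) \<partial>M)"
  let ?U = "(\<integral>x. \<alpha> x * (\<bar>u x\<bar> powr q * v x) \<partial>M)"
  let ?z = "\<lambda>x. \<alpha> x * (indicator {x. u x = 0} x * \<bar>v x\<bar> powr (q + 1))"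
  let ?u = "\<lambda>x. \<alpha> x * (\<bar>u x\<bar> powr q * v x)"
  let ?p = "\<lambda>x. \<alpha> x * \<bar>u x\<bar> powr (q + 1)"
  note si = H10_grad_L2[OF u(1)] H10_grad_L2[OF v]
  note [measurable] = si[THEN square_integrable_measurable]
  have w: "H10_grad (\<lambda>x. u x + t * v x) (\<lambda>x. g x + t *\<^sub>R h x)"
    by (intro H10_grad_add H10_grad_scale u v)
  note wsi = H10_grad_L2(1)[OF w]
  have uqv: "integrable M (\<lambda>x. ?u x)"
    by (intro integrable_\<alpha>_mult square_integrable_mult square_integrable_powr si)
  have ind: "integrable M (\<lambda>x. ?z x)"
  proof (intro integrable_\<alpha>_mult Bochner_Integration.integrable_bound[OF integrable_powr[OF si(3)]])
    show "AE x in M. norm (indicator {x. u x = 0} x * \<bar>v x\<bar> powr (q + 1)) \<le> norm (\<bar>v x\<bar> powr (q + 1))"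
      by (auto simp: indicator_def)
  qed measurable
  note int = integrable_\<alpha>_powr[OF si(1)] integrable_\<alpha>_powr[OF wsi] uqv ind
  have "(\<integral>x. ?p x + (q + 1) * t * (?u x)
      + \<bar>t\<bar> powr (q + 1) * (?z x) \<partial>M)
    \<le> (\<integral>x. \<alpha> x * \<bar>u x + t * v x\<bar> powr (q + 1) \<partial>M)"
  proof (rule integral_mono_AE)
    show "AE x in M. ?p x + (q + 1) * t * (?u x)
      + \<bar>t\<bar> powr (q + 1) * (?z x)
      \<le> \<alpha> x * \<bar>u x + t * v x\<bar> powr (q + 1)"
      using u(2) \<alpha>_pos
    proof eventually_elim
      case (elim x)
      show ?case
      proof (cases "u x = 0")
        case True
        then show ?thesis by (simp add: abs_mult powr_mult)
      next
        case False
        then have ux: "u x > 0" using elim by simp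
        have "\<alpha> x * ((q + 1) * (u x powr q * (t * v x))) \<le> \<alpha> x * (\<bar>u x + t * v x\<bar> powr (q + 1) - u x powr (q + 1))"
          using abs_powr_tangent[OF q(1), of "u x" "u x + t * v x"] ux elim
          by (intro mult_left_mono) auto
        then show ?thesis using ux by (simp add: algebra_simps)
      qed
    qed
  qed (intro Bochner_Integration.integrable_add Bochner_Integration.integrable_mult_right int)+
  also have "(\<integral>x. ?p x + (q + 1) * t * (?u x)
      + \<bar>t\<bar> powr (q + 1) * (?z x) \<partial>M)
    = (\<integral>x. ?p x \<partial>M) + (q + 1) * t * ?U
      + \<bar>t\<bar> powr (q + 1) * ?Z"
    using int by simp
  finally have "1 / (q + 1) * ((\<integral>x. ?p x \<partial>M)
      + (q + 1) * t * ?U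
      + \<bar>t\<bar> powr (q + 1) * ?Z)
    \<le> F (\<lambda>x. u x + t * v x)"
    unfolding F_def using q by (intro mult_left_mono) auto
  then have F: "F u + t * ?U
      + \<bar>t\<bar> powr (q + 1) / (q + 1) * ?Z
    \<le> F (\<lambda>x. u x + t * v x)"
    unfolding F_def[of u] using q by (simp add: distrib_left)
  have "(sqnorm M (\<lambda>x. g x + t *\<^sub>R h x))
      = (\<integral>x. (norm (g x))\<^sup>2 + 2 * t * (g x \<bullet> h x) + t\<^sup>2 * (norm (h x))\<^sup>2 \<partial>M)"
    by (intro Bochner_Integration.integral_cong refl)
      (simp add: power2_norm_eq_inner inner_add_left inner_add_right inner_commute,
        simp add: power2_eq_square)
  also have "\<dots> = sqnorm M g + 2 * t * (\<integral>x. g x \<bullet> h x \<partial>M) + t\<^sup>2 * sqnorm M h"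
    using si by (simp add: square_integrable_norm_power2 square_integrable_inner)
  finally show ?thesis
    using m0_le_H10[OF w] min F unfolding right_diff_distrib by linarith
qed

lemma minimiser_Euler_Lagrange:
  assumes u: "H10_grad u g" "AE x in M. 0 \<le> u x"
    and min: "1 / 2 * sqnorm M g - F u = m0"
    and v: "H10_grad v h"
  shows "(\<integral>x. g x \<bullet> h x \<partial>M) - (\<integral>x. \<alpha> x * (\<bar>u x\<bar> powr q * v x) \<partial>M) = 0"
proof (rule linear_term_eq_0)
  show "0 \<le> t * ((\<integral>x. g x \<bullet> h x \<partial>M) - (\<integral>x. \<alpha> x * (\<bar>u x\<bar> powr q * v x) \<partial>M))
    + t\<^sup>2 * (1 / 2 * sqnorm M h)" for t
  proof -
    have "0 \<le> (\<integral>x. \<alpha> x * (indicator {x. u x = 0} x * \<bar>v x\<bar> powr (q + 1)) \<partial>M)"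
      using \<alpha>_pos by (intro integral_nonneg_AE) (auto simp: indicator_def)
    then have "0 \<le> \<bar>t\<bar> powr (q + 1) / (q + 1) * (\<integral>x. \<alpha> x * (indicator {x. u x = 0} x * \<bar>v x\<bar> powr (q + 1)) \<partial>M)"
      using q by (intro mult_nonneg_nonneg) auto
    then show ?thesis using variation_inequality[OF u min v, of t] by linarith
  qed
qed simp

text \<open>The weak equation with the nonlocal coefficient frozen to a number \<open>k\<close> and
  an explicit gradient \<open>g\<close>.\<close>

definition solves :: "real \<Rightarrow> ('a \<Rightarrow> real) \<Rightarrow> ('a \<Rightarrow> 'a) \<Rightarrow> bool" where
  "solves k u g \<longleftrightarrow> (AE x in M. 0 < u x) \<and> H10_grad u g \<and>
    (\<forall>v h. H10_grad v h \<longrightarrow> k * (\<integral>x. g x \<bullet> h x \<partial>M) = (\<integral>x. \<alpha> x * u x powr q * v x \<partial>M))"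

lemma solvesD:
  assumes "solves k u g"
  shows "AE x in M. 0 < u x" "H10_grad u g"
    and "H10_grad v h \<Longrightarrow> k * (\<integral>x. g x \<bullet> h x \<partial>M) = (\<integral>x. \<alpha> x * u x powr q * v x \<partial>M)"
  using assms by (auto simp: solves_def)

text \<open>On the zero set of a minimiser \<open>u\<close> the perturbation \<open>u + t v\<close> would lower the energy by an
  amount of order \<open>t powr (q + 1)\<close>, which dominates \<open>t\<^sup>2\<close>. Hence the zero set is negligible.\<close>

lemma minimiser_pos:
  assumes u: "H10_grad u g" "AE x in M. 0 \<le> u x"
    and min: "1 / 2 * sqnorm M g - F u = m0"
  shows "AE x in M. 0 < u x"
proof -
  note [measurable] = H10_grad_L2[OF u(1), THEN square_integrable_measurable]
  obtain D where D: "countable D" "D \<subseteq> Pow \<Omega>" "\<And>X. X \<in> D \<Longrightarrow> \<exists>a b. X = cbox a b" "\<Union>D = \<Omega>"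
    using open_countable_Union_open_cbox[OF open_domain] by blast
  note EL = minimiser_Euler_Lagrange[OF u min]
  have "AE x in M. x \<in> X \<longrightarrow> u x \<noteq> 0" if X: "X \<in> D" for X
  proof -
    obtain a b where ab: "X = cbox a b" "cbox a b \<subseteq> \<Omega>" using D(2,3) X by blast
    let ?v = "box_bump a b"
    have tv: "test_function \<Omega> ?v" by (rule test_function_box_bump[OF ab(2)])
    note v = H10_grad_test[OF tv]
    note vsi = test_function_L2(1)[OF tv]
    note [measurable] = square_integrable_measurable[OF vsi]
    let ?Z = "\<lambda>x. \<alpha> x * (indicator {x. u x = 0} x * \<bar>?v x\<bar> powr (q + 1))"
    have nonneg: "AE x in M. 0 \<le> ?Z x" using \<alpha>_pos by eventually_elim (auto simp: indicator_def)
    have int: "integrable M ?Z"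
    proof (intro integrable_\<alpha>_mult Bochner_Integration.integrable_bound[OF integrable_powr[OF vsi]])
      show "AE x in M. norm (indicator {x. u x = 0} x * \<bar>?v x\<bar> powr (q + 1)) \<le> norm (\<bar>?v x\<bar> powr (q + 1))"
        by (auto simp: indicator_def)
    qed measurable
    \<comment> \<open>The Euler-Lagrange equation removes the linear term and leaves t powr (q + 1)
      against t^2 for all t > 0.\<close>
    have "1 / (q + 1) * (\<integral>x. ?Z x \<partial>M) \<le> 0"
    proof (rule sublinear_term_le_0[OF _ q(2)])
      show "t powr (q + 1) * (1 / (q + 1) * (\<integral>x. ?Z x \<partial>M)) \<le> t\<^sup>2 * (1 / 2 * sqnorm M (\<lambda>x. grad ?v x))"
        if "t > 0" for t
        using variation_inequality[OF u min v, of t] EL[OF v] that by simp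
    qed simp
    then have "(\<integral>x. ?Z x \<partial>M) \<le> 0" using q by (simp add: divide_le_0_iff)
    moreover have "0 \<le> (\<integral>x. ?Z x \<partial>M)" by (rule integral_nonneg_AE[OF nonneg])
    ultimately have "AE x in M. ?Z x = 0"
      using integral_nonneg_eq_0_iff_AE[OF int nonneg] by simp
    \<comment> \<open>The bump is positive only in the open box; the faces are discarded as a null
      set.\<close>
    moreover have "AE x in lebesgue. x \<notin> cbox a b - box a b"
      using negligible_frontier_interval by (intro AE_not_in) (simp add: negligible_iff_null_sets)
    then have "AE x in M. x \<notin> cbox a b - box a b"
      using sets_domain by (subst AE_restrict_space_iff) auto
    ultimately show ?thesis
      using \<alpha>_pos
    proof eventually_elim
      case (elim x)
      show ?case
      proof
        assume "x \<in> X"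
        then have "box_bump a b x > 0" using elim(2) ab by (simp add: box_bump_pos_iff)
        then show "u x \<noteq> 0" using elim(1,3) by (auto simp: indicator_def)
      qed
    qed
  qed
  then have "AE x in M. \<forall>X\<in>D. x \<in> X \<longrightarrow> u x \<noteq> 0" 
    using AE_ball_countable[THEN iffD2, OF D(1), of "\<lambda>x X. x \<in> X \<longrightarrow> u x \<noteq> 0" M] by blast
  then show ?thesis
    using u(2) AE_space
  proof eventually_elim
    case (elim x)
    then have "x \<in> \<Union>D" using D(4) by simp
    then show ?case using elim by force
  qed
qed

lemma integral_abs_powr_eq:
  assumes "AE x in M. 0 < u x" "u \<in> borel_measurable M" "v \<in> borel_measurable M"
  shows "(\<integral>x. \<alpha> x * (\<bar>u x\<bar> powr q * v x) \<partial>M) = (\<integral>x. \<alpha> x * u x powr q * v x \<partial>M)"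
proof (rule integral_cong_AE)
  show "AE x in M. \<alpha> x * (\<bar>u x\<bar> powr q * v x) = \<alpha> x * u x powr q * v x"
    using assms(1) by eventually_elim simp
qed (use assms(2,3) in measurable)

lemma solves_1_exists: "\<exists>u g. solves 1 u g"
proof -
  obtain u g where u: "H10_grad u g" "AE x in M. 0 \<le> u x"
    "1 / 2 * sqnorm M g - F u = m0"
    by (rule minimiser_exists) blast
  note pos = minimiser_pos[OF u]
  have "1 * (\<integral>x. g x \<bullet> h x \<partial>M) = (\<integral>x. \<alpha> x * u x powr q * v x \<partial>M)" if v: "H10_grad v h" for v h
  proof -
    note EL = minimiser_Euler_Lagrange[OF u v]
    show ?thesis
      using EL integral_abs_powr_eq[OF pos, of v] H10_grad_L2(1)[OF u(1)]
        H10_grad_L2(1)[OF v] by (simp add: square_integrable_measurable)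
  qed
  with u(1) pos show ?thesis by (auto simp: solves_def)
qed

end

section \<open>Positive solutions are global minimisers\<close>

text \<open>A smooth substitute for t as denominator. Test functions approximating u may be
  negative, so it is bounded below by d^2 on the whole line. The shift by d pays off for t > 0:
  there d^4 \<le> d^2 (t + d)^2, which keeps the slope above 1 / sqrt (1 + d^2).\<close>

definition picone_den :: "real \<Rightarrow> real \<Rightarrow> real" where
  "picone_den d t = sqrt ((t + d)\<^sup>2 + d ^ 4)"

lemma picone_den_pos: "d > 0 \<Longrightarrow> picone_den d t \<ge> d\<^sup>2" "d > 0 \<Longrightarrow> picone_den d t > 0"
proof -
  assume d: "d > 0"
  have "d ^ 4 = (d\<^sup>2)\<^sup>2" by simp
  then have "d\<^sup>2 = sqrt (d ^ 4)" by (simp only: real_sqrt_abs abs_power2)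
  also have "\<dots> \<le> picone_den d t" unfolding picone_den_def by simp
  finally show "picone_den d t \<ge> d\<^sup>2" .
  then show "picone_den d t > 0" using d by (smt (verit) zero_less_power)
qed

lemma picone_den_derivative:
  assumes "d > 0"
  shows "(picone_den d has_real_derivative (t + d) / picone_den d t) (at t)"
proof -
  have "(t + d)\<^sup>2 + d ^ 4 > 0" using assms by (intro add_nonneg_pos) auto
  then show ?thesis
    unfolding picone_den_def by (auto intro!: derivative_eq_intros simp: field_simps)
qed

lemma picone_den_slope_le: "d > 0 \<Longrightarrow> \<bar>(t + d) / picone_den d t\<bar> \<le> 1"
  using picone_den_pos(2)[of d t] real_sqrt_le_mono[of "(t + d)\<^sup>2" "(t + d)\<^sup>2 + d ^ 4"]
  by (simp add: picone_den_def)

lemma picone_den_slope_ge: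
  assumes "d > 0" "t > 0"
  shows "1 / sqrt (1 + d\<^sup>2) \<le> (t + d) / picone_den d t"
proof -
  have "d\<^sup>2 * d\<^sup>2 \<le> (t + d)\<^sup>2 * d\<^sup>2" using assms by (intro mult_right_mono power_mono) auto
  then have "(t + d)\<^sup>2 + d ^ 4 \<le> (t + d)\<^sup>2 * (1 + d\<^sup>2)"
    by (simp add: algebra_simps flip: power_add)
  then have "picone_den d t \<le> (t + d) * sqrt (1 + d\<^sup>2)"
    unfolding picone_den_def using assms
    by (intro real_le_lsqrt) (auto simp: power_mult_distrib)
  moreover have "sqrt (1 + d\<^sup>2) > 0" by (simp add: add_pos_nonneg)
  ultimately show ?thesis using picone_den_pos(2)[OF assms(1), of t] by (simp add: field_simps)
qed

lemma smooth_picone_den: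
  assumes "smooth f" "d > 0"
  shows "smooth (\<lambda>x. picone_den d (f x))"
  unfolding picone_den_def
  by (intro smooth_sqrt smooth_add smooth_power2 smooth_const assms)
    (use assms(2) in \<open>auto intro!: add_nonneg_pos\<close>)

lemma continuous_on_picone_den: "continuous_on A (picone_den d)"
  unfolding picone_den_def by (intro continuous_intros)

section \<open>Picone's inequality and the comparison of energies\<close>

context sublinear_problem
begin

lemma square_integrable_\<alpha>_powr:
  assumes "square_integrable M u" "AE x in M. 0 < u x"
  shows "square_integrable M (\<lambda>x. \<alpha> x * u x powr q)"
proof (rule square_integrable_bound[OF square_integrable_\<alpha>_mult[OF square_integrable_powr[OF assms(1)]]])
  show "(\<lambda>x. \<alpha> x * u x powr q) \<in> borel_measurable M"
    using square_integrable_measurable[OF assms(1)] by measurable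
  show "AE x in M. norm (\<alpha> x * u x powr q) \<le> norm (\<alpha> x * \<bar>u x\<bar> powr q)"
    using assms(2) by eventually_elim simp
qed

text \<open>Testing the equation with \<open>\<phi>\<^sup>2 / u\<close>, where the quotient is regularised so that the test
  functions approximating \<open>u\<close> are mapped to test functions.\<close>

lemma picone_regularised:
  assumes k: "k > 0" and sol: "solves k u g" and t: "test_function \<Omega> \<phi>" and d: "d > 0"
  shows "integrable M (\<lambda>x. \<alpha> x * u x powr q * ((\<phi> x)\<^sup>2 / picone_den d (u x)))"
    and "(\<integral>x. \<alpha> x * u x powr q * ((\<phi> x)\<^sup>2 / picone_den d (u x)) \<partial>M)
      \<le> k * (sqrt (1 + d\<^sup>2) * sqnorm M (grad \<phi>))"
proof -
  note u = solvesD(1,2)[OF sol] and EL = solvesD(3)[OF sol]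
  let ?H = "picone_den d"
  note sm = test_function_smooth[OF t]
  note si = H10_grad_L2[OF u(2)]
  note tsi = test_function_L2[OF t]
  note [measurable] = si[THEN square_integrable_measurable] tsi[THEN square_integrable_measurable]
  obtain B where B: "\<And>x. \<bar>\<phi> x\<bar> \<le> B" "B > 0" by (rule test_function_bounded[OF t]) blast
  obtain \<eta>' where \<eta>': "\<And>j. test_function \<Omega> (\<eta>' j)" "L2_tendsto M \<eta>' u" "L2_tendsto M (\<lambda>j. grad (\<eta>' j)) g"
    by (rule H10_gradE[OF u(2)]) blast
  obtain r where r: "strict_mono r" "AE x in M. (\<lambda>j. \<eta>' (r j) x) \<longlonglongrightarrow> u x"
    by (rule L2_tendsto_subseq_AE[OF \<eta>'(2)])
  define \<eta> where "\<eta> j = \<eta>' (r j)" for j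
  have \<eta>: "test_function \<Omega> (\<eta> j)" "L2_tendsto M (\<lambda>j. grad (\<eta> j)) g"
    "AE x in M. (\<lambda>j. \<eta> j x) \<longlonglongrightarrow> u x" for j
    using \<eta>'(1) L2_tendsto_subseq[OF \<eta>'(3) r(1)] r(2) by (auto simp: \<eta>_def)
  note \<eta>sm = \<eta>(1)[THEN test_function_smooth]
  have [measurable]: "\<eta> j \<in> borel_measurable M" for j
    by (rule test_function_measurable[OF \<eta>sm])
  have [measurable]: "?H \<in> borel_measurable borel"
    by (intro borel_measurable_continuous_onI continuous_on_picone_den)
  have H: "?H y \<ge> d\<^sup>2" "?H y > 0" for y using picone_den_pos[OF d] by auto
  have H_tendsto: "(\<lambda>j. ?H (y j)) \<longlonglongrightarrow> ?H l" if "y \<longlonglongrightarrow> l" for y l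
    using continuous_on_picone_den[of UNIV d] that by (auto simp: continuous_on_eq_continuous_at isCont_tendsto_compose)
  define v where "v j x = \<phi> x * (inverse (?H (\<eta> j x)) * \<phi> x)" for j x
  have H_smooth: "smooth (\<lambda>x. inverse (?H (\<eta> j x)))" for j
    by (intro smooth_inverse smooth_picone_den \<eta>sm d H)
  have tv: "test_function \<Omega> (v j)" for j
    unfolding v_def by (intro test_function_mult_left t sm H_smooth)
  \<comment> \<open>The test function is \<open>c\<close> evaluated along the approximants, and its
    gradient is \<open>a\<close> times grad \<open>\<phi>\<close> minus \<open>b\<close> times the
    gradient of the approximant. All three coefficients are bounded in terms of d and the bound B of
    \<open>\<phi>\<close>.\<close>
  define a where "a f x = 2 * \<phi> x / ?H (f x)" for f :: "'a \<Rightarrow> real" and x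
  define b where "b f x = (\<phi> x)\<^sup>2 * ((f x + d) / ?H (f x)) / (?H (f x))\<^sup>2" for f :: "'a \<Rightarrow> real" and x
  define c where "c f x = (\<phi> x)\<^sup>2 / ?H (f x)" for f :: "'a \<Rightarrow> real" and x
  have grad_v: "grad (v j) x = a (\<eta> j) x *\<^sub>R grad \<phi> x - b (\<eta> j) x *\<^sub>R grad (\<eta> j) x" for j x
  proof -
    have "((\<lambda>y. inverse (?H y)) has_real_derivative
        - (((\<eta> j x + d) / ?H (\<eta> j x)) / (?H (\<eta> j x))\<^sup>2)) (at (\<eta> j x))"
      using H(2)[of "\<eta> j x"]
      by (auto intro!: derivative_eq_intros picone_den_derivative[OF d] simp: divide_simps power2_eq_square)
    from grad_compose[OF \<eta>sm this]
    have 1: "grad (\<lambda>x. inverse (?H (\<eta> j x))) x = - (((\<eta> j x + d) / ?H (\<eta> j x)) / (?H (\<eta> j x))\<^sup>2) *\<^sub>R grad (\<eta> j) x" .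
    show ?thesis
      unfolding v_def a_def b_def
      by (simp add: grad_mult sm H_smooth smooth_mult 1 scaleR_add_right power2_eq_square divide_inverse
          algebra_simps flip: scaleR_add_left)
  qed
  have v_eq: "v j = c (\<eta> j)" for j
    by (simp add: fun_eq_iff v_def c_def power2_eq_square divide_inverse mult_ac)
  have a_le: "\<bar>a f x\<bar> \<le> 2 * B / d\<^sup>2" for f x
    unfolding a_def abs_divide
    using B(1)[of x] H[of "f x"] d by (intro frac_le) (auto simp: abs_mult)
  have \<phi>2: "(\<phi> x)\<^sup>2 \<le> B\<^sup>2" for x using power_mono[OF B(1)[of x], of 2] by simp
  have c_le: "\<bar>c f x\<bar> \<le> B\<^sup>2 / d\<^sup>2" for f x
    unfolding c_def abs_divide using \<phi>2[of x] H[of "f x"] d by (intro frac_le) auto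
  have b_le: "\<bar>b f x\<bar> \<le> B\<^sup>2 * 1 / (d\<^sup>2)\<^sup>2" for f x
    unfolding b_def abs_divide[of "(\<phi> x)\<^sup>2 * _"] abs_mult
  proof (rule frac_le)
    show "\<bar>(\<phi> x)\<^sup>2\<bar> * \<bar>(f x + d) / ?H (f x)\<bar> \<le> B\<^sup>2 * 1"
      using \<phi>2[of x] by (intro mult_mono picone_den_slope_le d) auto
    show "(d\<^sup>2)\<^sup>2 \<le> \<bar>(?H (f x))\<^sup>2\<bar>"
      unfolding abs_power2 using H[of "f x"] by (intro power_mono) auto
  qed (use d in auto)
  have [measurable]: "a f \<in> borel_measurable M" "b f \<in> borel_measurable M" "c f \<in> borel_measurable M"
    if [measurable]: "f \<in> borel_measurable M" for f
    unfolding a_def[abs_def] b_def[abs_def] c_def[abs_def] by measurable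
  have H_ne: "?H y \<noteq> 0" "(?H y)\<^sup>2 \<noteq> 0" for y using H(2)[of y] by auto
  have "(\<lambda>j. a (\<eta> j) x) \<longlonglongrightarrow> a u x \<and> (\<lambda>j. b (\<eta> j) x) \<longlonglongrightarrow> b u x \<and> (\<lambda>j. c (\<eta> j) x) \<longlonglongrightarrow> c u x"
    if "(\<lambda>j. \<eta> j x) \<longlonglongrightarrow> u x" for x
    unfolding a_def b_def c_def by (intro conjI tendsto_intros H_tendsto that H_ne)
  then have conv: "AE x in M. (\<lambda>j. a (\<eta> j) x) \<longlonglongrightarrow> a u x" "AE x in M. (\<lambda>j. b (\<eta> j) x) \<longlonglongrightarrow> b u x"
    "AE x in M. (\<lambda>j. c (\<eta> j) x) \<longlonglongrightarrow> c u x"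
    using \<eta>(3) by (blast intro: eventually_mono)+
  note \<alpha>u = square_integrable_\<alpha>_powr[OF si(1) u(1)]
  have one: "square_integrable M (\<lambda>x. 1::real)" by (rule square_integrable_const)
  have "L2_tendsto M (\<lambda>j x. c (\<eta> j) x *\<^sub>R (\<alpha> x * u x powr q)) (\<lambda>x. c u x *\<^sub>R (\<alpha> x * u x powr q))"
    by (rule L2_tendsto_dominated[OF \<alpha>u _ _ c_le conv(3)]) measurable
  then have L: "L2_tendsto M (\<lambda>j x. c (\<eta> j) x * (\<alpha> x * u x powr q)) (\<lambda>x. c u x * (\<alpha> x * u x powr q))"
    by simp
  from L2_tendsto_inner[OF L L2_tendsto_const[OF one]]
  have lim1: "(\<lambda>j. \<integral>x. \<alpha> x * u x powr q * c (\<eta> j) x \<partial>M) \<longlonglongrightarrow> (\<integral>x. \<alpha> x * u x powr q * c u x \<partial>M)"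
    by (simp add: mult.commute)
  \<comment> \<open>The coefficients are attached to the fixed \<open>g\<close>, where dominated
    convergence gives strong limits; the varying gradients then stand on the other side of the inner
    product.\<close>
  have La: "L2_tendsto M (\<lambda>j x. a (\<eta> j) x *\<^sub>R g x) (\<lambda>x. a u x *\<^sub>R g x)"
    by (rule L2_tendsto_dominated[OF si(2) _ _ a_le conv(1)]) measurable
  have Lb: "L2_tendsto M (\<lambda>j x. b (\<eta> j) x *\<^sub>R g x) (\<lambda>x. b u x *\<^sub>R g x)"
    by (rule L2_tendsto_dominated[OF si(2) _ _ b_le conv(2)]) measurable
  have lsi: "square_integrable M (\<lambda>x. a (\<eta> j) x *\<^sub>R g x)" "square_integrable M (\<lambda>x. b (\<eta> j) x *\<^sub>R g x)"
    "square_integrable M (\<lambda>x. a u x *\<^sub>R g x)" "square_integrable M (\<lambda>x. b u x *\<^sub>R g x)" for j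
    using La Lb by (auto simp: L2_tendsto_def)
  let ?R = "(\<integral>x. (a u x *\<^sub>R g x) \<bullet> grad \<phi> x \<partial>M) - (\<integral>x. (b u x *\<^sub>R g x) \<bullet> g x \<partial>M)"
  let ?S = "\<lambda>j. (\<integral>x. (a (\<eta> j) x *\<^sub>R g x) \<bullet> grad \<phi> x \<partial>M) - (\<integral>x. (b (\<eta> j) x *\<^sub>R g x) \<bullet> grad (\<eta> j) x \<partial>M)"
  have "(\<lambda>j. k * (?S j))
      \<longlonglongrightarrow> k * (?R)"
    by (intro tendsto_intros L2_tendsto_inner La Lb L2_tendsto_const tsi \<eta>)
  moreover have "k * (?S j)
      = (\<integral>x. \<alpha> x * u x powr q * c (\<eta> j) x \<partial>M)" for j
  proof -
    have "?S j
        = (\<integral>x. (a (\<eta> j) x *\<^sub>R g x) \<bullet> grad \<phi> x - (b (\<eta> j) x *\<^sub>R g x) \<bullet> grad (\<eta> j) x \<partial>M)"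
      by (intro Bochner_Integration.integral_diff[symmetric] square_integrable_inner lsi tsi
          test_function_L2 \<eta>)
    also have "\<dots> = (\<integral>x. g x \<bullet> grad (v j) x \<partial>M)"
      by (simp add: grad_v inner_diff_right)
    finally show ?thesis
      using EL[OF H10_grad_test[OF tv[of j]]] by (simp only: v_eq)
  qed
  ultimately have "(\<lambda>j. \<integral>x. \<alpha> x * u x powr q * c (\<eta> j) x \<partial>M)
      \<longlonglongrightarrow> k * (?R)"
    by simp
  with lim1 have eq: "(\<integral>x. \<alpha> x * u x powr q * c u x \<partial>M)
      = k * (?R)"
    by (rule LIMSEQ_unique)
  have "integrable M (\<lambda>x. c u x * (\<alpha> x * u x powr q))"
    using L by (auto simp: L2_tendsto_def intro: square_integrable_imp_integrable)
  then show "integrable M (\<lambda>x. \<alpha> x * u x powr q * ((\<phi> x)\<^sup>2 / ?H (u x)))"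
    by (simp add: c_def mult.commute)
  define \<kappa> where "\<kappa> = sqrt (1 + d\<^sup>2)"
  have \<kappa>: "\<kappa> > 0" by (simp add: \<kappa>_def add_pos_nonneg)
  have "?R
      = (\<integral>x. (a u x *\<^sub>R g x) \<bullet> grad \<phi> x - (b u x *\<^sub>R g x) \<bullet> g x \<partial>M)"
    by (intro Bochner_Integration.integral_diff[symmetric] square_integrable_inner lsi tsi si)
  also have "\<dots> \<le> (\<integral>x. \<kappa> * (norm (grad \<phi> x))\<^sup>2 \<partial>M)"
  proof (rule integral_mono_AE)
    show "integrable M (\<lambda>x. (a u x *\<^sub>R g x) \<bullet> grad \<phi> x - (b u x *\<^sub>R g x) \<bullet> g x)"
      by (intro Bochner_Integration.integrable_diff square_integrable_inner lsi tsi si)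
    show "integrable M (\<lambda>x. \<kappa> * (norm (grad \<phi> x))\<^sup>2)"
      using square_integrable_norm_power2[OF tsi(2)] by simp
    show "AE x in M. (a u x *\<^sub>R g x) \<bullet> grad \<phi> x - (b u x *\<^sub>R g x) \<bullet> g x \<le> \<kappa> * (norm (grad \<phi> x))\<^sup>2"
      using u(1)
    proof eventually_elim
      case (elim x)
      \<comment> \<open>Completing the square with weight \<open>\<kappa>\<close> leaves |z|^2 /
        \<open>\<kappa>\<close>, which the slope bound from below absorbs.\<close>
      define z where "z = (\<phi> x / ?H (u x)) *\<^sub>R g x"
      have "0 \<le> (norm (z - \<kappa> *\<^sub>R grad \<phi> x))\<^sup>2" by simp
      also have "\<dots> = (norm z)\<^sup>2 - 2 * \<kappa> * (z \<bullet> grad \<phi> x) + \<kappa>\<^sup>2 * (norm (grad \<phi> x))\<^sup>2"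
        unfolding power2_norm_eq_inner
        by (simp add: inner_diff_left inner_diff_right inner_commute power2_eq_square)
      finally have "2 * \<kappa> * (z \<bullet> grad \<phi> x) \<le> (norm z)\<^sup>2 + \<kappa>\<^sup>2 * (norm (grad \<phi> x))\<^sup>2" by simp
      then have "1 / \<kappa> * (2 * \<kappa> * (z \<bullet> grad \<phi> x)) \<le> 1 / \<kappa> * ((norm z)\<^sup>2 + \<kappa>\<^sup>2 * (norm (grad \<phi> x))\<^sup>2)"
        using \<kappa> by (intro mult_left_mono) auto
      then have 1: "2 * (z \<bullet> grad \<phi> x) \<le> 1 / \<kappa> * (norm z)\<^sup>2 + \<kappa> * (norm (grad \<phi> x))\<^sup>2"
        using \<kappa> by (simp add: distrib_left power2_eq_square)
      have 2: "1 / \<kappa> * (norm z)\<^sup>2 \<le> (u x + d) / ?H (u x) * (norm z)\<^sup>2"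
        unfolding \<kappa>_def by (intro mult_right_mono picone_den_slope_ge d elim) simp
      have 3: "(a u x *\<^sub>R g x) \<bullet> grad \<phi> x = 2 * (z \<bullet> grad \<phi> x)"
        by (simp add: a_def z_def)
      have 4: "(b u x *\<^sub>R g x) \<bullet> g x = (u x + d) / ?H (u x) * (norm z)\<^sup>2"
        unfolding power2_norm_eq_inner by (simp add: b_def z_def power2_eq_square)
      show ?case using 1 2 unfolding 3 4 by linarith
    qed
  qed
  also have "\<dots> = \<kappa> * sqnorm M (grad \<phi>)" by simp
  finally have "k * (?R)
      \<le> k * (\<kappa> * sqnorm M (grad \<phi>))"
    using k by (intro mult_left_mono) auto
  then show "(\<integral>x. \<alpha> x * u x powr q * ((\<phi> x)\<^sup>2 / ?H (u x)) \<partial>M)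
      \<le> k * (sqrt (1 + d\<^sup>2) * sqnorm M (grad \<phi>))"
    using eq by (simp add: c_def \<kappa>_def)
qed

text \<open>The parameter d tends to 0 and the test functions tend to \<open>v\<close> along one
  index. Since u powr (q - 1) may be unbounded where u is small, Fatou's lemma provides both
  integrability and the bound.\<close>

lemma picone:
  assumes k: "k > 0" and sol: "solves k u g" and v: "H10_grad v h"
  shows "integrable M (\<lambda>x. \<alpha> x * (u x powr (q - 1) * (v x)\<^sup>2))"
    and "(\<integral>x. \<alpha> x * (u x powr (q - 1) * (v x)\<^sup>2) \<partial>M) \<le> k * sqnorm M h"
proof -
  let ?f = "\<lambda>x. \<alpha> x * u x powr q * ((v x)\<^sup>2 / u x)"
  let ?g = "\<lambda>x. \<alpha> x * (u x powr (q - 1) * (v x)\<^sup>2)"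
  have u: "AE x in M. 0 < u x" "H10_grad u g" using sol by (auto simp: solves_def)
  note [measurable] = H10_grad_L2[OF u(2), THEN square_integrable_measurable]
    H10_grad_L2[OF v, THEN square_integrable_measurable]
  obtain \<phi>' where \<phi>': "\<And>j. test_function \<Omega> (\<phi>' j)" "L2_tendsto M \<phi>' v" "L2_tendsto M (\<lambda>j. grad (\<phi>' j)) h"
    by (rule H10_gradE[OF v]) blast
  obtain r where r: "strict_mono r" "AE x in M. (\<lambda>j. \<phi>' (r j) x) \<longlonglongrightarrow> v x"
    by (rule L2_tendsto_subseq_AE[OF \<phi>'(2)])
  define \<phi> where "\<phi> j = \<phi>' (r j)" for j
  have \<phi>: "test_function \<Omega> (\<phi> j)" "L2_tendsto M (\<lambda>j. grad (\<phi> j)) h"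
    "AE x in M. (\<lambda>j. \<phi> j x) \<longlonglongrightarrow> v x" for j
    using \<phi>'(1) L2_tendsto_subseq[OF \<phi>'(3) r(1)] r(2) by (auto simp: \<phi>_def)
  define d where "d n = 1 / real (Suc n)" for n
  have d: "d n > 0" for n by (simp add: d_def)
  have d_lim: "d \<longlonglongrightarrow> 0"
    using LIMSEQ_Suc[OF lim_1_over_n] by (auto simp: d_def[abs_def])
  define f where "f j x = \<alpha> x * u x powr q * ((\<phi> j x)\<^sup>2 / picone_den (d j) (u x))" for j x
  note P = picone_regularised[OF k sol \<phi>(1) d]
  have f_int: "integrable M (f j)" for j unfolding f_def[abs_def] by (rule P(1))
  have f_nonneg: "AE x in M. 0 \<le> f j x" for j
    using \<alpha>_pos by eventually_elim
      (simp add: f_def picone_den_pos(2)[OF d, THEN less_imp_le])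
  have f_le: "integral\<^sup>L M (f j) \<le> k * (sqrt (1 + (d j)\<^sup>2) * sqnorm M (grad (\<phi> j)))" for j
    unfolding f_def[abs_def] by (rule P(2))
  have bound_lim: "(\<lambda>j. k * (sqrt (1 + (d j)\<^sup>2) * sqnorm M (grad (\<phi> j))))
      \<longlonglongrightarrow> k * (sqrt (1 + 0\<^sup>2) * sqnorm M h)"
    by (intro tendsto_intros d_lim L2_tendsto_norm_power2 \<phi>)
  have f_lim: "AE x in M. (\<lambda>j. f j x) \<longlonglongrightarrow> ?f x"
    using \<phi>(3) u(1)
  proof eventually_elim
    case (elim x)
    have "(\<lambda>j. picone_den (d j) (u x)) \<longlonglongrightarrow> sqrt ((u x + 0)\<^sup>2 + 0 ^ 4)"
      unfolding picone_den_def by (intro tendsto_intros d_lim)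
    then have "(\<lambda>j. picone_den (d j) (u x)) \<longlonglongrightarrow> u x" using elim by simp
    then show ?case unfolding f_def using elim by (intro tendsto_intros) auto
  qed
  have "(\<lambda>x. ?f x) \<in> borel_measurable M" by measurable
  note fatou = integral_fatou[OF f_int this f_nonneg f_lim f_le bound_lim]
  have *: "integrable M (\<lambda>x. ?f x)"
    "(\<integral>x. ?f x \<partial>M) \<le> k * sqnorm M h"
    using fatou(1,3) by simp_all
  have eq: "AE x in M. ?f x = ?g x"
    using u(1) by eventually_elim (simp add: powr_diff)
  show "integrable M (\<lambda>x. ?g x)"
    using *(1) by (rule integrable_cong_AE_imp) (measurable, use eq in eventually_elim, simp)
  have "(\<integral>x. ?g x \<partial>M) = (\<integral>x. ?f x \<partial>M)"
    by (rule integral_cong_AE) (measurable, use eq in eventually_elim, simp)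
  with *(2) show "(\<integral>x. ?g x \<partial>M) \<le> k * sqnorm M h" by simp
qed

text \<open>The equation tested with its own solution.\<close>

lemma solves_energy:
  assumes "solves k u g"
  shows "k * sqnorm M g = (\<integral>x. \<alpha> x * \<bar>u x\<bar> powr (q + 1) \<partial>M)"
proof -
  note u = solvesD(1,2)[OF assms(1)] and EL = solvesD(3)[OF assms(1)]
  note [measurable] = H10_grad_L2[OF u(2), THEN square_integrable_measurable]
  have "k * sqnorm M g = (\<integral>x. \<alpha> x * u x powr q * u x \<partial>M)"
    using EL[OF u(2)] by (simp add: power2_norm_eq_inner)
  also have "\<dots> = (\<integral>x. \<alpha> x * \<bar>u x\<bar> powr (q + 1) \<partial>M)"
    by (rule integral_cong_AE) (measurable, use u(1) in eventually_elim, simp add: powr_add)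
  finally show ?thesis .
qed

lemma energy_functional_H10_grad:
  assumes "H10_grad v h"
  shows "energy_functional \<Omega> k q \<alpha> v = 1 / 2 * k * sqnorm M h
    - 1 / (q + 1) * (\<integral>x. \<alpha> x * \<bar>max 0 (v x)\<bar> powr (q + 1) \<partial>M)"
  by (simp add: energy_functional_def dirichlet_energy_H10_grad[OF assms])

text \<open>Picone's inequality replaces the Dirichlet energy of \<open>v\<close> by an integral
  without gradients, and \<open>solves_energy\<close> does the same for \<open>u\<close>. The
  difference of the energies then dominates the integral of \<alpha> times the expression in
  \<open>minimality_integrand\<close>; if that integral is 0, the equality case applies almost
  everywhere.\<close>

lemma solves_minimises:
  assumes k: "k > 0" and sol: "solves k u g" and v: "v \<in> H10 \<Omega>"
  shows "energy_functional \<Omega> k q \<alpha> u \<le> energy_functional \<Omega> k q \<alpha> v"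
    and "energy_functional \<Omega> k q \<alpha> v \<le> energy_functional \<Omega> k q \<alpha> u \<Longrightarrow> ae_eq \<Omega> v u"
proof -
  have pos: "AE x in M. 0 < u x" and g: "H10_grad u g" using sol by (auto simp: solves_def)
  obtain h where h: "H10_grad v h" using v by (auto simp: H10_iff)
  note si = H10_grad_L2[OF g] H10_grad_L2[OF h]
  note [measurable] = si[THEN square_integrable_measurable]
  note P = picone[OF k sol h]
  have max_si: "square_integrable M (\<lambda>x. max 0 (v x))"
    by (rule square_integrable_bound[OF si(3)]) auto
  define U where "U = (\<integral>x. \<alpha> x * \<bar>u x\<bar> powr (q + 1) \<partial>M)"
  define V where "V = (\<integral>x. \<alpha> x * \<bar>max 0 (v x)\<bar> powr (q + 1) \<partial>M)"
  define W where "W = (\<integral>x. \<alpha> x * (u x powr (q - 1) * (v x)\<^sup>2) \<partial>M)"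
  note int = integrable_\<alpha>_powr[OF si(1)] integrable_\<alpha>_powr[OF max_si] P(1)
  have kg: "k * sqnorm M g = U" unfolding U_def by (rule solves_energy[OF sol])
  have "(\<integral>x. \<alpha> x * \<bar>max 0 (u x)\<bar> powr (q + 1) \<partial>M) = U"
    unfolding U_def by (rule integral_cong_AE) (measurable, use pos in eventually_elim, simp)
  with kg have Ju: "energy_functional \<Omega> k q \<alpha> u = 1 / 2 * U - 1 / (q + 1) * U"
    by (simp add: energy_functional_H10_grad[OF g])
  have Jv: "energy_functional \<Omega> k q \<alpha> v \<ge> 1 / 2 * W - 1 / (q + 1) * V"
    using P(2) by (simp add: energy_functional_H10_grad[OF h] V_def W_def)
  define f where "f x = u x powr (q - 1) * (v x)\<^sup>2 / 2 - \<bar>max 0 (v x)\<bar> powr (q + 1) / (q + 1)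
      - (1 / 2 - 1 / (q + 1)) * \<bar>u x\<bar> powr (q + 1)" for x
  have f_eq: "\<alpha> x * f x = 1 / 2 * (\<alpha> x * (u x powr (q - 1) * (v x)\<^sup>2))
      - 1 / (q + 1) * (\<alpha> x * \<bar>max 0 (v x)\<bar> powr (q + 1))
      - (1 / 2 - 1 / (q + 1)) * (\<alpha> x * \<bar>u x\<bar> powr (q + 1))" for x
    by (simp add: f_def right_diff_distrib)
  have f_int: "integrable M (\<lambda>x. \<alpha> x * f x)" unfolding f_eq
    by (intro Bochner_Integration.integrable_diff Bochner_Integration.integrable_mult_right int)
  have "(\<integral>x. \<alpha> x * f x \<partial>M) = 1 / 2 * W - 1 / (q + 1) * V - (1 / 2 - 1 / (q + 1)) * U"
    unfolding f_eq W_def V_def U_def using int by simp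
  with Ju Jv have diff: "(\<integral>x. \<alpha> x * f x \<partial>M) \<le> energy_functional \<Omega> k q \<alpha> v - energy_functional \<Omega> k q \<alpha> u"
    by (simp add: left_diff_distrib)
  have nonneg: "AE x in M. 0 \<le> \<alpha> x * f x"
    using pos \<alpha>_pos by eventually_elim (use minimality_integrand(1)[OF q] in \<open>simp add: f_def\<close>)
  have f0: "0 \<le> (\<integral>x. \<alpha> x * f x \<partial>M)" by (rule integral_nonneg_AE[OF nonneg])
  with diff show "energy_functional \<Omega> k q \<alpha> u \<le> energy_functional \<Omega> k q \<alpha> v" by linarith
  assume "energy_functional \<Omega> k q \<alpha> v \<le> energy_functional \<Omega> k q \<alpha> u"
  with diff f0 have "(\<integral>x. \<alpha> x * f x \<partial>M) = 0" by linarith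
  then have "AE x in M. \<alpha> x * f x = 0"
    using integral_nonneg_eq_0_iff_AE[OF f_int nonneg] by simp
  then have "AE x in M. v x = u x"
    using pos \<alpha>_pos
  proof eventually_elim
    case (elim x)
    then have "f x = 0" by simp
    then show ?case using minimality_integrand(2)[OF q elim(2), of "v x"] elim(2) by (simp add: f_def)
  qed
  then show "ae_eq \<Omega> v u" by (simp add: ae_eq_def)
qed

lemma solves_in_H10: "solves k u g \<Longrightarrow> u \<in> H10 \<Omega>"
  by (auto simp: solves_def H10_iff)

lemma solves_unique:
  assumes "k > 0" "solves k u g" "solves k w h"
  shows "ae_eq \<Omega> w u"
  using solves_minimises(2)[OF assms(1,2)] solves_minimises(1)[OF assms(1,3)]
    assms(2,3)[THEN solves_in_H10] by blast

end

section \<open>The Kirchhoff problem\<close>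

context bounded_open_set
begin

text \<open>Excludes the degenerate null measure, under which a positive function could also be zero
  almost everywhere.\<close>

lemma not_AE_False:
  assumes "\<Omega> \<noteq> {}"
  shows "\<not> (AE x in M. False)"
proof
  assume "AE x in M. False"
  then have "AE x in lebesgue. x \<notin> \<Omega>"
    using sets_domain by (simp add: AE_restrict_space_iff)
  then have "negligible \<Omega>"
    using sets_domain by (simp add: negligible_iff_null_sets AE_iff_null_sets)
  then show False using open_not_negligible[OF open_domain assms] by simp
qed

lemma integral_power2_pos:
  assumes "square_integrable M u" "\<not> ae_eq \<Omega> u (\<lambda>x. 0)"
  shows "0 < (\<integral>x. (u x)\<^sup>2 \<partial>M)"
proof -
  have "(\<integral>x. (u x)\<^sup>2 \<partial>M) \<noteq> 0"
    using assms integral_nonneg_eq_0_iff_AE[OF square_integrable_power2[OF assms(1)]]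
    by (simp add: ae_eq_def)
  moreover have "0 \<le> (\<integral>x. (u x)\<^sup>2 \<partial>M)" by simp
  ultimately show ?thesis by linarith
qed

text \<open>Poincare's inequality bounds all quotients below by 1 / P. The nonzero \<open>u\<close>
  makes the set nonempty, without which a real infimum has no meaningful value.\<close>

lemma lambda1_bounds:
  assumes "H10_grad u g" "\<not> ae_eq \<Omega> u (\<lambda>x. 0)"
  shows "lambda1 \<Omega> > 0" "lambda1 \<Omega> * (\<integral>x. (u x)\<^sup>2 \<partial>M) \<le> sqnorm M g"
proof -
  let ?S = "{u \<in> H10 \<Omega>. \<not> ae_eq \<Omega> u (\<lambda>x. 0)}"
  let ?Q = "\<lambda>u. dirichlet_energy \<Omega> u / (\<integral>x. \<bar>u x\<bar>\<^sup>2 \<partial>M)"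
  obtain P where P: "P > 0" "\<And>u g. H10_grad u g \<Longrightarrow>
    (\<integral>x. (u x)\<^sup>2 \<partial>M) \<le> P * sqnorm M g" by (rule poincare) blast
  have Q_ge: "1 / P \<le> ?Q w" if w: "w \<in> ?S" for w
  proof -
    obtain h where h: "H10_grad w h" using w by (auto simp: H10_iff)
    have "0 < (\<integral>x. (w x)\<^sup>2 \<partial>M)"
      using w H10_grad_L2(1)[OF h] by (intro integral_power2_pos) auto
    then show ?thesis
      using P(2)[OF h] P(1) by (simp add: dirichlet_energy_H10_grad[OF h] field_simps)
  qed
  have uS: "u \<in> ?S" using assms by (auto simp: H10_iff)
  then have "1 / P \<le> lambda1 \<Omega>"
    unfolding lambda1_def by (intro cINF_greatest Q_ge) auto
  then show "lambda1 \<Omega> > 0" using P(1) by (simp add: less_le_trans[of 0 "1 / P"])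
  have "lambda1 \<Omega> \<le> ?Q u"
    unfolding lambda1_def using Q_ge by (intro cINF_lower uS bdd_belowI2[of _ "1 / P"]) auto
  moreover have "0 < (\<integral>x. (u x)\<^sup>2 \<partial>M)"
    using assms H10_grad_L2(1)[OF assms(1)] by (intro integral_power2_pos) auto
  ultimately show "lambda1 \<Omega> * (\<integral>x. (u x)\<^sup>2 \<partial>M) \<le> sqnorm M g"
    by (simp add: dirichlet_energy_H10_grad[OF assms(1)] field_simps)
qed

end

context sublinear_problem
begin

text \<open>The left side is homogeneous of degree 1 and the right side of degree q, hence the
  factor c powr (q - 1).\<close>

lemma solves_scale:
  assumes "solves k u g" "c > 0"
  shows "solves (k * c powr (q - 1)) (\<lambda>x. c * u x) (\<lambda>x. c *\<^sub>R g x)"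
proof -
  note u = solvesD(1,2)[OF assms(1)] and EL = solvesD(3)[OF assms(1)]
  have "k * c powr (q - 1) * (\<integral>x. (c *\<^sub>R g x) \<bullet> h x \<partial>M) = (\<integral>x. \<alpha> x * (c * u x) powr q * v x \<partial>M)"
    if v: "H10_grad v h" for v h
  proof -
    note [measurable] = H10_grad_L2[OF u(2), THEN square_integrable_measurable]
      H10_grad_L2[OF v, THEN square_integrable_measurable]
    have "(\<integral>x. \<alpha> x * (c * u x) powr q * v x \<partial>M) = (\<integral>x. c powr q * (\<alpha> x * u x powr q * v x) \<partial>M)"
      by (intro Bochner_Integration.integral_cong refl) (use assms(2) in \<open>simp add: powr_mult\<close>)
    also have "\<dots> = c powr q * (k * (\<integral>x. g x \<bullet> h x \<partial>M))" using EL[OF v] by simp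
    also have "c powr q = c powr (q - 1) * c" using assms(2) by (simp add: powr_diff)
    finally show ?thesis by simp
  qed
  moreover have "AE x in M. 0 < c * u x" using u(1) by eventually_elim (use assms(2) in simp)
  ultimately show ?thesis
    using H10_grad_scale[OF u(2), of c] by (simp add: solves_def)
qed

text \<open>By \<open>solves_energy\<close> the energy is an integral of the solution alone, so
  almost everywhere equality of the solutions is enough.\<close>

lemma solves_energy_unique:
  assumes "k > 0" "solves k u g" "solves k w h"
  shows "sqnorm M g = sqnorm M h"
proof -
  have u: "H10_grad u g" "H10_grad w h" using assms by (auto simp: solves_def)
  note [measurable] = u[THEN H10_grad_L2(1), THEN square_integrable_measurable]
  have ae: "AE x in M. w x = u x" using solves_unique[OF assms] by (simp add: ae_eq_def)
  have "(\<integral>x. \<alpha> x * \<bar>w x\<bar> powr (q + 1) \<partial>M) = (\<integral>x. \<alpha> x * \<bar>u x\<bar> powr (q + 1) \<partial>M)"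
    by (rule integral_cong_AE) (measurable, use ae in eventually_elim, simp)
  then have "k * sqnorm M g = k * sqnorm M h"
    using solves_energy[OF assms(2)] solves_energy[OF assms(3)] by simp
  then show ?thesis using assms(1) by simp
qed

lemma weak_solution_iff:
  "weak_solution \<Omega> K I q \<alpha> u \<longleftrightarrow>
    (\<exists>g. solves (K (dirichlet_energy \<Omega> u)) u g) \<and> dirichlet_energy \<Omega> u \<in> I"
proof
  assume w: "weak_solution \<Omega> K I q \<alpha> u"
  then obtain g where g: "H10_grad u g" by (auto simp: weak_solution_def H10_iff)
  have "solves (K (dirichlet_energy \<Omega> u)) u g"
    unfolding solves_def
  proof (intro conjI allI impI g)
    show "AE x in M. 0 < u x" using w by (simp add: weak_solution_def)
    fix v h assume v: "H10_grad v h"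
    then have "v \<in> H10 \<Omega>" by (auto simp: H10_iff)
    then show "K (dirichlet_energy \<Omega> u) * (\<integral>x. g x \<bullet> h x \<partial>M) = (\<integral>x. \<alpha> x * u x powr q * v x \<partial>M)"
      using w unfolding weak_solution_def integral_weak_gradient_inner[OF g v, symmetric] by simp
  qed
  with w show "(\<exists>g. solves (K (dirichlet_energy \<Omega> u)) u g) \<and> dirichlet_energy \<Omega> u \<in> I"
    by (auto simp: weak_solution_def)
next
  assume "(\<exists>g. solves (K (dirichlet_energy \<Omega> u)) u g) \<and> dirichlet_energy \<Omega> u \<in> I"
  then obtain g where sol: "solves (K (dirichlet_energy \<Omega> u)) u g" and E: "dirichlet_energy \<Omega> u \<in> I" by blast
  have u: "AE x in M. 0 < u x" "H10_grad u g" using sol by (auto simp: solves_def)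
  show "weak_solution \<Omega> K I q \<alpha> u"
    unfolding weak_solution_def
  proof (intro conjI ballI E u(1))
    show "u \<in> H10 \<Omega>" using u(2) by (auto simp: H10_iff)
    fix v assume "v \<in> H10 \<Omega>"
    then obtain h where v: "H10_grad v h" by (auto simp: H10_iff)
    show "integrable M (\<lambda>x. \<alpha> x * u x powr q * v x)"
      by (intro square_integrable_mult square_integrable_\<alpha>_powr u(1) H10_grad_L2[OF u(2)]
          H10_grad_L2[OF v])
    show "K (dirichlet_energy \<Omega> u) * (\<integral>x. weak_gradient \<Omega> u x \<bullet> weak_gradient \<Omega> v x \<partial>M)
        - (\<integral>x. \<alpha> x * u x powr q * v x \<partial>M) = 0"
      using sol v integral_weak_gradient_inner[OF u(2) v] by (simp add: solves_def)
  qed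
qed

text \<open>The energy E equals (q + 1) F u. In \<open>F_le\<close> the quadratic part is at most E
  / 2, and 1 / (q + 1) - 1 / 2 is exactly the factor of the remaining term, so it cancels.\<close>

lemma solves_1_energy_le:
  assumes sol: "solves 1 u g" and ne: "\<Omega> \<noteq> {}"
  shows "sqnorm M g > 0"
    and "sqnorm M g \<le> (A / lambda1 \<Omega>) powr ((q + 1) / (1 - q)) * (\<integral>x. \<alpha> x \<partial>M)"
    and "lambda1 \<Omega> > 0"
proof -
  let ?B = "(A / lambda1 \<Omega>) powr ((q + 1) / (1 - q))"
  let ?w = "(1 - q) / (2 * (q + 1))"
  define E where "E = sqnorm M g"
  define S where "S = (\<integral>x. \<alpha> x \<partial>M)"
  have u: "AE x in M. 0 < u x" "H10_grad u g" using sol by (auto simp: solves_def)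
  have not0: "\<not> ae_eq \<Omega> u (\<lambda>x. 0)"
  proof
    assume "ae_eq \<Omega> u (\<lambda>x. 0)"
    then have "AE x in M. False" using u(1) unfolding ae_eq_def by eventually_elim simp
    then show False using not_AE_False[OF ne] by simp
  qed
  note l = lambda1_bounds[OF u(2) not0]
  show "lambda1 \<Omega> > 0" by (rule l(1))
  have "0 < (\<integral>x. (u x)\<^sup>2 \<partial>M)" by (rule integral_power2_pos[OF H10_grad_L2(1)[OF u(2)] not0])
  then have "0 < lambda1 \<Omega> * (\<integral>x. (u x)\<^sup>2 \<partial>M)" using l(1) by simp
  then show "sqnorm M g > 0" using l(2) by linarith
  \<comment> \<open>With this choice the definition of \<open>lambda1\<close> bounds the quadratic
    term by half the energy.\<close>
  define e where "e = lambda1 \<Omega> / A"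
  have e: "e > 0" using l(1) A_pos by (simp add: e_def)
  have "e powr (- (q + 1) / (1 - q)) = ?B"
  proof -
    have "(A / lambda1 \<Omega>) = inverse e" by (simp add: e_def)
    then show ?thesis by (simp only: inverse_powr minus_divide_left[symmetric] powr_minus)
  qed
  moreover have "F u = E / (q + 1)" using solves_energy[OF sol] by (simp add: F_def E_def)
  moreover have "1 / 2 * e * A * (\<integral>x. (u x)\<^sup>2 \<partial>M) \<le> E / 2"
    using l(2) A_pos by (simp add: e_def E_def)
  ultimately have "E / (q + 1) \<le> E / 2
      + ?w * ?B * S"
    using F_le[OF H10_grad_L2(1)[OF u(2)] e] by (simp add: S_def)
  moreover have "E / (q + 1) - E / 2 = ?w * E" using q by (simp add: field_simps)
  ultimately have "?w * E
      \<le> ?w * (?B * S)"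
    unfolding mult.assoc by linarith
  moreover have "?w > 0" using q by simp
  ultimately have "E \<le> ?B * S"
    by (simp only: mult_le_cancel_left_pos)
  then show "sqnorm M g \<le> ?B * (\<integral>x. \<alpha> x \<partial>M)"
    by (simp add: E_def S_def)
qed

text \<open>The exponent in \<open>c\<close> solves c powr (q - 1) = k. By uniqueness every solution
  with coefficient k has the energy of this rescaled one.\<close>

lemma solves_at:
  assumes sol: "solves 1 u g" and k: "k > 0"
  defines "c \<equiv> k powr (- 1 / (1 - q))"
  shows "solves k (\<lambda>x. c * u x) (\<lambda>x. c *\<^sub>R g x)"
    and "solves k w h \<Longrightarrow> k powr (2 / (1 - q)) * sqnorm M h = sqnorm M g"
proof -
  have c: "c > 0" using k by (simp add: c_def)
  have "c powr (q - 1) = k powr 1"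
  proof -
    have "- 1 / (1 - q) * (q - 1) = 1" using q by (simp add: field_simps)
    then show ?thesis by (simp only: c_def powr_powr)
  qed
  then show sol_k: "solves k (\<lambda>x. c * u x) (\<lambda>x. c *\<^sub>R g x)"
    using solves_scale[OF sol c] k by simp
  assume "solves k w h"
  from solves_energy_unique[OF k sol_k this]
  have "sqnorm M h = c\<^sup>2 * sqnorm M g"
    by (simp add: power_mult_distrib)
  moreover have "k powr (2 / (1 - q)) * c\<^sup>2 = 1"
  proof -
    have "c\<^sup>2 = k powr (- 1 / (1 - q) * 2)" unfolding c_def using k
      by (simp only: powr_powr[symmetric]) (simp add: powr_numeral)
    then show ?thesis using k by (simp flip: powr_add)
  qed
  ultimately show "k powr (2 / (1 - q)) * sqnorm M h = sqnorm M g"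
    by (simp flip: mult.assoc)
qed

end

text \<open>A root exists by the intermediate value theorem, and it is unique because the product of
  two positive increasing functions is strictly increasing.\<close>

lemma increasing_power_product:
  fixes K :: "real \<Rightarrow> real" and I :: "real set"
  assumes "is_interval I" "I \<subseteq> {0<..}" "strict_mono_on I K" "K ` I = {0<..}" "p > 0" "E > 0"
  shows "\<exists>t\<in>I. K t powr p * t = E"
    and "\<lbrakk>s \<in> I; t \<in> I; K s powr p * s = K t powr p * t\<rbrakk> \<Longrightarrow> s = t"
proof -
  have K_pos: "K t > 0" if "t \<in> I" for t using assms(4) that by auto
  have I_pos: "t > 0" if "t \<in> I" for t using assms(2) that by auto
  have K_less: "K s < K t" if "s \<in> I" "t \<in> I" "s < t" for s t
    using assms(3) that by (rule strict_mono_onD)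
  have K_le: "s \<le> t" if "s \<in> I" "t \<in> I" "K s \<le> K t" for s t
    using K_less[of t s] that by force
  \<comment> \<open>A monotone function with open image has no jumps.\<close>
  have "continuous_on I K"
  proof (rule continuous_onI_mono)
    show "K x \<le> K y" if "x \<in> I" "y \<in> I" "x \<le> y" for x y
      using K_less[of x y] that by (cases "x = y") auto
  qed (simp add: assms(4))
  then have cont: "continuous_on I (\<lambda>t. K t powr p * t)"
    using K_pos by (intro continuous_intros) fastforce+
  have "1 \<in> K ` I" unfolding assms(4) by simp
  then obtain s0 where s0: "s0 \<in> I" by blast
  \<comment> \<open>The value with k powr p s0 = E. Preimages of the minimum and the maximum of k
    and \<open>K s0\<close> lie on either side of s0, which makes the product at most E at t1 and at
    least E at t2.\<close>
  define k where "k = (E / s0) powr (1 / p)"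
  have k: "k > 0" "k powr p = E / s0" using assms(5,6) I_pos[OF s0] by (simp_all add: k_def powr_powr)
  have "min (K s0) k \<in> K ` I" unfolding assms(4) using K_pos[OF s0] k(1) by simp
  then obtain t1 where t1: "t1 \<in> I" "K t1 = min (K s0) k" by force
  have "max (K s0) k \<in> K ` I" unfolding assms(4) using k(1) by simp
  then obtain t2 where t2: "t2 \<in> I" "K t2 = max (K s0) k" by force
  have "t1 \<le> s0" "s0 \<le> t2" using K_le[OF t1(1) s0] K_le[OF s0 t2(1)] t1(2) t2(2) by auto
  have "K t1 powr p * t1 \<le> k powr p * s0"
    using t1 K_pos[OF t1(1)] I_pos[OF t1(1)] \<open>t1 \<le> s0\<close> assms(5) by (intro mult_mono powr_mono2) auto
  then have 1: "K t1 powr p * t1 \<le> E" using k(2) I_pos[OF s0] by simp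
  have "k powr p * s0 \<le> K t2 powr p * t2"
    using t2 k(1) I_pos[OF s0] \<open>s0 \<le> t2\<close> assms(5) by (intro mult_mono powr_mono2) auto
  then have 2: "E \<le> K t2 powr p * t2" using k(2) I_pos[OF s0] by simp
  have sub: "{t1..t2} \<subseteq> I"
    using mem_is_interval_1_I[OF assms(1) t1(1) t2(1)] by (simp add: subset_iff)
  have "\<exists>t\<ge>t1. t \<le> t2 \<and> K t powr p * t = E"
    using 1 2 \<open>t1 \<le> s0\<close> \<open>s0 \<le> t2\<close> by (intro IVT' continuous_on_subset[OF cont sub]) auto
  then obtain r where "r \<in> {t1..t2}" "K r powr p * r = E" by auto
  then show "\<exists>t\<in>I. K t powr p * t = E" using sub by blast
  have less: "K s powr p * s < K t powr p * t" if "s \<in> I" "t \<in> I" "s < t" for s t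
    using K_less[OF that] K_pos[OF that(1)] I_pos[OF that(1)] that(3) assms(5)
    by (intro mult_strict_mono powr_less_mono2) auto
  show "s = t" if "s \<in> I" "t \<in> I" "K s powr p * s = K t powr p * t"
    using less[of s t] less[of t s] that by (cases s t rule: linorder_cases) auto
qed

theorem theorem1p1:
  fixes \<Omega> :: "(real ^ 'n) set" and K :: "real \<Rightarrow> real" and I :: "real set"
    and q :: real and \<alpha> :: "real ^ 'n \<Rightarrow> real"
  assumes "smooth_bounded_domain \<Omega>"
    and "open I" and "is_interval I" and "I \<subseteq> {0<..}"
    and "strict_mono_on I K" and "K ` I = {0<..}"
    and "0 < q" and "q < 1"
    and "\<alpha> \<in> L_infinity \<Omega>" and "AE x in lebesgue_on \<Omega>. \<alpha> x > 0"
  shows "\<exists>u. weak_solution \<Omega> K I q \<alpha> u \<and>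
      (\<forall>w. weak_solution \<Omega> K I q \<alpha> w \<longrightarrow> ae_eq \<Omega> w u) \<and>
      is_arg_min (energy_functional \<Omega> (K (dirichlet_energy \<Omega> u)) q \<alpha>) (\<lambda>w. w \<in> H10 \<Omega>) u \<and>
      (\<forall>w. is_arg_min (energy_functional \<Omega> (K (dirichlet_energy \<Omega> u)) q \<alpha>) (\<lambda>w. w \<in> H10 \<Omega>) w
           \<longrightarrow> ae_eq \<Omega> w u) \<and>
      K (dirichlet_energy \<Omega> u) powr (2 / (1 - q)) * dirichlet_energy \<Omega> u
        \<le> ((2 / (q + 1))\<^sup>2 *
            (real_of_ereal (esssup (lebesgue_on \<Omega>) (\<lambda>x. ereal (\<alpha> x))) / lambda1 \<Omega>) powr (q + 1))
            powr (1 / (1 - q))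
          * (\<integral>x. \<alpha> x \<partial>lebesgue_on \<Omega>)"
proof -
  have ne: "\<Omega> \<noteq> {}" using assms(1) by (simp add: smooth_bounded_domain_def)
  interpret bounded_open_set \<Omega>
    using assms(1) by unfold_locales (simp_all add: smooth_bounded_domain_def)
  define A where "A = real_of_ereal (esssup M (\<lambda>x. ereal (\<alpha> x)))"
  have meas[measurable]: "\<alpha> \<in> borel_measurable M" using assms(9) by (simp add: L_infinity_def)
  have "esssup M (\<lambda>x. ereal (\<alpha> x)) \<le> esssup M (\<lambda>x. ereal \<bar>\<alpha> x\<bar>)"
    by (rule esssup_mono) auto
  also have "\<dots> < \<infinity>" using assms(9) by (simp add: L_infinity_def)
  finally have lt: "esssup M (\<lambda>x. ereal (\<alpha> x)) < \<infinity>" .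
  have le: "AE x in M. ereal (\<alpha> x) \<le> esssup M (\<lambda>x. ereal (\<alpha> x))" by (rule esssup_AE)
  have gt: "0 < esssup M (\<lambda>x. ereal (\<alpha> x))"
  proof (rule ccontr)
    assume n: "\<not> 0 < esssup M (\<lambda>x. ereal (\<alpha> x))"
    have "AE x in M. False"
      using le assms(10)
    proof eventually_elim
      case (elim x)
      then have "0 < ereal (\<alpha> x)" by simp
      then show False using elim n less_le_trans by blast
    qed
    then show False using not_AE_False[OF ne] by simp
  qed
  \<comment> \<open>Positivity and finiteness guarantee that \<open>real_of_ereal\<close> does not
    fall back on its default value 0.\<close>
  have A: "ereal A = esssup M (\<lambda>x. ereal (\<alpha> x))"
    unfolding A_def using lt gt by (intro ereal_real') auto
  interpret sublinear_problem \<Omega> q A \<alpha>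
  proof
    show "AE x in M. \<alpha> x \<le> A" using le by (simp flip: A)
    show "0 < A" using gt by (simp flip: A)
  qed (use assms in auto)
  let ?p = "2 / (1 - q)"
  have p: "?p > 0" using q by simp
  obtain u0 g0 where sol: "solves 1 u0 g0" using solves_1_exists by blast
  define E where "E = sqnorm M g0"
  note E = solves_1_energy_le[OF sol ne, folded E_def]
  \<comment> \<open>Solutions with coefficient K t have energy E / K t powr ?p; the Kirchhoff
    condition asks that this be t.\<close>
  obtain t where t: "t \<in> I" "K t powr ?p * t = E"
    using increasing_power_product(1)[OF assms(3-6) p E(1)] by blast
  have Kt: "K t > 0" using t(1) assms(6) by auto
  define c where "c = K t powr (- 1 / (1 - q))"
  define u where "u = (\<lambda>x. c * u0 x)"
  define g where "g = (\<lambda>x. c *\<^sub>R g0 x)"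
  have u: "solves (K t) u g"
    unfolding u_def g_def c_def by (rule solves_at(1)[OF sol Kt])
  have "K t powr ?p * sqnorm M g = E"
    unfolding E_def by (rule solves_at(2)[OF sol Kt u])
  then have "K t powr ?p * sqnorm M g = K t powr ?p * t" using t(2) by simp
  then have "sqnorm M g = t" using Kt by simp
  moreover have "H10_grad u g" using u by (simp add: solves_def)
  ultimately have Eu: "dirichlet_energy \<Omega> u = t" by (simp add: dirichlet_energy_H10_grad)
  have weak: "weak_solution \<Omega> K I q \<alpha> u" unfolding weak_solution_iff Eu using u t(1) by blast
  have unique: "ae_eq \<Omega> w u" if w: "weak_solution \<Omega> K I q \<alpha> w" for w
  proof -
    obtain h where h: "solves (K (dirichlet_energy \<Omega> w)) w h" and Ew: "dirichlet_energy \<Omega> w \<in> I"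
      using w unfolding weak_solution_iff by blast
    have "H10_grad w h" using h by (simp add: solves_def)
    then have "dirichlet_energy \<Omega> w = sqnorm M h" by (rule dirichlet_energy_H10_grad)
    moreover have "K (dirichlet_energy \<Omega> w) > 0" using Ew assms(6) by auto
    \<comment> \<open>The energy of any weak solution solves the same scalar equation, so it is t,
      and both solutions share the coefficient K t.\<close>
    ultimately have "K (dirichlet_energy \<Omega> w) powr ?p * dirichlet_energy \<Omega> w = E"
      using solves_at(2)[OF sol _ h] by (simp add: E_def)
    then have "dirichlet_energy \<Omega> w = t"
      using increasing_power_product(2)[OF assms(3-6) p E(1) Ew t(1)] t(2) by simp
    with h solves_unique[OF Kt u] show ?thesis by simp
  qed
  have arg_min: "is_arg_min (energy_functional \<Omega> (K t) q \<alpha>) (\<lambda>w. w \<in> H10 \<Omega>) u"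
    unfolding is_arg_min_def using solves_minimises(1)[OF Kt u] solves_in_H10[OF u] by (auto simp: not_less)
  have arg_min_unique: "ae_eq \<Omega> w u"
    if "is_arg_min (energy_functional \<Omega> (K t) q \<alpha>) (\<lambda>w. w \<in> H10 \<Omega>) w" for w
    using that solves_minimises(2)[OF Kt u] solves_in_H10[OF u] unfolding is_arg_min_def
    by (auto simp: not_less)
  have "K t powr ?p * t \<le> ((2 / (q + 1))\<^sup>2 * (A / lambda1 \<Omega>) powr (q + 1)) powr (1 / (1 - q)) * (\<integral>x. \<alpha> x \<partial>M)"
  proof -
    let ?B = "(A / lambda1 \<Omega>) powr ((q + 1) / (1 - q))"
    have "0 \<le> (\<integral>x. \<alpha> x \<partial>M)" using \<alpha>_pos by (intro integral_nonneg_AE) auto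
    \<comment> \<open>Young's inequality gave the bound with constant 1; the factor (2 / (q + 1))^2
      is at least 1 because q < 1.\<close>
    moreover have "1 \<le> ((2 / (q + 1))\<^sup>2) powr (1 / (1 - q))"
      using q by (intro ge_one_powr_ge_zero one_le_power) auto
    then have "1 * ?B \<le> ((2 / (q + 1))\<^sup>2) powr (1 / (1 - q)) * ?B" by (intro mult_right_mono) auto
    then have "?B \<le> ((2 / (q + 1))\<^sup>2 * (A / lambda1 \<Omega>) powr (q + 1)) powr (1 / (1 - q))"
      by (simp add: powr_mult powr_powr)
    ultimately show ?thesis using E(2) t(2) by (smt (verit) mult_right_mono)
  qed
  then show ?thesis
    using weak unique arg_min arg_min_unique by (intro exI[of _ u]) (simp add: Eu A_def)
qed

end
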